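(* Let $W:\mathcal{X}\to\mathcal{S}(B)$ be a cq-channel, and let $T=(T_y:y\in\mathcal{Y})$ be an informationally complete POVM on $B$ with $\infty>|\mathcal{Y}|\ge|B|^2$. Then for any $\lambda_1,\lambda_2>0$ with $\lambda_1+\lambda_2<1$, \[ \frac14\,\underline{d}_M\!\left(\sqrt{\widehat{\mathcal{X}}}\right)\;\le\;\dot{C}^{\mathrm{sim}}_{\mathrm{DI}}(W)\;\le\;\liminf_{n\to\infty}\frac{1}{n\log n}\log N_{\mathrm{DI}}(n,\lambda_1,\lambda_2)\;\le\;\frac12\,\underline{d}_M\!\left(\sqrt{\widetilde{\mathcal{X}}}\right). \]
   Context: $B$ is a finite-dimensional complex Hilbert space, $\mathcal{S}(B)$ the set of density matrices on $B$, $\mathcal{X}$ a measurable space. A cq-channel is a measurable map $W:\mathcal{X}\to\mathcal{S}(B)$, $x\mapsto W_x$; for $x^n\in\mathcal{X}^n$, $W_{x^n}=W_{x_1}\otimes\cdots\otimes W_{x_n}$. An $(n,N,\lambda_1,\lambda_2)$-deterministic identification (DI) code is a family $\{(u_j,E_j):j\in[N]\}$ with $u_j\in\mathcal{X}^n$ and operators $0\le E_j\le\mathbb{1}$ on $B^{\otimes n}$ such that $\mathrm{Tr}\,W_{u_j}E_j\ge1-\lambda_1$ for all $j$ and $\mathrm{Tr}\,W_{u_j}E_k\le\lambda_2$ for all $j\ne k$. It is simultaneous if there is a POVM $(D_m:m\in\mathcal{M})$ on $B^{\otimes n}$ and subsets $\mathcal{M}_j\subset\mathcal{M}$ with $E_j=\sum_{m\in\mathcal{M}_j}D_m$.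 $N_{\mathrm{DI}}(n,\lambda_1,\lambda_2)$ and $N^{\mathrm{sim}}_{\mathrm{DI}}(n,\lambda_1,\lambda_2)$ are the largest $N$ for general and simultaneous DI codes. Logarithms base 2; $\dot{C}^{\mathrm{sim}}_{\mathrm{DI}}(W)=\inf_{\lambda_1,\lambda_2>0}\liminf_{n\to\infty}\frac{1}{n\log n}\log N^{\mathrm{sim}}_{\mathrm{DI}}(n,\lambda_1,\lambda_2)$. A POVM $T=(T_y)_{y\in\mathcal{Y}}$ ($T_y\ge0$, $\sum_yT_y=\mathbb{1}$) is informationally complete if $\sigma\mapsto(\mathrm{Tr}\,\sigma T_y)_y$ is injective on $\mathcal{S}(B)$. Set $\widehat{\mathcal{X}}=\{(\mathrm{Tr}\,W_xT_y)_{y\in\mathcal{Y}}:x\in\mathcal{X}\}\subset\mathcal{P}(\mathcal{Y})$ and $\sqrt{\widehat{\mathcal{X}}}=\{(\sqrt{\mathrm{Tr}\,W_xT_y})_{y}:x\in\mathcal{X}\}\subset\mathbb{R}^{\mathcal{Y}}$ with the Euclidean metric; set $\widetilde{\mathcal{X}}=\{W_x:x\in\mathcal{X}\}$ and $\sqrt{\widetilde{\mathcal{X}}}=\{\sqrt{\sigma}:\sigma\in\widetilde{\mathcal{X}}\}$ with the Hilbert–Schmidt metric $\|M-M'\|_2=\sqrt{\mathrm{Tr}(M-M')^2}$ on Hermitian matrices. For a nonempty bounded set $F$ in a finite-dimensional normed real space, $\Gamma_\delta(F)$ is the minimum number of closed balls of radius $\delta$ centered in $F$ covering $F$, and $\underline{d}_M(F)=\liminf_{\delta\to0}\frac{\log\Gamma_\delta(F)}{-\log\delta}$.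 *)

theory Defs
  imports "HOL-Analysis.Analysis" "HOL-Library.Complex_Order" "Jordan_Normal_Form.Matrix"
begin

text \<open>Operators on B = C^d are d x d complex matrices (Jordan_Normal_Form).\<close>

definition mtrace :: "complex mat \<Rightarrow> complex" where
  "mtrace A = (\<Sum>i<dim_row A. A $$ (i, i))"

text \<open>Positive semidefinite (over C this includes Hermiticity).\<close>
definition psd :: "nat \<Rightarrow> complex mat \<Rightarrow> bool" where
  "psd d A \<longleftrightarrow> A \<in> carrier_mat d d \<and>
     (\<forall>v::nat \<Rightarrow> complex. (\<Sum>i<d. \<Sum>j<d. cnj (v i) * A $$ (i, j) * v j) \<ge> 0)"

definition effect :: "nat \<Rightarrow> complex mat \<Rightarrow> bool" where
  "effect d E \<longleftrightarrow> psd d E \<and> psd d (1\<^sub>m d - E)"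

definition density :: "nat \<Rightarrow> complex mat \<Rightarrow> bool" where
  "density d \<rho> \<longleftrightarrow> psd d \<rho> \<and> mtrace \<rho> = 1"

definition msum :: "nat \<Rightarrow> ('i \<Rightarrow> complex mat) \<Rightarrow> 'i set \<Rightarrow> complex mat" where
  "msum d f I = mat d d (\<lambda>(i, j). \<Sum>m\<in>I. f m $$ (i, j))"

definition kron :: "complex mat \<Rightarrow> complex mat \<Rightarrow> complex mat" where
  "kron A B = mat (dim_row A * dim_row B) (dim_col A * dim_col B)
     (\<lambda>(i, j). A $$ (i div dim_row B, j div dim_col B) * B $$ (i mod dim_row B, j mod dim_col B))"

definition tensor_word :: "('x \<Rightarrow> complex mat) \<Rightarrow> 'x list \<Rightarrow> complex mat" where
  "tensor_word W xs = foldr (\<lambda>x R. kron (W x) R) xs (1\<^sub>m 1)"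

definition cq_channel :: "'x measure \<Rightarrow> nat \<Rightarrow> ('x \<Rightarrow> complex mat) \<Rightarrow> bool" where
  "cq_channel X d W \<longleftrightarrow> (\<forall>x\<in>space X. density d (W x)) \<and>
     (\<forall>i<d. \<forall>j<d. (\<lambda>x. W x $$ (i, j)) \<in> borel_measurable X)"

definition DI_code :: "'x measure \<Rightarrow> nat \<Rightarrow> ('x \<Rightarrow> complex mat) \<Rightarrow> nat \<Rightarrow> nat \<Rightarrow> real \<Rightarrow> real
    \<Rightarrow> (nat \<Rightarrow> 'x list) \<Rightarrow> (nat \<Rightarrow> complex mat) \<Rightarrow> bool" where
  "DI_code X d W n N l1 l2 u E \<longleftrightarrow>
     (\<forall>j<N. length (u j) = n \<and> set (u j) \<subseteq> space X \<and> effect (d ^ n) (E j)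
        \<and> Re (mtrace (tensor_word W (u j) * E j)) \<ge> 1 - l1) \<and>
     (\<forall>j<N. \<forall>k<N. j \<noteq> k \<longrightarrow> Re (mtrace (tensor_word W (u j) * E k)) \<le> l2)"

definition sim_DI_code :: "'x measure \<Rightarrow> nat \<Rightarrow> ('x \<Rightarrow> complex mat) \<Rightarrow> nat \<Rightarrow> nat \<Rightarrow> real \<Rightarrow> real
    \<Rightarrow> (nat \<Rightarrow> 'x list) \<Rightarrow> (nat \<Rightarrow> complex mat) \<Rightarrow> bool" where
  "sim_DI_code X d W n N l1 l2 u E \<longleftrightarrow> DI_code X d W n N l1 l2 u E \<and>
     (\<exists>(Mset :: nat set) (D :: nat \<Rightarrow> complex mat) (M :: nat \<Rightarrow> nat set).
        finite Mset \<and> (\<forall>m\<in>Mset. psd (d ^ n) (D m)) \<and> msum (d ^ n) D Mset = 1\<^sub>m (d ^ n) \<and>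
        (\<forall>j<N. M j \<subseteq> Mset \<and> E j = msum (d ^ n) D (M j)))"

definition N_DI :: "'x measure \<Rightarrow> nat \<Rightarrow> ('x \<Rightarrow> complex mat) \<Rightarrow> nat \<Rightarrow> real \<Rightarrow> real \<Rightarrow> enat" where
  "N_DI X d W n l1 l2 = Sup {enat N | N. \<exists>u E. DI_code X d W n N l1 l2 u E}"

definition N_DI_sim :: "'x measure \<Rightarrow> nat \<Rightarrow> ('x \<Rightarrow> complex mat) \<Rightarrow> nat \<Rightarrow> real \<Rightarrow> real \<Rightarrow> enat" where
  "N_DI_sim X d W n l1 l2 = Sup {enat N | N. \<exists>u E. sim_DI_code X d W n N l1 l2 u E}"

definition log2_enat :: "enat \<Rightarrow> ereal" where
  "log2_enat N = (case N of \<infinity> \<Rightarrow> \<infinity> | enat k \<Rightarrow> (if k = 0 then -\<infinity> else ereal (log 2 (real k))))"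

definition DI_rate :: "(nat \<Rightarrow> enat) \<Rightarrow> ereal" where
  "DI_rate Nf = liminf (\<lambda>n. log2_enat (Nf n) / ereal (real n * log 2 (real n)))"

definition C_DI_sim_dot :: "'x measure \<Rightarrow> nat \<Rightarrow> ('x \<Rightarrow> complex mat) \<Rightarrow> ereal" where
  "C_DI_sim_dot X d W = (INF l\<in>{l::real \<times> real. fst l > 0 \<and> snd l > 0}.
      DI_rate (\<lambda>n. N_DI_sim X d W n (fst l) (snd l)))"

definition cover_num :: "('p \<Rightarrow> 'p \<Rightarrow> real) \<Rightarrow> 'p set \<Rightarrow> real \<Rightarrow> nat" where
  "cover_num dst F \<delta> = (LEAST k. \<exists>C. finite C \<and> card C = k \<and> C \<subseteq> F \<and>
      F \<subseteq> (\<Union>c\<in>C. {p. dst c p \<le> \<delta>}))"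

definition lower_mink_dim :: "('p \<Rightarrow> 'p \<Rightarrow> real) \<Rightarrow> 'p set \<Rightarrow> ereal" where
  "lower_mink_dim dst F = Liminf (at_right 0)
      (\<lambda>\<delta>. ereal (log 2 (real (cover_num dst F \<delta>)) / - log 2 \<delta>))"

definition info_complete_povm :: "nat \<Rightarrow> nat \<Rightarrow> (nat \<Rightarrow> complex mat) \<Rightarrow> bool" where
  "info_complete_povm d k T \<longleftrightarrow> (\<forall>y<k. psd d (T y)) \<and> msum d T {..<k} = 1\<^sub>m d \<and>
     (\<forall>\<sigma> \<sigma>'. density d \<sigma> \<longrightarrow> density d \<sigma>' \<longrightarrow>
        (\<forall>y<k. mtrace (\<sigma> * T y) = mtrace (\<sigma>' * T y)) \<longrightarrow> \<sigma> = \<sigma>')"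

definition euclid_dist :: "nat \<Rightarrow> (nat \<Rightarrow> real) \<Rightarrow> (nat \<Rightarrow> real) \<Rightarrow> real" where
  "euclid_dist k p q = sqrt (\<Sum>y<k. (p y - q y)\<^sup>2)"

text \<open>Hilbert-Schmidt metric on Hermitian matrices.\<close>
definition hs_dist :: "complex mat \<Rightarrow> complex mat \<Rightarrow> real" where
  "hs_dist M M' = sqrt (Re (mtrace ((M - M') * (M - M'))))"

definition psd_sqrt :: "nat \<Rightarrow> complex mat \<Rightarrow> complex mat" where
  "psd_sqrt d A = (THE S. psd d S \<and> S * S = A)"

definition sqrt_hat_X :: "'x measure \<Rightarrow> nat \<Rightarrow> ('x \<Rightarrow> complex mat) \<Rightarrow> nat \<Rightarrow> (nat \<Rightarrow> complex mat)
    \<Rightarrow> (nat \<Rightarrow> real) set" where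
  "sqrt_hat_X X d W k T = (\<lambda>x. \<lambda>y. if y < k then sqrt (Re (mtrace (W x * T y))) else 0) ` space X"

definition sqrt_tilde_X :: "'x measure \<Rightarrow> nat \<Rightarrow> ('x \<Rightarrow> complex mat) \<Rightarrow> complex mat set" where
  "sqrt_tilde_X X d W = psd_sqrt d ` (W ` space X)"

end

theory Submission
  imports Defs "HOL-Real_Asymp.Real_Asymp"
begin

text \<open>
  Upper bound. Cover the set of square roots of the channel outputs with radius \<open>\<delta> = c / sqrt n\<close> and
  quantize codewords letterwise. If two codewords get the same quantization, then the square roots \<open>A\<close>, \<open>B\<close>
  of their output states satisfy \<open>Tr A B \<ge> (1 - 2 \<delta>\<^sup>2)\<^sup>n\<close>, so the squared Hilbert--Schmidt distance of \<open>A\<close>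
  and \<open>B\<close> is at most \<open>4 n \<delta>\<^sup>2 = 4 c\<^sup>2\<close>, and for small \<open>c\<close> no effect separates \<open>A\<^sup>2\<close> from \<open>B\<^sup>2\<close> well enough
  for a code. Hence the number of codewords is at most the \<open>n\<close>-th power of the covering number.

  Lower bound. Measuring every system with \<open>T\<close> gives a classical channel with a finite output alphabet.
  Take a packing of the square-root output distributions at distance \<open>\<kappa> n powr (-1/4)\<close>, and from its
  \<open>n\<close>-letter words choose a code with relative Hamming distance \<open>t\<close> all of whose entropies lie within
  \<open>sqrt n\<close> of each other. The test for a codeword is membership in its entropy-typical set: an output
  typical for two codewords has likelihood ratio \<open>exp (O(sqrt n))\<close>, while the Hellinger affinity of the two
  output distributions is at most \<open>exp (- t \<kappa>\<^sup>2 sqrt n / 2)\<close>, which wins for large \<open>\<kappa>\<close>.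
\<close>

section \<open>Quadratic forms of complex matrices\<close>

text \<open>The factors 1/2 and 1/4 are scales of \<open>\<delta>\<close>: for
  \<open>\<delta>\<close> of order \<open>n powr (-b)\<close> the logarithm of the covering number
  is on the scale of \<open>b * dim * log 2 n\<close> per letter. Indistinguishability only asks
  that \<open>n * \<delta>\<^sup>2\<close> be small, hence b = 1/2. The typicality test asks that
  the affinity exponent, of order \<open>n * \<delta>\<^sup>2\<close>, beat the fluctuations of the
  log-likelihood, of order \<open>sqrt n\<close>, hence b = 1/4. As rates are measured against
  \<open>n * log 2 n\<close>, factors like \<open>2 ^ n\<close> and polynomials in n cost nothing.
  This permits a crude count of Hamming balls and the restriction to one entropy bin. Binning is
  there because joint typicality compares two likelihoods only up to the difference of the
  entropies. Letter probabilities may be arbitrarily small, and the alphabet changes with n, so the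
  variance bound has to be uniform over all distributions on the output alphabet. Codes exist at
  integer n only, while the dimension is a lower limit over real \<open>\<delta>\<close>;
  monotonicity of the covering number bridges the two in the upper bound. Matrix square roots are
  obtained from quadratic forms and a power series, without diagonalization.\<close>

definition ip :: "nat \<Rightarrow> (nat \<Rightarrow> complex) \<Rightarrow> (nat \<Rightarrow> complex) \<Rightarrow> complex" where
  "ip d v w = (\<Sum>i<d. cnj (v i) * w i)"

definition mv :: "nat \<Rightarrow> complex mat \<Rightarrow> (nat \<Rightarrow> complex) \<Rightarrow> nat \<Rightarrow> complex" where
  "mv d A v i = (\<Sum>j<d. A $$ (i, j) * v j)"

definition herm :: "nat \<Rightarrow> complex mat \<Rightarrow> bool" where
  "herm d A \<longleftrightarrow> A \<in> carrier_mat d d \<and> (\<forall>i<d. \<forall>j<d. A $$ (i, j) = cnj (A $$ (j, i)))"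

lemma psd_iff: "psd d A \<longleftrightarrow> A \<in> carrier_mat d d \<and> (\<forall>v. 0 \<le> ip d v (mv d A v))"
  by (simp add: psd_def ip_def mv_def sum_distrib_left mult.assoc)

lemma ip_add_right: "ip d v (\<lambda>i. w i + w' i) = ip d v w + ip d v w'"
  and ip_add_left: "ip d (\<lambda>i. w i + w' i) v = ip d w v + ip d w' v"
  and ip_diff_right: "ip d v (\<lambda>i. w i - w' i) = ip d v w - ip d v w'"
  and ip_diff_left: "ip d (\<lambda>i. w i - w' i) v = ip d w v - ip d w' v"
  and ip_scale_right: "ip d v (\<lambda>i. c * w i) = c * ip d v w"
  and ip_scale_left: "ip d (\<lambda>i. c * w i) v = cnj c * ip d w v"
  by (simp_all add: ip_def algebra_simps sum.distrib sum_subtractf sum_distrib_left)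

lemmas ip_linear = ip_add_right ip_add_left ip_diff_right ip_diff_left ip_scale_right ip_scale_left

text \<open>Vectors are functions on all naturals of which only the first \<open>d\<close> values
  count, as in \<open>psd_def\<close>. Matrix identities hold below \<open>d\<close> only; this rule
  carries them into forms.\<close>

lemma ip_cong: "(\<And>i. i < d \<Longrightarrow> v i = v' i) \<Longrightarrow> (\<And>i. i < d \<Longrightarrow> w i = w' i) \<Longrightarrow> ip d v w = ip d v' w'"
  by (simp add: ip_def)

lemma cnj_ip: "cnj (ip d v w) = ip d w v"
  by (simp add: ip_def mult.commute)

lemma ip_self: "ip d v v = of_real (\<Sum>i<d. (cmod (v i))\<^sup>2)"
  by (simp add: ip_def complex_norm_square[symmetric] mult.commute)

lemma Re_ip_self: "Re (ip d v v) = (\<Sum>i<d. (cmod (v i))\<^sup>2)"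
  by (simp only: ip_self Re_complex_of_real)

lemma Re_ip_self_nonneg: "0 \<le> Re (ip d v v)"
  by (simp add: Re_ip_self sum_nonneg)

lemma mv_add: "mv d A (\<lambda>i. v i + w i) = (\<lambda>i. mv d A v i + mv d A w i)"
  and mv_diff: "mv d A (\<lambda>i. v i - w i) = (\<lambda>i. mv d A v i - mv d A w i)"
  and mv_scale: "mv d A (\<lambda>i. c * v i) = (\<lambda>i. c * mv d A v i)"
  by (simp_all add: mv_def fun_eq_iff algebra_simps sum.distrib sum_subtractf sum_distrib_left)

lemmas mv_linear = mv_add mv_diff mv_scale

lemma index_mult_mat_sum:
  "A \<in> carrier_mat n m \<Longrightarrow> B \<in> carrier_mat m l \<Longrightarrow> i < n \<Longrightarrow> j < l \<Longrightarrow>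
    (A * B) $$ (i, j) = (\<Sum>k<m. A $$ (i, k) * B $$ (k, j))"
  by (auto simp: scalar_prod_def lessThan_atLeast0 intro!: sum.cong)

lemma mv_mult:
  assumes "A \<in> carrier_mat d d" "B \<in> carrier_mat d d" "i < d"
  shows "mv d (A * B) v i = mv d A (mv d B v) i"
proof -
  have "mv d (A * B) v i = (\<Sum>j<d. \<Sum>k<d. A $$ (i, k) * B $$ (k, j) * v j)"
    unfolding mv_def by (intro sum.cong refl)
      (simp add: index_mult_mat_sum[OF assms] sum_distrib_right del: index_mult_mat)
  also have "\<dots> = (\<Sum>k<d. \<Sum>j<d. A $$ (i, k) * B $$ (k, j) * v j)"
    by (rule sum.swap)
  finally show ?thesis by (simp add: mv_def sum_distrib_left mult.assoc)
qed

lemma herm_carrier [dest]: "herm d A \<Longrightarrow> A \<in> carrier_mat d d"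
  by (simp add: herm_def)

lemma psd_carrier [dest]: "psd d A \<Longrightarrow> A \<in> carrier_mat d d"
  by (simp add: psd_def)

lemma hermD: "herm d A \<Longrightarrow> i < d \<Longrightarrow> j < d \<Longrightarrow> cnj (A $$ (i, j)) = A $$ (j, i)"
  unfolding herm_def by metis

lemma herm_ip: "herm d A \<Longrightarrow> ip d v (mv d A w) = ip d (mv d A v) w"
proof -
  assume h: "herm d A"
  have "ip d v (mv d A w) = (\<Sum>i<d. \<Sum>j<d. cnj (v i) * A $$ (i, j) * w j)"
    by (simp add: ip_def mv_def sum_distrib_left mult.assoc)
  also have "\<dots> = (\<Sum>j<d. \<Sum>i<d. cnj (v i) * A $$ (i, j) * w j)"
    by (rule sum.swap)
  also have "\<dots> = (\<Sum>j<d. \<Sum>i<d. cnj (A $$ (j, i) * v i) * w j)"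
    by (intro sum.cong refl) (simp add: hermD[OF h])
  finally show ?thesis
    by (simp add: ip_def mv_def sum_distrib_right)
qed

lemma ip_unit:
  assumes "i < d" "j < d"
  shows "ip d (\<lambda>k. if k = i then 1 else 0) (mv d A (\<lambda>k. if k = j then 1 else 0)) = A $$ (i, j)"
  using assms by (simp add: ip_def mv_def if_distrib[of cnj] if_distrib[of "\<lambda>x. x * _"] if_distrib[of "\<lambda>x. _ * x"] cong: if_cong)

text \<open>By polarization, since the form is real on the diagonal.\<close>
lemma psd_herm: "psd d A \<Longrightarrow> herm d A"
proof -
  assume p: "psd d A"
  let ?B = "\<lambda>v w. ip d v (mv d A w)"
  have real: "Im (?B v v) = 0" for v
    using p by (simp add: psd_iff less_eq_complex_def)
  have "?B v w = cnj (?B w v)" for v w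
  proof -
    have "Im (?B v w + ?B w v) = 0"
      using real[of "\<lambda>i. v i + w i"] real[of v] real[of w] by (simp add: mv_linear ip_linear)
    moreover have "Re (?B v w - ?B w v) = 0"
      using real[of "\<lambda>i. v i + \<i> * w i"] real[of v] real[of w] by (simp add: mv_linear ip_linear)
    ultimately show ?thesis by (simp add: complex_eq_iff)
  qed
  then have "A $$ (i, j) = cnj (A $$ (j, i))" if "i < d" "j < d" for i j
    using that ip_unit[of i d j A] ip_unit[of j d i A] by metis
  then show ?thesis using psd_carrier[OF p] unfolding herm_def by blast
qed

lemma psd_Re: "psd d A \<Longrightarrow> 0 \<le> Re (ip d v (mv d A v))"
  by (simp add: psd_iff less_eq_complex_def)

lemma psd_of_Re:
  assumes "herm d A" "\<And>v. 0 \<le> Re (ip d v (mv d A v))"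
  shows "psd d A"
proof -
  have "Im (ip d v (mv d A v)) = 0" for v
    by (metis assms(1) cnj_ip herm_ip Reals_cnj_iff complex_is_Real_iff)
  then show ?thesis using assms by (auto simp: psd_iff less_eq_complex_def)
qed

text \<open>The form of \<open>A * A\<close> at \<open>v\<close> is the squared norm of
  \<open>A v\<close>.\<close>

lemma herm_square_psd: "herm d A \<Longrightarrow> psd d (A * A)"
proof -
  assume h: "herm d A"
  then have c: "A \<in> carrier_mat d d" by auto
  have "ip d v (mv d (A * A) v) = ip d (mv d A v) (mv d A v)" for v
  proof -
    have "ip d v (mv d (A * A) v) = ip d v (mv d A (mv d A v))"
      by (intro ip_cong) (auto simp: mv_mult[OF c c])
    then show ?thesis using herm_ip[OF h] by simp
  qed
  then show ?thesis using c Re_ip_self_nonneg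
    by (auto simp: psd_iff less_eq_complex_def ip_self sum_nonneg)
qed

lemma mv_smult: "A \<in> carrier_mat d d \<Longrightarrow> i < d \<Longrightarrow> mv d (c \<cdot>\<^sub>m A) v i = c * mv d A v i"
  by (simp add: mv_def sum_distrib_left mult.assoc)

lemma mv_minus: "A \<in> carrier_mat d d \<Longrightarrow> B \<in> carrier_mat d d \<Longrightarrow> i < d \<Longrightarrow> mv d (A - B) v i = mv d A v i - mv d B v i"
  by (simp add: mv_def sum_subtractf algebra_simps)

lemma mv_one: "i < d \<Longrightarrow> mv d (1\<^sub>m d) v i = v i"
  by (simp add: mv_def if_distrib[of "\<lambda>x. x * _"] cong: if_cong)

lemma ip_mv_smult: "A \<in> carrier_mat d d \<Longrightarrow> ip d v (mv d (c \<cdot>\<^sub>m A) w) = c * ip d v (mv d A w)"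
  unfolding ip_scale_right[symmetric] by (intro ip_cong refl mv_smult)

lemma ip_mv_minus: "A \<in> carrier_mat d d \<Longrightarrow> B \<in> carrier_mat d d \<Longrightarrow>
    ip d v (mv d (A - B) w) = ip d v (mv d A w) - ip d v (mv d B w)"
  unfolding ip_diff_right[symmetric] by (intro ip_cong refl mv_minus)

lemma ip_mv_one: "ip d v (mv d (1\<^sub>m d) w) = ip d v w"
  by (intro ip_cong refl mv_one)

lemma effect_le: "effect d E \<Longrightarrow> Re (ip d v (mv d E v)) \<le> Re (ip d v v)"
  using psd_Re[of d "1\<^sub>m d - E" v] by (auto simp: effect_def ip_mv_minus ip_mv_one)

text \<open>Evaluate the form of \<open>A\<close> at \<open>v - A v\<close>.\<close>
lemma psd_contraction:
  assumes p: "psd d A" and le: "\<And>v. Re (ip d v (mv d A v)) \<le> Re (ip d v v)"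
  shows "Re (ip d (mv d A v) (mv d A v)) \<le> Re (ip d v (mv d A v))"
proof -
  note h = herm_ip[OF psd_herm[OF p]]
  let ?w = "mv d A v"
  have "0 \<le> Re (ip d (\<lambda>i. v i - ?w i) (mv d A (\<lambda>i. v i - ?w i)))"
    by (rule psd_Re[OF p])
  also have "\<dots> = Re (ip d v ?w) - 2 * Re (ip d ?w ?w) + Re (ip d ?w (mv d A ?w))"
    using h[of v ?w] by (simp add: mv_linear ip_linear)
  finally show ?thesis using le[of ?w] by linarith
qed

text \<open>A crude bound through the moduli of the entries, in place of the operator norm. Dividing
  by the constant brings the form below the squared norm, as \<open>psd_contraction\<close>
  requires.\<close>

lemma psd_bounded:
  assumes "psd d A"
  shows "\<exists>c>0. \<forall>v. Re (ip d v (mv d A v)) \<le> c * Re (ip d v v)"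
proof -
  let ?c = "\<Sum>i<d. \<Sum>j<d. cmod (A $$ (i, j))"
  have "Re (ip d v (mv d A v)) \<le> (?c + 1) * Re (ip d v v)" for v
  proof -
    let ?s = "Re (ip d v v)"
    have "cmod (v i) * cmod (v j) \<le> ?s" if "i < d" "j < d" for i j
    proof -
      have le: "(cmod (v l))\<^sup>2 \<le> ?s" if "l < d" for l
        unfolding Re_ip_self using that by (intro member_le_sum) auto
      have "cmod (v l) \<le> sqrt ?s" if "l < d" for l
        using le[OF that] by (simp add: real_le_rsqrt)
      then have "cmod (v i) * cmod (v j) \<le> sqrt ?s * sqrt ?s"
        using that by (intro mult_mono) (auto simp: Re_ip_self_nonneg)
      then show ?thesis by (simp add: Re_ip_self_nonneg)
    qed
    note vv = this
    have "Re (ip d v (mv d A v)) \<le> cmod (\<Sum>i<d. \<Sum>j<d. cnj (v i) * (A $$ (i, j) * v j))"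
      unfolding ip_def mv_def sum_distrib_left by (rule complex_Re_le_cmod)
    also have "\<dots> \<le> (\<Sum>i<d. \<Sum>j<d. cmod (A $$ (i, j)) * ?s)"
    proof (intro order.trans[OF norm_sum] sum_mono)
      fix i j assume "i \<in> {..<d}" "j \<in> {..<d}"
      then show "cmod (cnj (v i) * (A $$ (i, j) * v j)) \<le> cmod (A $$ (i, j)) * ?s"
        using mult_left_mono[OF vv[of i j], of "cmod (A $$ (i, j))"] by (simp add: norm_mult algebra_simps)
    qed
    also have "\<dots> = ?c * ?s" by (simp add: sum_distrib_right)
    also have "\<dots> \<le> (?c + 1) * ?s" by (intro mult_right_mono) (auto simp: Re_ip_self_nonneg)
    finally show ?thesis .
  qed
  \<comment> \<open>The added 1 keeps the constant positive for the zero matrix as well, so that it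
    can be divided by.\<close>
  moreover have "?c + 1 > 0" by (simp add: sum_nonneg add_nonneg_pos)
  ultimately show ?thesis by blast
qed

lemma herm_smult: "herm d A \<Longrightarrow> herm d (of_real c \<cdot>\<^sub>m A)"
  unfolding herm_def
proof (elim conjE, intro conjI allI impI)
  fix i j assume A: "A \<in> carrier_mat d d" and ij: "i < d" "j < d"
    and h: "\<forall>i<d. \<forall>j<d. A $$ (i, j) = cnj (A $$ (j, i))"
  have "A $$ (i, j) = cnj (A $$ (j, i))" using h ij by blast
  with A ij show "(of_real c \<cdot>\<^sub>m A) $$ (i, j) = cnj ((of_real c \<cdot>\<^sub>m A) $$ (j, i))"
    by (simp del: complex_cnj_cancel_iff)
qed (rule smult_carrier_mat)

lemma psd_smult:
  assumes "psd d A" "c \<ge> 0"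
  shows "psd d (of_real c \<cdot>\<^sub>m A)"
proof (rule psd_of_Re[OF herm_smult[OF psd_herm[OF assms(1)]]])
  show "0 \<le> Re (ip d v (mv d (of_real c \<cdot>\<^sub>m A) v))" for v
    using assms psd_Re[OF assms(1), of v] by (simp add: ip_mv_smult[OF psd_carrier])
qed

text \<open>After scaling, \<open>psd_contraction\<close> bounds the squared norm of the image of
  \<open>v\<close> by the form at \<open>v\<close>, which vanishes. This is what makes positive
  square roots unique.\<close>

lemma psd_null:
  assumes p: "psd d A" and z: "Re (ip d v (mv d A v)) = 0" and i: "i < d"
  shows "mv d A v i = 0"
proof -
  obtain c where c: "c > 0" "\<And>v. Re (ip d v (mv d A v)) \<le> c * Re (ip d v v)"
    using psd_bounded[OF p] by blast
  let ?B = "of_real (1 / c) \<cdot>\<^sub>m A"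
  have car: "A \<in> carrier_mat d d" using p by auto
  have "Re (ip d (mv d ?B v) (mv d ?B v)) \<le> Re (ip d v (mv d ?B v))"
  proof (rule psd_contraction)
    show "psd d ?B" using c(1) by (intro psd_smult[OF p]) auto
    show "Re (ip d w (mv d ?B w)) \<le> Re (ip d w w)" for w
      using c(1) c(2)[of w] by (simp add: ip_mv_smult[OF car] field_simps)
  qed
  also have "\<dots> = 0" using z by (simp add: ip_mv_smult[OF car])
  finally have le: "(\<Sum>i<d. (cmod (mv d ?B v i))\<^sup>2) \<le> 0" by (simp add: Re_ip_self)
  have "(cmod (mv d ?B v i))\<^sup>2 \<le> (\<Sum>i<d. (cmod (mv d ?B v i))\<^sup>2)"
    using i by (intro member_le_sum) auto
  with le have "(cmod (mv d ?B v i))\<^sup>2 \<le> 0" by linarith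
  then have "mv d ?B v i = 0" by simp
  then show ?thesis using c(1) i by (simp add: mv_smult[OF car])
qed

section \<open>Traces of products as sums over columns\<close>

definition mcol :: "complex mat \<Rightarrow> nat \<Rightarrow> nat \<Rightarrow> complex" where
  "mcol A j i = A $$ (i, j)"

lemma mtrace_sum: "A \<in> carrier_mat d d \<Longrightarrow> mtrace A = (\<Sum>i<d. A $$ (i, i))"
  by (simp add: mtrace_def)

lemma mtrace_mult:
  assumes "A \<in> carrier_mat d d" "B \<in> carrier_mat d d"
  shows "mtrace (A * B) = (\<Sum>i<d. \<Sum>j<d. A $$ (i, j) * B $$ (j, i))"
  unfolding mtrace_sum[OF mult_carrier_mat[OF assms]]
  by (intro sum.cong refl) (simp add: index_mult_mat_sum[OF assms] del: index_mult_mat)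

lemma mtrace_mult_commute:
  assumes "A \<in> carrier_mat d d" "B \<in> carrier_mat d d"
  shows "mtrace (A * B) = mtrace (B * A)"
  unfolding mtrace_mult[OF assms] mtrace_mult[OF assms(2,1)]
  by (subst sum.swap) (simp add: mult.commute)

lemma mtrace_herm_mult:
  assumes "herm d A" "B \<in> carrier_mat d d"
  shows "mtrace (A * B) = (\<Sum>j<d. ip d (mcol A j) (mcol B j))"
proof -
  have "mtrace (A * B) = (\<Sum>j<d. \<Sum>i<d. A $$ (j, i) * B $$ (i, j))"
    using mtrace_mult[OF herm_carrier[OF assms(1)] assms(2)] .
  then show ?thesis using hermD[OF assms(1)] by (simp add: ip_def mcol_def)
qed

lemma mcol_mult:
  "A \<in> carrier_mat d d \<Longrightarrow> B \<in> carrier_mat d d \<Longrightarrow> i < d \<Longrightarrow> j < d \<Longrightarrow> mcol (A * B) j i = mv d A (mcol B j) i"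
  by (simp add: mcol_def mv_def index_mult_mat_sum del: index_mult_mat)

text \<open>Cyclicity puts \<open>E\<close> between the two factors \<open>A\<close>. The columns of
  \<open>A\<close> then act as unnormalized state vectors, and trace inequalities reduce to
  inequalities of forms, column by column.\<close>

lemma mtrace_sandwich:
  assumes A: "herm d A" and E: "E \<in> carrier_mat d d"
  shows "mtrace ((A * A) * E) = (\<Sum>j<d. ip d (mcol A j) (mv d E (mcol A j)))"
proof -
  note c = herm_carrier[OF A]
  have "mtrace ((A * A) * E) = mtrace (A * (E * A))"
    using mtrace_mult_commute[OF c mult_carrier_mat[OF c E]]
    by (simp only: assoc_mult_mat[OF c c E] assoc_mult_mat[OF c E c])
  also have "\<dots> = (\<Sum>j<d. ip d (mcol A j) (mcol (E * A) j))"
    by (rule mtrace_herm_mult[OF A mult_carrier_mat[OF E c]])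
  also have "\<dots> = (\<Sum>j<d. ip d (mcol A j) (mv d E (mcol A j)))"
    by (intro sum.cong refl ip_cong mcol_mult[OF E c]) simp_all
  finally show ?thesis .
qed

lemma psd_mtrace_sandwich:
  assumes "herm d A" "psd d E"
  shows "mtrace ((A * A) * E) = of_real (Re (mtrace ((A * A) * E)))" "0 \<le> Re (mtrace ((A * A) * E))"
proof -
  have "0 \<le> mtrace ((A * A) * E)"
    unfolding mtrace_sandwich[OF assms(1) psd_carrier[OF assms(2)]]
    using assms(2) by (intro sum_nonneg) (simp add: psd_iff)
  then show "mtrace ((A * A) * E) = of_real (Re (mtrace ((A * A) * E)))" "0 \<le> Re (mtrace ((A * A) * E))"
    by (auto simp: less_eq_complex_def complex_eq_iff)
qed

lemma hs_norm_eq: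
  assumes "herm d A"
  shows "Re (mtrace (A * A)) = (\<Sum>j<d. Re (ip d (mcol A j) (mcol A j)))"
  by (simp add: mtrace_herm_mult[OF assms herm_carrier[OF assms]])

lemma herm_minus: "herm d A \<Longrightarrow> herm d B \<Longrightarrow> herm d (A - B)"
  unfolding herm_def
proof (elim conjE, intro conjI allI impI)
  fix i j assume A: "A \<in> carrier_mat d d" "B \<in> carrier_mat d d" and ij: "i < d" "j < d"
    and h: "\<forall>i<d. \<forall>j<d. A $$ (i, j) = cnj (A $$ (j, i))" "\<forall>i<d. \<forall>j<d. B $$ (i, j) = cnj (B $$ (j, i))"
  have "A $$ (i, j) = cnj (A $$ (j, i))" "B $$ (i, j) = cnj (B $$ (j, i))" using h ij by blast+
  with A ij show "(A - B) $$ (i, j) = cnj ((A - B) $$ (j, i))"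
    by (simp del: complex_cnj_cancel_iff)
qed (rule minus_carrier_mat)

text \<open>Expand the form of \<open>E\<close> at \<open>sqrt s * b - (a - b) / sqrt s\<close>.\<close>
lemma psd_form_le:
  assumes E: "psd d E" and s: "s > 0"
  defines "q \<equiv> \<lambda>v. Re (ip d v (mv d E v))"
  shows "q a \<le> (1 + s) * q b + (1 + 1 / s) * q (\<lambda>i. a i - b i)"
proof -
  define x where "x = (\<lambda>i. a i - b i)"
  define r where "r = sqrt s"
  have r: "r > 0" "s = r * r" using s by (auto simp: r_def)
  have a: "a = (\<lambda>i. b i + x i)" by (simp add: x_def)
  let ?m = "Re (ip d b (mv d E x) + ip d x (mv d E b))"
  have "q a = q b + ?m + q x"
    unfolding q_def a by (simp add: mv_linear ip_linear)
  moreover define t where "t = 1 / r"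
  have t: "r * t = 1" "t * t = 1 / s" using r by (auto simp: t_def)
  have "0 \<le> q (\<lambda>i. of_real r * b i - of_real t * x i)"
    unfolding q_def by (rule psd_Re[OF E])
  moreover have "q (\<lambda>i. of_real r * b i - of_real t * x i) = (r * r) * q b - (r * t) * ?m + (t * t) * q x"
    unfolding q_def by (simp add: mv_linear ip_linear algebra_simps)
  ultimately show ?thesis unfolding x_def[symmetric] t r(2)[symmetric] by (simp add: algebra_simps)
qed

text \<open>Apply \<open>psd_form_le\<close> to each column. The surplus \<open>s\<close> times the
  form at the columns of \<open>B\<close> sums to at most \<open>s\<close>, because \<open>E\<close>
  lies below the identity and \<open>B\<close> has Hilbert--Schmidt norm at most 1. This takes the
  place of a bound of trace distance by fidelity; \<open>s\<close> stays free, to be traded against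
  the distance of the roots.\<close>

lemma mtrace_effect_diff_le:
  assumes A: "herm d A" and B: "herm d B" and E: "effect d E" and s: "s > 0"
    and tr: "Re (mtrace (B * B)) \<le> 1"
  shows "Re (mtrace ((A * A) * E)) - Re (mtrace ((B * B) * E))
    \<le> s + (1 + 1 / s) * Re (mtrace ((A - B) * (A - B)))"
proof -
  let ?q = "\<lambda>v. Re (ip d v (mv d E v))"
  let ?n = "\<lambda>v. Re (ip d v v)"
  have p: "psd d E" and c: "E \<in> carrier_mat d d" using E by (auto simp: effect_def)
  have col: "mcol (A - B) j i = mcol A j i - mcol B j i" if "i < d" "j < d" for i j
    using that herm_carrier[OF A] herm_carrier[OF B] by (simp add: mcol_def)
  have "(\<Sum>j<d. ?q (mcol A j)) \<le> (\<Sum>j<d. (?q (mcol B j) + s * ?n (mcol B j)) + (1 + 1 / s) * ?n (mcol (A - B) j))"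
  proof (intro sum_mono)
    fix j assume j: "j \<in> {..<d}"
    have "?q (mcol A j) \<le> (1 + s) * ?q (mcol B j) + (1 + 1 / s) * ?q (\<lambda>i. mcol A j i - mcol B j i)"
      by (rule psd_form_le[OF p s])
    also have "\<dots> \<le> (?q (mcol B j) + s * ?n (mcol B j)) + (1 + 1 / s) * ?n (\<lambda>i. mcol A j i - mcol B j i)"
      using s mult_left_mono[OF effect_le[OF E], of s "mcol B j"]
      by (intro add_mono mult_left_mono effect_le[OF E]) (auto simp: algebra_simps)
    also have "?n (\<lambda>i. mcol A j i - mcol B j i) = ?n (mcol (A - B) j)"
      using j by (intro arg_cong[where f = Re] ip_cong) (auto simp: col)
    finally show "?q (mcol A j) \<le> (?q (mcol B j) + s * ?n (mcol B j)) + (1 + 1 / s) * ?n (mcol (A - B) j)" .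
  qed
  also have "\<dots> = (\<Sum>j<d. ?q (mcol B j)) + s * Re (mtrace (B * B)) + (1 + 1 / s) * Re (mtrace ((A - B) * (A - B)))"
    by (simp only: sum.distrib hs_norm_eq[OF B] hs_norm_eq[OF herm_minus[OF A B]] sum_distrib_left)
  also have "\<dots> \<le> (\<Sum>j<d. ?q (mcol B j)) + s + (1 + 1 / s) * Re (mtrace ((A - B) * (A - B)))"
    using s tr by simp
  finally show ?thesis by (simp add: mtrace_sandwich[OF A c] mtrace_sandwich[OF B c])
qed

text \<open>With \<open>D = S - S'\<close>, equality of the squares gives
  \<open>D * S = - (S' * D)\<close>. So the traces of \<open>D * D * S\<close> and
  \<open>D * D * S'\<close> are opposite; both are nonnegative, hence zero. By
  \<open>psd_null\<close> both matrices annihilate the columns of \<open>D\<close>, so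
  \<open>D * D\<close> has zero trace, which is the squared norm of \<open>D\<close>.\<close>

lemma psd_sqrt_unique:
  assumes S: "psd d S" and S': "psd d S'" and eq: "S * S = S' * S'"
  shows "S = S'"
proof -
  define D where "D = S - S'"
  have c: "S \<in> carrier_mat d d" "S' \<in> carrier_mat d d" "D \<in> carrier_mat d d"
    using psd_carrier[OF S] psd_carrier[OF S'] by (simp_all add: D_def minus_carrier_mat)
  have D: "herm d D" unfolding D_def by (intro herm_minus psd_herm S S')
  have "D * S = S * S - S' * S" "S' * D = S' * S - S' * S'"
    using c by (simp_all add: D_def minus_mult_distrib_mat mult_minus_distrib_mat)
  then have z: "D * S = - (S' * D)"
    unfolding eq using c by (intro eq_matI) auto
  have "D * (D * S) = - (D * (S' * D))"
    unfolding z using c by (intro uminus_mult_right_mat) auto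
  then have "mtrace ((D * D) * S) = - mtrace (D * (S' * D))"
    using c by (simp add: assoc_mult_mat[of D d d D d S d] mtrace_def sum_negf)
  also have "mtrace (D * (S' * D)) = mtrace ((D * D) * S')"
    using c mtrace_mult_commute[of D d "S' * D"] assoc_mult_mat[of S' d d D d D d]
      mtrace_mult_commute[of "D * D" d S'] by simp
  finally have "Re (mtrace ((D * D) * S)) = - Re (mtrace ((D * D) * S'))"
    by simp
  then have "Re (mtrace ((D * D) * S)) = 0" "Re (mtrace ((D * D) * S')) = 0"
    using psd_mtrace_sandwich(2)[OF D S] psd_mtrace_sandwich(2)[OF D S'] by linarith+
  then have tr: "(\<Sum>j<d. Re (ip d (mcol D j) (mv d S (mcol D j)))) = 0"
    "(\<Sum>j<d. Re (ip d (mcol D j) (mv d S' (mcol D j)))) = 0"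
    by (simp_all add: mtrace_sandwich[OF D] c)
  have z: "Re (ip d (mcol D j) (mv d S (mcol D j))) = 0" "Re (ip d (mcol D j) (mv d S' (mcol D j))) = 0"
    if "j < d" for j
    using that tr psd_Re[OF S] psd_Re[OF S'] by (simp_all add: sum_nonneg_eq_0_iff)
  have "mv d D (mcol D j) i = 0" if "i < d" "j < d" for i j
    using psd_null[OF S z(1)[OF that(2)] that(1)] psd_null[OF S' z(2)[OF that(2)] that(1)] that c
    by (simp add: D_def mv_minus)
  then have "(D * D) $$ (i, i) = 0" if "i < d" for i
    using mcol_mult[OF c(3) c(3) that that] that by (simp only: mcol_def)
  then have "mtrace (D * D) = 0"
    unfolding mtrace_sum[OF mult_carrier_mat[OF c(3) c(3)]] by (intro sum.neutral) simp
  then have s: "(\<Sum>j<d. \<Sum>i<d. (cmod (mcol D j i))\<^sup>2) = 0"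
    using hs_norm_eq[OF D] by (simp add: Re_ip_self)
  have z: "D $$ (i, j) = 0" if "i < d" "j < d" for i j
  proof -
    have "(\<Sum>i<d. (cmod (mcol D j i))\<^sup>2) = 0"
      using s that(2) by (subst (asm) sum_nonneg_eq_0_iff) (auto intro: sum_nonneg)
    then show ?thesis
      using that(1) by (subst (asm) sum_nonneg_eq_0_iff) (auto simp: mcol_def)
  qed
  show ?thesis
  proof (rule eq_matI)
    fix i j assume "i < dim_row S'" "j < dim_col S'"
    then have "i < d" "j < d" using c(2) by (simp_all only: carrier_matD)
    then have "S $$ (i, j) - S' $$ (i, j) = 0"
      using z[of i j] index_minus_mat(1)[of i S' j S] c(2) by (simp only: D_def carrier_matD)
    then show "S $$ (i, j) = S' $$ (i, j)" by simp
  qed (use c in auto)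
qed

section \<open>Square roots of positive semidefinite matrices\<close>

text \<open>The Taylor coefficients of \<open>sqrt (1 - x)\<close> at 0.\<close>

definition sq_coeff :: "nat \<Rightarrow> real" where
  "sq_coeff n = (- 1) ^ n * ((1 / 2) gchoose n)"

text \<open>With the sign absorbed, the ratio of consecutive terms shows the sign pattern: for
  \<open>a = 1/2\<close> it is positive from \<open>n = 1\<close> on, for \<open>a = - 1/2\<close>
  always.\<close>

lemma gchoose_rec: "(- 1) ^ Suc n * (a gchoose Suc n) = (of_nat n - a) / of_nat (Suc n) * ((- 1) ^ n * (a gchoose n))"
  for a :: real
proof -
  have "of_nat (Suc n) * (a gchoose Suc n) = (a - of_nat n) * (a gchoose n)"
    using gbinomial_mult_1[of a n] by (simp add: algebra_simps)
  moreover define r where "r = (of_nat n - a) / of_nat (Suc n)"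
  then have "a - of_nat n = - (of_nat (Suc n) * r)" by simp
  ultimately have "of_nat (Suc n) * (a gchoose Suc n) = of_nat (Suc n) * (- r * (a gchoose n))"
    by (simp only: mult.assoc mult_minus_left mult_minus_right)
  then have "(a gchoose Suc n) = - r * (a gchoose n)"
    by (simp only: mult_cancel_left of_nat_eq_0_iff nat.distinct(2) simp_thms)
  then show ?thesis unfolding r_def[symmetric] by simp
qed

lemma sq_coeff_0: "sq_coeff 0 = 1"
  by (simp add: sq_coeff_def)

lemma sq_coeff_nonpos: "sq_coeff (Suc n) \<le> 0"
proof (induction n)
  case (Suc n)
  then have "(- 1) ^ Suc n * ((1 / 2 :: real) gchoose Suc n) \<le> 0"
    by (simp only: sq_coeff_def)
  then show ?case
    unfolding sq_coeff_def by (subst gchoose_rec) (rule mult_nonneg_nonpos, simp)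
qed (simp add: sq_coeff_def)

text \<open>Summing coefficients means dividing the series by \<open>1 - x\<close>, so the partial
  sums are the coefficients of \<open>(1 - x) powr (- 1/2)\<close>, which are nonnegative.\<close>

lemma sum_sq_coeff_nonneg: "0 \<le> (\<Sum>k\<le>n. sq_coeff k)"
proof -
  have "(\<Sum>k\<le>n. sq_coeff k) = (- 1) ^ n * ((- 1 / 2) gchoose n)"
    using gbinomial_sum_lower_neg[of "1/2 :: real" n] by (simp add: sq_coeff_def mult.commute)
  moreover have "0 \<le> (- 1) ^ n * ((- 1 / 2 :: real) gchoose n)"
  proof (induction n)
    case (Suc n)
    show ?case unfolding gchoose_rec by (rule mult_nonneg_nonneg[OF _ Suc]) simp
  qed simp
  ultimately show ?thesis by simp
qed

lemma sum_sq_coeff_lessThan_nonneg: "0 \<le> (\<Sum>k<n. sq_coeff k)"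
  by (cases n) (simp_all only: lessThan_0 sum.empty order.refl lessThan_Suc_atMost sum_sq_coeff_nonneg)

text \<open>Only the coefficient of index 0 is positive, so the absolute partial sums are at most 2
  minus the signed ones, and those are nonnegative.\<close>

lemma summable_sq_coeff: "summable (\<lambda>n. \<bar>sq_coeff n\<bar>)"
proof (rule summableI_nonneg_bounded)
  fix n
  have "(\<Sum>k<n. \<bar>sq_coeff k\<bar>) \<le> 2 - (\<Sum>k<n. sq_coeff k)"
  proof (induction n)
    case (Suc n)
    then show ?case
      using sq_coeff_nonpos[of "n - 1"] by (cases n) (auto simp: sq_coeff_0)
  qed simp
  then show "(\<Sum>k<n. \<bar>sq_coeff k\<bar>) \<le> 2"
    using sum_sq_coeff_lessThan_nonneg[of n] by linarith
qed simp

text \<open>The square of the series is \<open>1 - x\<close>, by Vandermonde's identity for 1/2 +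
  1/2 = 1.\<close>

lemma sq_coeff_convolution:
  "(\<Sum>m\<le>n. sq_coeff m * sq_coeff (n - m)) = (if n = 0 then 1 else if n = 1 then -1 else 0)"
proof -
  have "(\<Sum>m\<le>n. sq_coeff m * sq_coeff (n - m)) =
      (\<Sum>m\<le>n. (- 1) ^ n * (((1 / 2) gchoose m) * ((1 / 2) gchoose (n - m))))"
    by (intro sum.cong) (auto simp: sq_coeff_def simp flip: power_add)
  also have "\<dots> = (- 1) ^ n * ((1 / 2 + 1 / 2 :: real) gchoose n)"
    by (simp only: sum_distrib_left[symmetric] gbinomial_Vandermonde atLeast0AtMost[symmetric])
  also have "(1 / 2 + 1 / 2 :: real) gchoose n = of_nat (1 choose n)"
    by (simp add: binomial_gbinomial)
  finally show ?thesis by (cases n; cases "n - 1") (auto simp: binomial_eq_0)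
qed

lemma pow_mat_add:
  fixes X :: "complex mat"
  assumes "X \<in> carrier_mat d d"
  shows "X ^\<^sub>m m * X ^\<^sub>m n = X ^\<^sub>m (m + n)"
proof (induction n)
  case 0
  show ?case using assms by simp
next
  case (Suc n)
  have "X ^\<^sub>m m * X ^\<^sub>m Suc n = (X ^\<^sub>m m * X ^\<^sub>m n) * X"
    using assms by (simp add: assoc_mult_mat[of _ d d _ d _ d])
  then show ?case by (simp add: Suc)
qed

lemma pow_mat_Suc_left:
  fixes X :: "complex mat"
  assumes "X \<in> carrier_mat d d"
  shows "X ^\<^sub>m Suc n = X * X ^\<^sub>m n"
  using pow_mat_add[OF assms, of 1 n] assms by simp

lemma herm_of_ip:
  assumes "A \<in> carrier_mat d d" "\<And>v w. ip d v (mv d A w) = ip d (mv d A v) w"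
  shows "herm d A"
  unfolding herm_def
proof (intro conjI allI impI assms(1))
  fix i j assume "i < d" "j < d"
  then show "A $$ (i, j) = cnj (A $$ (j, i))"
    by (metis assms(2) cnj_ip ip_unit)
qed

lemma herm_pow:
  assumes X: "herm d X"
  shows "herm d (X ^\<^sub>m n)"
proof (rule herm_of_ip)
  note c = herm_carrier[OF X]
  then show "X ^\<^sub>m n \<in> carrier_mat d d" by simp
  show "ip d v (mv d (X ^\<^sub>m n) w) = ip d (mv d (X ^\<^sub>m n) v) w" for v w
  proof (induction n arbitrary: v w)
    case 0
    have "ip d (mv d (1\<^sub>m d) v) w = ip d v w"
      by (intro ip_cong mv_one) auto
    then show ?case using c by (simp add: ip_mv_one)
  next
    case (Suc n)
    have p: "X ^\<^sub>m n \<in> carrier_mat d d" using c by simp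
    have "ip d v (mv d (X ^\<^sub>m Suc n) w) = ip d v (mv d (X ^\<^sub>m n) (mv d X w))"
      by (intro ip_cong) (simp_all add: mv_mult[OF p c])
    also have "\<dots> = ip d (mv d X (mv d (X ^\<^sub>m n) v)) w"
      by (simp only: Suc herm_ip[OF X])
    also have "\<dots> = ip d (mv d (X ^\<^sub>m Suc n) v) w"
      unfolding pow_mat_Suc_left[OF c] by (intro ip_cong) (simp_all add: mv_mult[OF c p])
    finally show ?case .
  qed
qed

lemma contraction_pow:
  assumes X: "X \<in> carrier_mat d d"
    and le: "\<And>v. Re (ip d (mv d X v) (mv d X v)) \<le> Re (ip d v v)"
  shows "Re (ip d (mv d (X ^\<^sub>m n) v) (mv d (X ^\<^sub>m n) v)) \<le> Re (ip d v v)"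
proof (induction n arbitrary: v)
  case 0
  have "ip d (mv d (1\<^sub>m d) v) (mv d (1\<^sub>m d) v) = ip d v v"
    by (intro ip_cong mv_one) auto
  then show ?case using X by simp
next
  case (Suc n)
  have p: "X ^\<^sub>m n \<in> carrier_mat d d" using X by simp
  have "ip d (mv d (X ^\<^sub>m Suc n) v) (mv d (X ^\<^sub>m Suc n) v)
      = ip d (mv d (X ^\<^sub>m n) (mv d X v)) (mv d (X ^\<^sub>m n) (mv d X v))"
    by (intro ip_cong) (simp_all add: mv_mult[OF p X])
  then show ?case using Suc[of "mv d X v"] le[of v] by simp
qed

text \<open>The entry is a coordinate of the image of a unit vector. Applied to powers of a
  contraction, this dominates the matrix series by \<open>\<bar>sq_coeff n\<bar>\<close> in every
  entry.\<close>

lemma entry_le_1: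
  assumes le: "\<And>v. Re (ip d (mv d X v) (mv d X v)) \<le> Re (ip d v v)" and ij: "i < d" "j < d"
  shows "cmod (X $$ (i, j)) \<le> 1"
proof -
  let ?e = "\<lambda>k. if k = j then 1 else 0 :: complex"
  have e: "mv d X ?e i = X $$ (i, j)" for i
    using ij by (simp add: mv_def if_distrib[of "\<lambda>x. _ * x"] cong: if_cong)
  have "(cmod (X $$ (i, j)))\<^sup>2 \<le> Re (ip d (mv d X ?e) (mv d X ?e))"
    unfolding Re_ip_self e using ij by (intro member_le_sum) auto
  also have "\<dots> \<le> Re (ip d ?e ?e)" by (rule le)
  also have "\<dots> = 1" using ij by (simp add: ip_def if_distrib[of "\<lambda>x. _ * x"] cong: if_cong)
  finally show ?thesis by (simp add: abs_square_le_1)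
qed

text \<open>Expand the squared norm of \<open>v - w\<close>; this does the work of
  Cauchy--Schwarz.\<close>

lemma Re_ip_le:
  assumes "Re (ip d w w) \<le> Re (ip d v v)"
  shows "Re (ip d v w) \<le> Re (ip d v v)"
proof -
  have "0 \<le> Re (ip d (\<lambda>i. v i - w i) (\<lambda>i. v i - w i))" by (rule Re_ip_self_nonneg)
  also have "\<dots> = Re (ip d v v) + Re (ip d w w) - 2 * Re (ip d v w)"
    using arg_cong[OF cnj_ip[of d w v], of Re] by (simp add: ip_linear)
  finally show ?thesis using assms by simp
qed

text \<open>The square root of \<open>1 - X\<close> is given by the binomial series in \<open>X\<close>; it converges absolutely
  on contractions because the coefficients are summable up to the boundary of the unit disc.\<close>
lemma contraction_sqrt_exists:
  assumes X: "herm d X" and le: "\<And>v. Re (ip d (mv d X v) (mv d X v)) \<le> Re (ip d v v)"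
  shows "\<exists>S. psd d S \<and> S * S = 1\<^sub>m d - X"
proof -
  note c = herm_carrier[OF X]
  define P where "P n i j = (X ^\<^sub>m n) $$ (i, j)" for n i j
  define S where "S = mat d d (\<lambda>(i, j). \<Sum>n. of_real (sq_coeff n) * P n i j)"
  have S_c: "S \<in> carrier_mat d d" by (simp add: S_def)
  have norm: "summable (\<lambda>n. norm (of_real (sq_coeff n) * P n i j))" if "i < d" "j < d" for i j
  proof (rule summable_comparison_test'[OF summable_sq_coeff])
    fix n
    have "cmod (P n i j) \<le> 1"
      unfolding P_def by (rule entry_le_1[OF contraction_pow[OF c le] that])
    then show "norm (norm (of_real (sq_coeff n) * P n i j)) \<le> \<bar>sq_coeff n\<bar>"
      by (simp add: norm_mult mult_left_le)
  qed
  have sums: "(\<lambda>n. of_real (sq_coeff n) * P n i j) sums S $$ (i, j)" if "i < d" "j < d" for i j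
    using that summable_norm_cancel[OF norm[OF that]] by (simp add: S_def summable_sums)
  have form: "(\<lambda>n. of_real (sq_coeff n) * ip d v (mv d (X ^\<^sub>m n) w)) sums ip d v (mv d S w)" for v w
  proof -
    have "(\<lambda>n. \<Sum>i<d. cnj (v i) * (\<Sum>j<d. (of_real (sq_coeff n) * P n i j) * w j)) sums
        (\<Sum>i<d. cnj (v i) * (\<Sum>j<d. S $$ (i, j) * w j))"
      by (intro sums_sum sums_mult sums_mult2 sums) auto
    then show ?thesis
      by (simp add: ip_def mv_def P_def sum_distrib_left mult_ac)
  qed
  have "herm d S"
  proof (rule herm_of_ip[OF S_c])
    fix v w
    have "ip d v (mv d (X ^\<^sub>m n) w) = ip d (mv d (X ^\<^sub>m n) v) w" for n
      by (rule herm_ip[OF herm_pow[OF X]])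
    then have "(\<lambda>n. of_real (sq_coeff n) * cnj (ip d w (mv d (X ^\<^sub>m n) v))) sums ip d v (mv d S w)"
      using form[of v w] by (simp add: cnj_ip)
    moreover have "(\<lambda>n. of_real (sq_coeff n) * cnj (ip d w (mv d (X ^\<^sub>m n) v))) sums cnj (ip d w (mv d S v))"
      using iffD2[OF sums_cnj form[of w v]] by simp
    ultimately show "ip d v (mv d S w) = ip d (mv d S v) w"
      using sums_unique2 by (metis cnj_ip)
  qed
  then have "psd d S"
  proof (rule psd_of_Re)
    fix v
    let ?r = "\<lambda>n. Re (ip d v (mv d (X ^\<^sub>m n) v))"
    have s: "(\<lambda>n. sq_coeff n * ?r n) sums Re (ip d v (mv d S v))"
      using sums_Re[OF form[of v v]] by simp
    \<comment> \<open>All coefficients but the first are nonpositive, so replacing each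
      \<open>?r n\<close> by its upper bound, the squared norm of \<open>v\<close>, only lowers the
      sum. What remains is that norm times a nonnegative partial sum of coefficients.\<close>
    have "0 \<le> (\<Sum>n<N. sq_coeff n * ?r n)" for N
    proof -
      have "0 \<le> Re (ip d v v) * (\<Sum>n<N. sq_coeff n)"
        by (intro mult_nonneg_nonneg Re_ip_self_nonneg sum_sq_coeff_lessThan_nonneg)
      also have "\<dots> \<le> (\<Sum>n<N. sq_coeff n * ?r n)"
        unfolding sum_distrib_left
      proof (intro sum_mono)
        fix n
        show "Re (ip d v v) * sq_coeff n \<le> sq_coeff n * ?r n"
        proof (cases n)
          case 0
          then show ?thesis using c by (simp add: ip_mv_one)
        next
          case (Suc m)
          have "?r n \<le> Re (ip d v v)"
            by (intro Re_ip_le contraction_pow[OF c le])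
          then show ?thesis
            using sq_coeff_nonpos[of m] Suc by (simp add: mult.commute mult_left_mono_neg)
        qed
      qed
      finally show ?thesis .
    qed
    then show "0 \<le> Re (ip d v (mv d S v))"
      using s unfolding sums_def by (intro LIMSEQ_le_const) auto
  qed
  moreover have "S * S = 1\<^sub>m d - X"
  proof (rule eq_matI)
    fix i j assume "i < dim_row (1\<^sub>m d - X)" "j < dim_col (1\<^sub>m d - X)"
    then have ij: "i < d" "j < d" using c by auto
    \<comment> \<open>An entry of \<open>S * S\<close> is a finite sum of Cauchy products. In each
      degree the powers of \<open>X\<close> recombine, and the convolution identity leaves the
      degrees 0 and 1 only.\<close>
    have "(\<lambda>n. \<Sum>k<d. \<Sum>m\<le>n. (of_real (sq_coeff m) * P m i k) * (of_real (sq_coeff (n - m)) * P (n - m) k j))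
        sums (\<Sum>k<d. S $$ (i, k) * S $$ (k, j))"
    proof (rule sums_sum)
      fix k assume "k \<in> {..<d}"
      then have k: "k < d" by simp
      show "(\<lambda>n. \<Sum>m\<le>n. (of_real (sq_coeff m) * P m i k) * (of_real (sq_coeff (n - m)) * P (n - m) k j))
          sums (S $$ (i, k) * S $$ (k, j))"
        using Cauchy_product_sums[OF norm[OF ij(1) k] norm[OF k ij(2)]]
        unfolding sums_unique[OF sums[OF ij(1) k], symmetric] sums_unique[OF sums[OF k ij(2)], symmetric] .
    qed
    moreover have "(\<Sum>k<d. \<Sum>m\<le>n. (of_real (sq_coeff m) * P m i k) * (of_real (sq_coeff (n - m)) * P (n - m) k j))
        = of_real (if n = 0 then 1 else if n = 1 then -1 else 0) * P n i j" for n
    proof -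
      have "(\<Sum>k<d. \<Sum>m\<le>n. (of_real (sq_coeff m) * P m i k) * (of_real (sq_coeff (n - m)) * P (n - m) k j))
          = (\<Sum>m\<le>n. of_real (sq_coeff m * sq_coeff (n - m)) * (\<Sum>k<d. P m i k * P (n - m) k j))"
        by (subst sum.swap) (simp add: sum_distrib_left mult_ac)
      also have "\<dots> = (\<Sum>m\<le>n. of_real (sq_coeff m * sq_coeff (n - m)) * P n i j)"
      proof (intro sum.cong refl arg_cong2[where f = "(*)"])
        fix m assume "m \<in> {..n}"
        then have "X ^\<^sub>m m * X ^\<^sub>m (n - m) = X ^\<^sub>m n" using pow_mat_add[OF c] by simp
        moreover have "(X ^\<^sub>m m * X ^\<^sub>m (n - m)) $$ (i, j) = (\<Sum>k<d. P m i k * P (n - m) k j)"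
          unfolding P_def using c ij by (intro index_mult_mat_sum) auto
        ultimately show "(\<Sum>k<d. P m i k * P (n - m) k j) = P n i j" by (simp add: P_def)
      qed
      also have "\<dots> = of_real (if n = 0 then 1 else if n = 1 then -1 else 0) * P n i j"
        by (simp only: sum_distrib_right[symmetric] of_real_sum[symmetric] sq_coeff_convolution)
      finally show ?thesis .
    qed
    moreover have "(\<lambda>n. of_real (if n = 0 then 1 else if n = 1 then -1 else 0) * P n i j) sums
        (\<Sum>n\<in>{0, 1}. of_real (if n = 0 then 1 else if n = 1 then -1 else 0) * P n i j)"
      by (rule sums_finite) auto
    ultimately have "(\<Sum>k<d. S $$ (i, k) * S $$ (k, j)) = P 0 i j - P 1 i j"
      using sums_unique2 by fastforce
    also have "\<dots> = (1\<^sub>m d - X) $$ (i, j)"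
      using c ij by (simp add: P_def)
    finally show "(S * S) $$ (i, j) = (1\<^sub>m d - X) $$ (i, j)"
      using index_mult_mat_sum[OF S_c S_c ij] by simp
  qed (use S_c c in auto)
  ultimately show ?thesis by blast
qed

text \<open>Scale \<open>A\<close> to a matrix \<open>B\<close> between 0 and 1, take the root of
  \<open>1 - X\<close> with \<open>X = 1 - B\<close>, and scale back by
  \<open>sqrt c\<close>.\<close>

lemma psd_sqrt_exists:
  assumes A: "psd d A"
  shows "\<exists>S. psd d S \<and> S * S = A"
proof -
  obtain c where c: "c > 0" "\<And>v. Re (ip d v (mv d A v)) \<le> c * Re (ip d v v)"
    using psd_bounded[OF A] by blast
  note car = psd_carrier[OF A]
  define B where "B = of_real (1 / c) \<cdot>\<^sub>m A"
  have B: "psd d B" unfolding B_def using c(1) by (intro psd_smult[OF A]) simp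
  note carB = psd_carrier[OF B]
  have B1: "Re (ip d v (mv d B v)) \<le> Re (ip d v v)" for v
    using c(1) c(2)[of v] by (simp add: B_def ip_mv_smult[OF car] field_simps)
  have hX: "herm d (1\<^sub>m d - B)"
    by (intro herm_minus psd_herm[OF B]) (auto simp: herm_def)
  \<comment> \<open>The squared norm of \<open>v - B v\<close> drops by twice the form of
    \<open>B\<close> at \<open>v\<close> and gains the squared norm of \<open>B v\<close>, which by
    \<open>psd_contraction\<close> is at most that form once.\<close>
  have "Re (ip d (mv d (1\<^sub>m d - B) v) (mv d (1\<^sub>m d - B) v)) \<le> Re (ip d v v)" for v
  proof -
    let ?w = "mv d B v"
    have "ip d (mv d (1\<^sub>m d - B) v) (mv d (1\<^sub>m d - B) v) = ip d (\<lambda>i. v i - ?w i) (\<lambda>i. v i - ?w i)"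
      by (intro ip_cong) (simp_all add: mv_minus[OF one_carrier_mat carB] mv_one)
    also have "Re \<dots> = Re (ip d v v) - 2 * Re (ip d v ?w) + Re (ip d ?w ?w)"
      using herm_ip[OF psd_herm[OF B], of v v] by (simp add: ip_linear)
    also have "\<dots> \<le> Re (ip d v v)"
      using psd_contraction[OF B B1, of v] psd_Re[OF B, of v] by linarith
    finally show ?thesis .
  qed
  from contraction_sqrt_exists[OF hX this] obtain S where S: "psd d S" "S * S = 1\<^sub>m d - (1\<^sub>m d - B)"
    by blast
  note carS = psd_carrier[OF S(1)]
  have SS: "S * S = B" unfolding S(2) using carB by (intro eq_matI) auto
  let ?R = "of_real (sqrt c) \<cdot>\<^sub>m S"
  have "?R * ?R = of_real (sqrt c) \<cdot>\<^sub>m (of_real (sqrt c) \<cdot>\<^sub>m (S * S))"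
    by (simp only: mult_smult_assoc_mat[OF carS smult_carrier_mat[OF carS]] mult_smult_distrib[OF carS carS])
  also have "\<dots> = A"
    unfolding SS B_def using c(1) car
    by (intro eq_matI) (auto simp: mult.assoc[symmetric] simp flip: of_real_mult)
  finally show ?thesis
    using psd_smult[OF S(1), of "sqrt c"] c(1) by (intro exI[of _ ?R]) auto
qed

text \<open>Existence and uniqueness together give meaning to the \<open>THE\<close> in
  \<open>psd_sqrt_def\<close>.\<close>

lemma psd_sqrt:
  assumes "psd d A"
  shows "psd d (psd_sqrt d A)" "psd_sqrt d A * psd_sqrt d A = A"
proof -
  have "\<exists>!S. psd d S \<and> S * S = A"
    using psd_sqrt_exists[OF assms] psd_sqrt_unique by blast
  from theI'[OF this] show "psd d (psd_sqrt d A)" "psd_sqrt d A * psd_sqrt d A = A"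
    by (simp_all add: psd_sqrt_def)
qed

section \<open>Tensor products and product measurements\<close>

definition words :: "'a set \<Rightarrow> nat \<Rightarrow> 'a list set" where
  "words A n = {ys. set ys \<subseteq> A \<and> length ys = n}"

lemma words_mono: "A \<subseteq> B \<Longrightarrow> words A n \<subseteq> words B n"
  by (auto simp: words_def)

lemma finite_words: "finite A \<Longrightarrow> finite (words A n)"
  unfolding words_def by (rule finite_lists_length_eq)

lemma card_words: "finite A \<Longrightarrow> card (words A n) = card A ^ n"
  unfolding words_def by (rule card_lists_length_eq)

lemma words_0: "words A 0 = {[]}"
  by (auto simp: words_def)

lemma sum_words_Suc: "(\<Sum>ys\<in>words A (Suc n). f ys) = (\<Sum>y\<in>A. \<Sum>ys\<in>words A n. f (y # ys))"
proof -
  have "(\<Sum>ys\<in>words A (Suc n). f ys) = (\<Sum>(y, ys)\<in>A \<times> words A n. f (y # ys))"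
    by (rule sum.reindex_bij_witness[of _ "\<lambda>(y, ys). y # ys" "\<lambda>zs. (hd zs, tl zs)"])
      (auto simp: words_def length_Suc_conv)
  then show ?thesis by (simp add: sum.cartesian_product)
qed

text \<open>An index of a Kronecker product is a two-digit number. Splitting it into its digits
  yields the multiplicativity of products and traces below.\<close>

lemma sum_div_mod:
  "(\<Sum>i<m * n. f (i div n) (i mod n)) = (\<Sum>a<m. \<Sum>b<n. f a b)" for m n :: nat
proof -
  have "(\<Sum>i<m * n. f (i div n) (i mod n)) = (\<Sum>(a, b)\<in>{..<m} \<times> {..<n}. f a b)"
  proof (rule sum.reindex_bij_witness[of _ "\<lambda>(a, b). a * n + b" "\<lambda>i. (i div n, i mod n)"])
    fix i assume "i \<in> {..<m * n}"
    then show "(i div n, i mod n) \<in> {..<m} \<times> {..<n}"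
      by (cases "n = 0") (auto simp: less_mult_imp_div_less)
  next
    fix p assume p: "p \<in> {..<m} \<times> {..<n}"
    then obtain a b where ab: "p = (a, b)" "a < m" "b < n" by auto
    have "a * n + b < Suc a * n" using ab by simp
    also have "\<dots> \<le> m * n" using ab by (intro mult_le_mono1) simp
    finally show "(case p of (a, b) \<Rightarrow> a * n + b) \<in> {..<m * n}" using ab by simp
  qed auto
  then show ?thesis by (simp add: sum.cartesian_product)
qed

lemma kron_carrier: "A \<in> carrier_mat m m \<Longrightarrow> B \<in> carrier_mat n n \<Longrightarrow> kron A B \<in> carrier_mat (m * n) (m * n)"
  by (simp add: kron_def)

lemma index_kron:
  "A \<in> carrier_mat m m \<Longrightarrow> B \<in> carrier_mat n n \<Longrightarrow> i < m * n \<Longrightarrow> j < m * n \<Longrightarrow>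
    kron A B $$ (i, j) = A $$ (i div n, j div n) * B $$ (i mod n, j mod n)"
  by (simp add: kron_def)

lemma div_mod_less: "i < m * n \<Longrightarrow> i div n < m \<and> i mod n < n" for i m n :: nat
  by (cases "n = 0") (auto simp: less_mult_imp_div_less)

lemma kron_mult:
  assumes A: "A \<in> carrier_mat m m" and B: "B \<in> carrier_mat n n"
    and C: "C \<in> carrier_mat m m" and D: "D \<in> carrier_mat n n"
  shows "kron A B * kron C D = kron (A * C) (B * D)"
proof (rule eq_matI)
  note AC = mult_carrier_mat[OF A C] and BD = mult_carrier_mat[OF B D]
  note kk = kron_carrier[OF AC BD] and kAB = kron_carrier[OF A B] and kCD = kron_carrier[OF C D]
  fix i j assume "i < dim_row (kron (A * C) (B * D))" "j < dim_col (kron (A * C) (B * D))"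
  then have ij: "i < m * n" "j < m * n" using kk by auto
  note dm = div_mod_less[OF ij(1)] div_mod_less[OF ij(2)]
  have "(kron A B * kron C D) $$ (i, j) = (\<Sum>k<m * n. kron A B $$ (i, k) * kron C D $$ (k, j))"
    by (rule index_mult_mat_sum[OF kAB kCD ij])
  also have "\<dots> = (\<Sum>k<m * n. (A $$ (i div n, k div n) * C $$ (k div n, j div n)) *
      (B $$ (i mod n, k mod n) * D $$ (k mod n, j mod n)))"
    using ij by (intro sum.cong refl) (simp add: index_kron[OF A B] index_kron[OF C D])
  also have "\<dots> = (\<Sum>a<m. \<Sum>b<n. (A $$ (i div n, a) * C $$ (a, j div n)) * (B $$ (i mod n, b) * D $$ (b, j mod n)))"
    by (rule sum_div_mod)
  also have "\<dots> = (\<Sum>a<m. A $$ (i div n, a) * C $$ (a, j div n)) * (\<Sum>b<n. B $$ (i mod n, b) * D $$ (b, j mod n))"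
    by (simp only: sum_product)
  also have "\<dots> = (A * C) $$ (i div n, j div n) * (B * D) $$ (i mod n, j mod n)"
    using dm by (simp only: index_mult_mat_sum[OF A C] index_mult_mat_sum[OF B D])
  also have "\<dots> = kron (A * C) (B * D) $$ (i, j)"
    by (rule index_kron[OF AC BD ij, symmetric])
  finally show "(kron A B * kron C D) $$ (i, j) = kron (A * C) (B * D) $$ (i, j)" .
qed (use assms in \<open>simp_all add: kron_def\<close>)

lemma mtrace_kron:
  assumes "A \<in> carrier_mat m m" "B \<in> carrier_mat n n"
  shows "mtrace (kron A B) = mtrace A * mtrace B"
proof -
  have "mtrace (kron A B) = (\<Sum>i<m * n. A $$ (i div n, i div n) * B $$ (i mod n, i mod n))"
    unfolding mtrace_sum[OF kron_carrier[OF assms]]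
    by (intro sum.cong refl) (simp add: index_kron[OF assms])
  also have "\<dots> = (\<Sum>a<m. \<Sum>b<n. A $$ (a, a) * B $$ (b, b))"
    by (rule sum_div_mod)
  finally show ?thesis
    by (simp only: sum_product[symmetric] mtrace_sum[OF assms(1)] mtrace_sum[OF assms(2)])
qed

lemma herm_kron:
  assumes A: "herm m A" and B: "herm n B"
  shows "herm (m * n) (kron A B)"
  unfolding herm_def
proof (intro conjI allI impI)
  note c = herm_carrier[OF A] herm_carrier[OF B]
  show "kron A B \<in> carrier_mat (m * n) (m * n)" by (rule kron_carrier[OF c])
  fix i j assume ij: "i < m * n" "j < m * n"
  note dm = div_mod_less[OF ij(1)] div_mod_less[OF ij(2)]
  show "kron A B $$ (i, j) = cnj (kron A B $$ (j, i))"
    using ij dm by (simp only: index_kron[OF c] complex_cnj_mult hermD[OF A] hermD[OF B])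
qed

lemma tensor_word_Nil: "tensor_word W [] = 1\<^sub>m 1"
  and tensor_word_Cons: "tensor_word W (x # xs) = kron (W x) (tensor_word W xs)"
  by (simp_all add: tensor_word_def)

lemma tensor_word_carrier:
  "(\<And>x. x \<in> set xs \<Longrightarrow> W x \<in> carrier_mat d d) \<Longrightarrow> tensor_word W xs \<in> carrier_mat (d ^ length xs) (d ^ length xs)"
  by (induction xs) (simp_all add: tensor_word_Nil tensor_word_Cons kron_carrier)

lemma tensor_word_mult:
  assumes "length xs = length ys"
    and "\<And>x. x \<in> set xs \<Longrightarrow> V x \<in> carrier_mat d d" "\<And>y. y \<in> set ys \<Longrightarrow> W y \<in> carrier_mat d d"
  shows "tensor_word V xs * tensor_word W ys = tensor_word (\<lambda>(x, y). V x * W y) (zip xs ys)"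
  using assms
proof (induction xs ys rule: list_induct2)
  case Nil
  then show ?case by (simp add: tensor_word_Nil)
next
  case (Cons x xs y ys)
  have V: "tensor_word V xs \<in> carrier_mat (d ^ length xs) (d ^ length xs)"
    and W: "tensor_word W ys \<in> carrier_mat (d ^ length xs) (d ^ length xs)"
    using tensor_word_carrier[of xs V d] tensor_word_carrier[of ys W d] Cons by auto
  have "kron (V x) (tensor_word V xs) * kron (W y) (tensor_word W ys)
      = kron (V x * W y) (tensor_word V xs * tensor_word W ys)"
    by (rule kron_mult[where m = d, OF _ V _ W]) (simp_all add: Cons)
  then show ?case using Cons by (simp add: tensor_word_Cons)
qed

lemma mtrace_tensor_word:
  "(\<And>x. x \<in> set xs \<Longrightarrow> W x \<in> carrier_mat d d) \<Longrightarrow> mtrace (tensor_word W xs) = (\<Prod>x\<leftarrow>xs. mtrace (W x))"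
proof (induction xs)
  case Nil
  show ?case by (simp add: tensor_word_Nil mtrace_def)
next
  case (Cons x xs)
  then show ?case
    using mtrace_kron[OF _ tensor_word_carrier[of xs W d], of "W x" d] by (simp add: tensor_word_Cons)
qed

lemma herm_tensor_word:
  "(\<And>x. x \<in> set xs \<Longrightarrow> herm d (W x)) \<Longrightarrow> herm (d ^ length xs) (tensor_word W xs)"
proof (induction xs)
  case Nil
  show ?case by (simp add: tensor_word_Nil herm_def)
next
  case (Cons x xs)
  then show ?case by (simp add: tensor_word_Cons herm_kron)
qed

lemma tensor_word_cong: "(\<And>x. x \<in> set xs \<Longrightarrow> V x = W x) \<Longrightarrow> tensor_word V xs = tensor_word W xs"
  by (induction xs) (simp_all add: tensor_word_Nil tensor_word_Cons)

lemma tensor_word_map: "tensor_word W (map f xs) = tensor_word (W \<circ> f) xs"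
  by (induction xs) (simp_all add: tensor_word_Nil tensor_word_Cons)

text \<open>Used twice: with square roots on both sides it gives the overlap of two product roots,
  with states and measurement operators the outcome probabilities.\<close>

lemma mtrace_tensor_word_mult:
  assumes "length xs = length ys"
    and "\<And>x. x \<in> set xs \<Longrightarrow> V x \<in> carrier_mat d d" "\<And>y. y \<in> set ys \<Longrightarrow> W y \<in> carrier_mat d d"
  shows "mtrace (tensor_word V xs * tensor_word W ys) = (\<Prod>(x, y)\<leftarrow>zip xs ys. mtrace (V x * W y))"
proof -
  have "mtrace (tensor_word V xs * tensor_word W ys) = (\<Prod>z\<leftarrow>zip xs ys. mtrace (case z of (x, y) \<Rightarrow> V x * W y))"
  proof (subst tensor_word_mult[where d = d])
    show "mtrace (tensor_word (\<lambda>(x, y). V x * W y) (zip xs ys)) = (\<Prod>z\<leftarrow>zip xs ys. mtrace (case z of (x, y) \<Rightarrow> V x * W y))"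
    proof (rule mtrace_tensor_word[where d = d])
      fix z assume "z \<in> set (zip xs ys)"
      moreover obtain x y where "z = (x, y)" by (cases z)
      ultimately show "(case z of (x, y) \<Rightarrow> V x * W y) \<in> carrier_mat d d"
        by (auto dest: set_zip_leftD set_zip_rightD intro!: mult_carrier_mat assms(2,3))
    qed
  qed (use assms in auto)
  also have "\<dots> = (\<Prod>(x, y)\<leftarrow>zip xs ys. mtrace (V x * W y))"
    by (intro arg_cong[where f = prod_list] map_cong refl) (simp add: split_beta)
  finally show ?thesis .
qed

text \<open>The product of the letter roots is a Hermitian factor of the product state. Positivity
  of tensor products is read off from this factorization.\<close>

lemma tensor_word_psd_sqrt:
  assumes "\<And>x. x \<in> set xs \<Longrightarrow> psd d (W x)"
  shows "tensor_word W xs = tensor_word (\<lambda>x. psd_sqrt d (W x)) xs * tensor_word (\<lambda>x. psd_sqrt d (W x)) xs"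
proof -
  let ?R = "\<lambda>x. psd_sqrt d (W x)"
  have "tensor_word ?R xs * tensor_word ?R xs = tensor_word (\<lambda>(x, y). ?R x * ?R y) (zip xs xs)"
    by (intro tensor_word_mult[where d = d] refl psd_carrier psd_sqrt assms)
  also have "\<dots> = tensor_word W xs"
    unfolding zip_same_conv_map tensor_word_map
    by (intro tensor_word_cong) (simp add: psd_sqrt(2)[OF assms])
  finally show ?thesis ..
qed

lemma psd_tensor_word:
  assumes "\<And>x. x \<in> set xs \<Longrightarrow> psd d (W x)"
  shows "psd (d ^ length xs) (tensor_word W xs)"
proof -
  have "herm (d ^ length xs) (tensor_word (\<lambda>x. psd_sqrt d (W x)) xs)"
    by (intro herm_tensor_word psd_herm psd_sqrt assms)
  moreover have "tensor_word W xs = tensor_word (\<lambda>x. psd_sqrt d (W x)) xs * tensor_word (\<lambda>x. psd_sqrt d (W x)) xs"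
    by (intro tensor_word_psd_sqrt assms)
  ultimately show ?thesis by (simp only: herm_square_psd)
qed

lemma msum_carrier: "msum d f I \<in> carrier_mat d d"
  by (simp add: msum_def)

lemma index_msum: "i < d \<Longrightarrow> j < d \<Longrightarrow> msum d f I $$ (i, j) = (\<Sum>m\<in>I. f m $$ (i, j))"
  by (simp add: msum_def)

lemma psd_msum:
  assumes "\<And>m. m \<in> I \<Longrightarrow> psd d (f m)"
  shows "psd d (msum d f I)"
  unfolding psd_def
proof (intro conjI allI msum_carrier)
  fix v :: "nat \<Rightarrow> complex"
  have "(\<Sum>i<d. \<Sum>j<d. cnj (v i) * msum d f I $$ (i, j) * v j)
      = (\<Sum>i<d. \<Sum>j<d. \<Sum>m\<in>I. cnj (v i) * f m $$ (i, j) * v j)"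
    by (intro sum.cong refl) (simp add: index_msum sum_distrib_left sum_distrib_right)
  also have "\<dots> = (\<Sum>m\<in>I. \<Sum>i<d. \<Sum>j<d. cnj (v i) * f m $$ (i, j) * v j)"
    by (subst (2) sum.swap, subst sum.swap, rule refl)
  also have "\<dots> \<ge> 0"
    using assms unfolding psd_def by (intro sum_nonneg[of I]) blast
  finally show "0 \<le> (\<Sum>i<d. \<Sum>j<d. cnj (v i) * msum d f I $$ (i, j) * v j)" .
qed

text \<open>The complement of a partial sum of a POVM is again a partial sum, over the remaining
  outcomes.\<close>

lemma effect_msum:
  assumes "finite I" "\<And>m. m \<in> I \<Longrightarrow> psd d (f m)" "msum d f I = 1\<^sub>m d" "J \<subseteq> I"
  shows "effect d (msum d f J)"
proof -
  have "msum d f I - msum d f J = msum d f (I - J)"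
    using assms(1,4) by (intro eq_matI) (simp_all add: msum_def sum_diff)
  then show ?thesis
    using psd_msum[of J d f] psd_msum[of "I - J" d f] assms unfolding effect_def by auto
qed

lemma mtrace_mult_msum:
  assumes R: "R \<in> carrier_mat d d" and f: "\<And>m. m \<in> I \<Longrightarrow> f m \<in> carrier_mat d d"
  shows "mtrace (R * msum d f I) = (\<Sum>m\<in>I. mtrace (R * f m))"
proof -
  have "mtrace (R * msum d f I) = (\<Sum>i<d. \<Sum>j<d. \<Sum>m\<in>I. R $$ (i, j) * f m $$ (j, i))"
    unfolding mtrace_mult[OF R msum_carrier]
    by (intro sum.cong refl) (simp add: index_msum sum_distrib_left)
  also have "\<dots> = (\<Sum>m\<in>I. \<Sum>i<d. \<Sum>j<d. R $$ (i, j) * f m $$ (j, i))"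
    by (subst (2) sum.swap, subst sum.swap, rule refl)
  also have "\<dots> = (\<Sum>m\<in>I. mtrace (R * f m))"
    by (intro sum.cong refl mtrace_mult[OF R f, symmetric])
  finally show ?thesis .
qed

text \<open>The sum over words factorizes into first letter and rest, and two indices agree exactly
  when their quotients and remainders do.\<close>

lemma msum_tensor_word:
  assumes T: "\<And>y. y \<in> Y \<Longrightarrow> T y \<in> carrier_mat d d" and one: "msum d T Y = 1\<^sub>m d"
  shows "msum (d ^ n) (tensor_word T) (words Y n) = 1\<^sub>m (d ^ n)"
proof (induction n)
  case 0
  show ?case by (rule eq_matI) (simp_all add: words_0 msum_def tensor_word_Nil)
next
  case (Suc n)
  let ?D = "d ^ n"
  show ?case
  proof (rule eq_matI)
    fix i j assume "i < dim_row (1\<^sub>m (d ^ Suc n) :: complex mat)" "j < dim_col (1\<^sub>m (d ^ Suc n) :: complex mat)"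
    then have ij: "i < d * ?D" "j < d * ?D" by auto
    note dm = div_mod_less[OF ij(1)] div_mod_less[OF ij(2)]
    have "msum (d ^ Suc n) (tensor_word T) (words Y (Suc n)) $$ (i, j)
        = (\<Sum>y\<in>Y. \<Sum>ys\<in>words Y n. kron (T y) (tensor_word T ys) $$ (i, j))"
      using ij by (simp add: index_msum sum_words_Suc tensor_word_Cons)
    also have "\<dots> = (\<Sum>y\<in>Y. \<Sum>ys\<in>words Y n. T y $$ (i div ?D, j div ?D) * tensor_word T ys $$ (i mod ?D, j mod ?D))"
    proof (intro sum.cong refl)
      fix y ys assume y: "y \<in> Y" and ys: "ys \<in> words Y n"
      have "tensor_word T ys \<in> carrier_mat ?D ?D"
        using tensor_word_carrier[of ys T d] ys T by (auto simp: words_def)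
      from index_kron[OF T[OF y] this ij]
      show "kron (T y) (tensor_word T ys) $$ (i, j) = T y $$ (i div ?D, j div ?D) * tensor_word T ys $$ (i mod ?D, j mod ?D)" .
    qed
    also have "\<dots> = msum d T Y $$ (i div ?D, j div ?D) * msum ?D (tensor_word T) (words Y n) $$ (i mod ?D, j mod ?D)"
      using dm by (simp only: index_msum sum_product)
    also have "\<dots> = 1\<^sub>m (d ^ Suc n) $$ (i, j)"
      unfolding one Suc using dm ij by auto (metis div_mult_mod_eq)
    finally show "msum (d ^ Suc n) (tensor_word T) (words Y (Suc n)) $$ (i, j) = 1\<^sub>m (d ^ Suc n) $$ (i, j)" .
  qed (simp_all add: msum_def)
qed

section \<open>Typical sets of product distributions\<close>

definition word_prob :: "('x \<Rightarrow> 'y \<Rightarrow> real) \<Rightarrow> 'x list \<Rightarrow> 'y list \<Rightarrow> real" where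
  "word_prob V xs ys = (\<Prod>(x, y)\<leftarrow>zip xs ys. V x y)"

definition stochastic :: "'y set \<Rightarrow> ('x \<Rightarrow> 'y \<Rightarrow> real) \<Rightarrow> 'x \<Rightarrow> bool" where
  "stochastic Y V x \<longleftrightarrow> (\<forall>y\<in>Y. 0 \<le> V x y) \<and> (\<Sum>y\<in>Y. V x y) = 1"

lemma word_prob_Nil [simp]: "word_prob V [] ys = 1"
  and word_prob_Cons [simp]: "word_prob V (x # xs) (y # ys) = V x y * word_prob V xs ys"
  by (simp_all add: word_prob_def)

lemma word_prob_nonneg:
  assumes "\<And>x. x \<in> set xs \<Longrightarrow> stochastic Y V x" "ys \<in> words Y n"
  shows "0 \<le> word_prob V xs ys"
  unfolding word_prob_def using assms
  by (intro prod_list_nonneg) (auto simp: words_def stochastic_def dest: set_zip_leftD set_zip_rightD)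

lemma sum_word_prob:
  "(\<And>x. x \<in> set xs \<Longrightarrow> stochastic Y V x) \<Longrightarrow> (\<Sum>ys\<in>words Y (length xs). word_prob V xs ys) = 1"
proof (induction xs)
  case (Cons x xs)
  have "(\<Sum>ys\<in>words Y (length (x # xs)). word_prob V (x # xs) ys)
      = (\<Sum>y\<in>Y. V x y * (\<Sum>ys\<in>words Y (length xs). word_prob V xs ys))"
    by (simp add: sum_words_Suc sum_distrib_left)
  then show ?case using Cons by (simp add: stochastic_def)
qed (simp add: words_0)

text \<open>Additivity of the variance for independent centered letter scores: when the square is
  expanded, the cross term vanishes because the scores of the remaining letters have mean 0.\<close>

lemma word_prob_score:
  fixes Z :: "'x \<Rightarrow> 'y \<Rightarrow> real"
  assumes "\<And>x. x \<in> set xs \<Longrightarrow> stochastic Y V x"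
    and "\<And>x. x \<in> set xs \<Longrightarrow> (\<Sum>y\<in>Y. V x y * Z x y) = 0"
    and "\<And>x. x \<in> set xs \<Longrightarrow> (\<Sum>y\<in>Y. V x y * (Z x y)\<^sup>2) \<le> K"
  defines "S \<equiv> \<lambda>xs ys. \<Sum>(x, y)\<leftarrow>zip xs ys. Z x y"
  shows "(\<Sum>ys\<in>words Y (length xs). word_prob V xs ys * S xs ys) = 0 \<and>
    (\<Sum>ys\<in>words Y (length xs). word_prob V xs ys * (S xs ys)\<^sup>2) \<le> length xs * K"
  using assms(1-3)
proof (induction xs)
  case Nil
  show ?case by (simp add: words_0 S_def)
next
  case (Cons x xs)
  let ?W = "words Y (length xs)" and ?P = "word_prob V xs"
  have S: "S (x # xs) (y # ys) = Z x y + S xs ys" for y ys by (simp add: S_def)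
  have one: "(\<Sum>ys\<in>?W. ?P ys) = 1" "(\<Sum>y\<in>Y. V x y) = 1"
    using sum_word_prob[of xs Y V] Cons.prems(1) by (auto simp: stochastic_def)
  have IH: "(\<Sum>ys\<in>?W. ?P ys * S xs ys) = 0" "(\<Sum>ys\<in>?W. ?P ys * (S xs ys)\<^sup>2) \<le> length xs * K"
    using Cons.IH Cons.prems by simp_all
  have inner1: "(\<Sum>ys\<in>?W. (V x y * ?P ys) * (Z x y + S xs ys)) = V x y * Z x y" for y
  proof -
    have "(\<Sum>ys\<in>?W. (V x y * ?P ys) * (Z x y + S xs ys))
        = V x y * Z x y * (\<Sum>ys\<in>?W. ?P ys) + V x y * (\<Sum>ys\<in>?W. ?P ys * S xs ys)"
      by (simp add: sum_distrib_left algebra_simps sum.distrib)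
    then show ?thesis by (simp add: one IH)
  qed
  have inner2: "(\<Sum>ys\<in>?W. (V x y * ?P ys) * (Z x y + S xs ys)\<^sup>2)
      = V x y * (Z x y)\<^sup>2 + V x y * (\<Sum>ys\<in>?W. ?P ys * (S xs ys)\<^sup>2)" for y
  proof -
    have "(\<Sum>ys\<in>?W. (V x y * ?P ys) * (Z x y + S xs ys)\<^sup>2)
        = V x y * (Z x y)\<^sup>2 * (\<Sum>ys\<in>?W. ?P ys) + 2 * V x y * Z x y * (\<Sum>ys\<in>?W. ?P ys * S xs ys)
          + V x y * (\<Sum>ys\<in>?W. ?P ys * (S xs ys)\<^sup>2)"
      by (simp add: sum_distrib_left power2_eq_square algebra_simps sum.distrib)
    then show ?thesis by (simp add: one IH)
  qed
  have "(\<Sum>ys\<in>words Y (length (x # xs)). word_prob V (x # xs) ys * S (x # xs) ys) = (\<Sum>y\<in>Y. V x y * Z x y)"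
    by (simp add: sum_words_Suc S inner1)
  moreover have "(\<Sum>ys\<in>words Y (length (x # xs)). word_prob V (x # xs) ys * (S (x # xs) ys)\<^sup>2)
      = (\<Sum>y\<in>Y. V x y * (Z x y)\<^sup>2) + (\<Sum>y\<in>Y. V x y) * (\<Sum>ys\<in>?W. ?P ys * (S xs ys)\<^sup>2)"
    by (simp add: sum_words_Suc S inner2 sum.distrib sum_distrib_right)
  ultimately show ?case
    using Cons.prems(2)[of x] Cons.prems(3)[of x] IH(2) one by (simp add: algebra_simps)
qed

lemma prod_list_zip_nth:
  "length xs = length ys \<Longrightarrow> (\<Prod>(x, y)\<leftarrow>zip xs ys. f x y) = (\<Prod>i<length xs. f (xs ! i) (ys ! i))"
  by (simp add: prod.list_conv_set_nth lessThan_atLeast0)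

text \<open>The Bhattacharyya coefficient, or Hellinger affinity, of two output
  distributions.\<close>

definition affinity :: "'y set \<Rightarrow> ('x \<Rightarrow> 'y \<Rightarrow> real) \<Rightarrow> 'x \<Rightarrow> 'x \<Rightarrow> real" where
  "affinity Y V x x' = (\<Sum>y\<in>Y. sqrt (V x y * V x' y))"

lemma word_affinity:
  assumes "length xs = length xs'"
  shows "(\<Sum>ys\<in>words Y (length xs). sqrt (word_prob V xs ys * word_prob V xs' ys))
    = (\<Prod>(x, x')\<leftarrow>zip xs xs'. affinity Y V x x')"
  using assms
proof (induction xs xs' rule: list_induct2)
  case Nil
  show ?case by (simp add: words_0)
next
  case (Cons x xs x' xs')
  have "(\<Sum>ys\<in>words Y (length (x # xs)). sqrt (word_prob V (x # xs) ys * word_prob V (x' # xs') ys))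
    = (\<Sum>y\<in>Y. \<Sum>ys\<in>words Y (length xs). sqrt (V x y * V x' y) * sqrt (word_prob V xs ys * word_prob V xs' ys))"
    by (simp add: sum_words_Suc mult_ac flip: real_sqrt_mult)
  also have "\<dots> = affinity Y V x x' * (\<Sum>ys\<in>words Y (length xs). sqrt (word_prob V xs ys * word_prob V xs' ys))"
    by (simp only: sum_product[symmetric] affinity_def)
  finally show ?case by (simp only: Cons.IH list.map zip_Cons_Cons prod_list.Cons prod.case)
qed

lemma affinity_nonneg: "stochastic Y V x \<Longrightarrow> stochastic Y V x' \<Longrightarrow> 0 \<le> affinity Y V x x'"
  unfolding affinity_def stochastic_def by (intro sum_nonneg) auto

text \<open>This is where the Euclidean metric on square roots of distributions enters: it
  determines the affinity, and affinities multiply over letters.\<close>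

lemma affinity_eq:
  assumes "stochastic Y V x" "stochastic Y V x'"
  shows "affinity Y V x x' = 1 - (\<Sum>y\<in>Y. (sqrt (V x y) - sqrt (V x' y))\<^sup>2) / 2"
proof -
  have "(\<Sum>y\<in>Y. (sqrt (V x y) - sqrt (V x' y))\<^sup>2) = (\<Sum>y\<in>Y. V x y + V x' y - 2 * sqrt (V x y * V x' y))"
    using assms by (intro sum.cong refl) (simp add: stochastic_def power2_diff real_sqrt_mult)
  also have "\<dots> = 2 - 2 * affinity Y V x x'"
    using assms by (simp add: sum.distrib sum_subtractf stochastic_def affinity_def sum_distrib_left)
  finally show ?thesis by linarith
qed

definition ham :: "'x list \<Rightarrow> 'x list \<Rightarrow> nat" where
  "ham xs ys = card {i. i < length xs \<and> xs ! i \<noteq> ys ! i}"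

text \<open>A position where the words differ contributes at most \<open>1 - r / 2\<close>, hence at
  most \<open>exp (- (r / 2))\<close>; any other position contributes at most 1.\<close>

lemma word_affinity_le:
  assumes "length xs = length xs'"
    and st: "\<And>x. x \<in> set xs \<union> set xs' \<Longrightarrow> stochastic Y V x"
    and sep: "\<And>x x'. x \<in> set xs \<Longrightarrow> x' \<in> set xs' \<Longrightarrow> x \<noteq> x' \<Longrightarrow>
      r \<le> (\<Sum>y\<in>Y. (sqrt (V x y) - sqrt (V x' y))\<^sup>2)"
  shows "(\<Sum>ys\<in>words Y (length xs). sqrt (word_prob V xs ys * word_prob V xs' ys))
    \<le> exp (- (r / 2) * ham xs xs')"
proof -
  have "(\<Prod>i<length xs. affinity Y V (xs ! i) (xs' ! i))
      \<le> (\<Prod>i<length xs. if xs ! i \<noteq> xs' ! i then exp (- (r / 2)) else 1)"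
  proof (intro prod_mono conjI)
    fix i assume "i \<in> {..<length xs}"
    then have mem: "xs ! i \<in> set xs" "xs' ! i \<in> set xs'" using assms(1) by auto
    then have s: "stochastic Y V (xs ! i)" "stochastic Y V (xs' ! i)" using st by auto
    show "0 \<le> affinity Y V (xs ! i) (xs' ! i)" by (rule affinity_nonneg[OF s])
    show "affinity Y V (xs ! i) (xs' ! i) \<le> (if xs ! i \<noteq> xs' ! i then exp (- (r / 2)) else 1)"
    proof (cases "xs ! i = xs' ! i")
      case True
      have "affinity Y V (xs ! i) (xs' ! i) \<le> 1"
        unfolding affinity_eq[OF s] by (simp add: sum_nonneg)
      then show ?thesis using True by simp
    next
      case False
      have "affinity Y V (xs ! i) (xs' ! i) \<le> 1 + (- (r / 2))"
        using sep[OF mem False] by (simp add: affinity_eq[OF s])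
      also have "\<dots> \<le> exp (- (r / 2))" by (rule exp_ge_add_one_self)
      finally show ?thesis using False by simp
    qed
  qed
  also have "\<dots> = exp (- (r / 2)) ^ ham xs xs'"
    by (simp add: prod.If_cases ham_def Int_def)
  finally show ?thesis
    unfolding word_affinity[OF assms(1)] prod_list_zip_nth[OF assms(1)]
    by (simp add: exp_of_nat2_mult[symmetric] algebra_simps)
qed

section \<open>Entropy-typical sets and the two error probabilities\<close>

definition entropy :: "'y set \<Rightarrow> ('x \<Rightarrow> 'y \<Rightarrow> real) \<Rightarrow> 'x \<Rightarrow> real" where
  "entropy Y V x = - (\<Sum>y\<in>Y. V x y * ln (V x y))"

definition word_entropy :: "'y set \<Rightarrow> ('x \<Rightarrow> 'y \<Rightarrow> real) \<Rightarrow> 'x list \<Rightarrow> real" where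
  "word_entropy Y V xs = (\<Sum>x\<leftarrow>xs. entropy Y V x)"

lemma stochastic_le_1: "finite Y \<Longrightarrow> stochastic Y V x \<Longrightarrow> y \<in> Y \<Longrightarrow> V x y \<le> 1"
  using member_le_sum[of y Y "V x"] by (auto simp: stochastic_def)

text \<open>Everything follows from \<open>ln z \<le> z - 1\<close>; for the last bound write
  \<open>v\<close> as the square of \<open>s\<close>, so that the expression becomes
  \<open>4 * (s * ln s)\<^sup>2\<close>. The bounds are uniform down to \<open>v = 0\<close>, so a
  single variance constant serves all output distributions.\<close>

lemma neg_x_ln_x_bounds:
  assumes "0 \<le> v" "v \<le> (1 :: real)"
  shows "0 \<le> - (v * ln v)" "- (v * ln v) \<le> 1" "v * (ln v)\<^sup>2 \<le> 4"
proof -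
  have "v * - ln v \<ge> 0"
  proof (cases "v = 0")
    case False
    then have "v > 0" using assms by simp
    then show ?thesis using assms by (intro mult_nonneg_nonneg) simp_all
  qed simp
  then show "0 \<le> - (v * ln v)" by simp
  have "v * ln (1 / v) \<le> 1"
  proof (cases "v = 0")
    case False
    then have "v * ln (1 / v) \<le> v * (1 / v - 1)"
      using assms by (intro mult_left_mono ln_le_minus_one) auto
    then show ?thesis using False assms by (simp add: algebra_simps)
  qed simp
  then show "- (v * ln v) \<le> 1" by (cases "v = 0") (use assms in \<open>simp_all add: ln_div\<close>)
  show "v * (ln v)\<^sup>2 \<le> 4"
  proof (cases "v = 0")
    case False
    define s where "s = sqrt v"
    have s: "s > 0" "s \<le> 1" "v = s * s" using False assms by (auto simp: s_def)
    have "s * ln (1 / s) \<le> s * (1 / s - 1)"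
      using s by (intro mult_left_mono ln_le_minus_one) auto
    then have "s * - ln s \<le> 1" using s by (simp add: algebra_simps ln_div)
    moreover have "0 \<le> s * - ln s" using s by (intro mult_nonneg_nonneg) auto
    ultimately have "(s * - ln s)\<^sup>2 \<le> 1" by (rule power_le_one[rotated])
    moreover have "v * (ln v)\<^sup>2 = 4 * (s * - ln s)\<^sup>2"
      using s by (simp add: ln_mult power2_eq_square algebra_simps)
    ultimately show ?thesis by simp
  qed simp
qed

lemma entropy_bounds:
  assumes "finite Y" "stochastic Y V x"
  shows "0 \<le> entropy Y V x" "entropy Y V x \<le> card Y"
proof -
  have b: "0 \<le> - (V x y * ln (V x y))" "- (V x y * ln (V x y)) \<le> 1" if "y \<in> Y" for y
    using neg_x_ln_x_bounds(1,2)[of "V x y"] stochastic_le_1[OF assms that] assms(2) that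
    by (auto simp: stochastic_def)
  have e: "entropy Y V x = (\<Sum>y\<in>Y. - (V x y * ln (V x y)))"
    by (simp add: entropy_def sum_negf)
  show "0 \<le> entropy Y V x" unfolding e using b(1) by (rule sum_nonneg)
  show "entropy Y V x \<le> card Y" unfolding e using sum_bounded_above[of Y _ 1, OF b(2)] by simp
qed

lemma word_entropy_bounds:
  assumes "finite Y" "\<And>x. x \<in> set xs \<Longrightarrow> stochastic Y V x"
  shows "0 \<le> word_entropy Y V xs" "word_entropy Y V xs \<le> length xs * card Y"
proof -
  have "0 \<le> word_entropy Y V xs \<and> word_entropy Y V xs \<le> length xs * card Y"
    using assms(2)
  proof (induction xs)
    case (Cons x xs)
    then show ?case
      using entropy_bounds[OF assms(1), of V x] by (simp add: word_entropy_def distrib_right)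
  qed (simp add: word_entropy_def)
  then show "0 \<le> word_entropy Y V xs" "word_entropy Y V xs \<le> length xs * card Y" by auto
qed

text \<open>Weak typicality with the absolute deviation \<open>a\<close>, later of order
  \<open>sqrt n\<close>. The positivity clause removes words of probability 0, where
  \<open>ln\<close> carries only a default value.\<close>

definition typical :: "'y set \<Rightarrow> ('x \<Rightarrow> 'y \<Rightarrow> real) \<Rightarrow> real \<Rightarrow> 'x list \<Rightarrow> 'y list set" where
  "typical Y V a xs = {ys \<in> words Y (length xs). 0 < word_prob V xs ys \<and>
     \<bar>ln (word_prob V xs ys) + word_entropy Y V xs\<bar> \<le> a}"

text \<open>Exhibits the centered log-likelihood as a sum of letter scores, the form to which
  \<open>word_prob_score\<close> applies.\<close>

lemma ln_word_prob:
  "length ys = length xs \<Longrightarrow> word_prob V xs ys \<noteq> 0 \<Longrightarrow>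
    (\<And>x y. x \<in> set xs \<Longrightarrow> y \<in> set ys \<Longrightarrow> 0 \<le> V x y) \<Longrightarrow>
    ln (word_prob V xs ys) + word_entropy Y V xs = (\<Sum>(x, y)\<leftarrow>zip xs ys. ln (V x y) + entropy Y V x)"
proof (induction ys xs rule: list_induct2)
  case Nil
  then show ?case by (simp add: word_entropy_def)
next
  case (Cons y ys x xs)
  have "0 < V x y" using Cons.prems by (simp add: order.not_eq_order_implies_strict)
  moreover have "0 \<le> word_prob V xs ys"
    unfolding word_prob_def using Cons.prems(2)
    by (intro prod_list_nonneg) (auto dest: set_zip_leftD set_zip_rightD)
  then have "0 < word_prob V xs ys" using Cons.prems(1) by simp
  ultimately show ?case
    using Cons by (simp add: ln_mult word_entropy_def)
qed

text \<open>Chebyshev's inequality for the centered log-likelihood, with variance at most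
  \<open>4 * card Y\<close> per letter.\<close>

lemma sum_atypical_le:
  assumes Y: "finite Y" and st: "\<And>x. x \<in> set xs \<Longrightarrow> stochastic Y V x" and a: "a > 0"
  shows "(\<Sum>ys\<in>words Y (length xs) - typical Y V a xs. word_prob V xs ys) \<le> 4 * card Y * length xs / a\<^sup>2"
proof -
  define Z where "Z x y = ln (V x y) + entropy Y V x" for x y
  define S where "S ys = (\<Sum>(x, y)\<leftarrow>zip xs ys. Z x y)" for ys
  let ?W = "words Y (length xs)" and ?P = "word_prob V xs"
  have P0: "0 \<le> ?P ys" if "ys \<in> ?W" for ys
    using st that by (rule word_prob_nonneg)
  have mean: "(\<Sum>y\<in>Y. V x y * Z x y) = 0" if "x \<in> set xs" for x
  proof -
    have "(\<Sum>y\<in>Y. V x y * Z x y) = (\<Sum>y\<in>Y. V x y * ln (V x y)) + (\<Sum>y\<in>Y. V x y) * entropy Y V x"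
      unfolding Z_def distrib_left sum.distrib sum_distrib_right ..
    then show ?thesis using st[OF that] by (simp add: stochastic_def entropy_def)
  qed
  have var: "(\<Sum>y\<in>Y. V x y * (Z x y)\<^sup>2) \<le> 4 * card Y" if "x \<in> set xs" for x
  proof -
    let ?h = "entropy Y V x"
    have sq: "V x y * (Z x y)\<^sup>2 = V x y * (ln (V x y))\<^sup>2 + V x y * ln (V x y) * (2 * ?h) + V x y * ?h\<^sup>2" for y
      by (simp add: Z_def power2_eq_square algebra_simps)
    have "(\<Sum>y\<in>Y. V x y * (Z x y)\<^sup>2)
        = (\<Sum>y\<in>Y. V x y * (ln (V x y))\<^sup>2) + (\<Sum>y\<in>Y. V x y * ln (V x y)) * (2 * ?h) + (\<Sum>y\<in>Y. V x y) * ?h\<^sup>2"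
      unfolding sq sum.distrib sum_distrib_right ..
    also have "\<dots> = (\<Sum>y\<in>Y. V x y * (ln (V x y))\<^sup>2) - ?h\<^sup>2"
      using st[OF that] by (simp add: stochastic_def entropy_def power2_eq_square)
    also have "\<dots> \<le> (\<Sum>y\<in>Y. V x y * (ln (V x y))\<^sup>2)" by simp
    also have "\<dots> \<le> (\<Sum>y\<in>Y. 4)"
      using st[OF that] stochastic_le_1[OF Y st[OF that]]
      by (intro sum_mono neg_x_ln_x_bounds(3)) (auto simp: stochastic_def)
    finally show ?thesis by simp
  qed
  have second: "(\<Sum>ys\<in>?W. ?P ys * (S ys)\<^sup>2) \<le> length xs * (4 * card Y)"
    using word_prob_score[of xs Y V Z "4 * card Y", OF st mean var] by (simp add: S_def)
  \<comment> \<open>Words of probability 0 contribute nothing, although they are atypical by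
    definition; on the other atypical words the score exceeds \<open>a\<close>.\<close>
  have "?P ys * a\<^sup>2 \<le> ?P ys * (S ys)\<^sup>2" if "ys \<in> ?W - typical Y V a xs" for ys
  proof (cases "?P ys = 0")
    case False
    have W: "ys \<in> ?W" using that by simp
    then have "ln (?P ys) + word_entropy Y V xs = S ys"
      unfolding S_def Z_def using False st
      by (intro ln_word_prob) (auto simp: words_def stochastic_def)
    moreover have "0 < ?P ys" using P0[OF W] False by simp
    ultimately have "a < \<bar>S ys\<bar>" using that by (auto simp: typical_def)
    then have "a\<^sup>2 \<le> (S ys)\<^sup>2" using a by (simp add: abs_le_square_iff[symmetric])
    then show ?thesis using P0[OF W] by (rule mult_left_mono)
  qed simp
  then have "(\<Sum>ys\<in>?W - typical Y V a xs. ?P ys) * a\<^sup>2 \<le> (\<Sum>ys\<in>?W - typical Y V a xs. ?P ys * (S ys)\<^sup>2)"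
    unfolding sum_distrib_right by (rule sum_mono)
  also have "\<dots> \<le> (\<Sum>ys\<in>?W. ?P ys * (S ys)\<^sup>2)"
    using P0 by (intro sum_mono2 finite_words Y) auto
  also note second
  finally show ?thesis using a by (simp add: field_simps)
qed

lemma sum_typical_ge:
  assumes Y: "finite Y" and st: "\<And>x. x \<in> set xs \<Longrightarrow> stochastic Y V x" and a: "a > 0"
  shows "1 - 4 * card Y * length xs / a\<^sup>2 \<le> (\<Sum>ys\<in>typical Y V a xs. word_prob V xs ys)"
proof -
  have "typical Y V a xs \<subseteq> words Y (length xs)" by (auto simp: typical_def)
  from sum.subset_diff[OF this finite_words[OF Y], of "word_prob V xs"]
  show ?thesis using sum_atypical_le[of Y xs V a, OF assms] sum_word_prob[of xs Y V, OF st] by simp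
qed

text \<open>On the intersection of two typical sets with comparable entropies the two likelihoods agree up
  to a factor \<open>exp (2 a + e)\<close>, so the overlap is controlled by the affinity.\<close>
lemma sum_other_typical_le:
  assumes Y: "finite Y" and len: "length xs = length xs'"
    and st: "\<And>x. x \<in> set xs \<union> set xs' \<Longrightarrow> stochastic Y V x" and a: "a > 0"
    and ent: "\<bar>word_entropy Y V xs - word_entropy Y V xs'\<bar> \<le> e"
  shows "(\<Sum>ys\<in>typical Y V a xs'. word_prob V xs ys) \<le> 4 * card Y * length xs / a\<^sup>2
    + exp (a + e / 2) * (\<Sum>ys\<in>words Y (length xs). sqrt (word_prob V xs ys * word_prob V xs' ys))"
proof -
  let ?W = "words Y (length xs)" and ?P = "word_prob V xs" and ?P' = "word_prob V xs'"
  let ?T = "typical Y V a xs" and ?T' = "typical Y V a xs'"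
  have st': "\<And>x. x \<in> set xs \<Longrightarrow> stochastic Y V x" "\<And>x. x \<in> set xs' \<Longrightarrow> stochastic Y V x"
    using st by auto
  have sub: "?T' \<subseteq> ?W" "?T \<subseteq> ?W" by (auto simp: typical_def len)
  have P0: "0 \<le> ?P ys" "0 \<le> ?P' ys" if "ys \<in> ?W" for ys
    using word_prob_nonneg[of xs Y V ys "length xs"] word_prob_nonneg[of xs' Y V ys "length xs"] st' that by auto
  have fin: "finite ?T'" "finite ?T" using finite_subset[OF sub(1)] finite_subset[OF sub(2)] finite_words[OF Y] by auto
  \<comment> \<open>Words typical for \<open>xs'\<close> only are atypical for \<open>xs\<close> and
    fall under Chebyshev's bound; the jointly typical ones are left to the affinity.\<close>
  have "(\<Sum>ys\<in>?T'. ?P ys) = (\<Sum>ys\<in>?T' - ?T. ?P ys) + (\<Sum>ys\<in>?T' \<inter> ?T. ?P ys)"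
    using sum.Int_Diff[OF fin(1), of ?P ?T] by simp
  moreover have "(\<Sum>ys\<in>?T' - ?T. ?P ys) \<le> 4 * card Y * length xs / a\<^sup>2"
  proof -
    have "(\<Sum>ys\<in>?T' - ?T. ?P ys) \<le> (\<Sum>ys\<in>?W - ?T. ?P ys)"
      using sub P0 by (intro sum_mono2 finite_Diff finite_words Y) auto
    also have "\<dots> \<le> 4 * card Y * length xs / a\<^sup>2" by (rule sum_atypical_le[OF Y st'(1) a])
    finally show ?thesis .
  qed
  moreover have "(\<Sum>ys\<in>?T' \<inter> ?T. ?P ys) \<le> exp (a + e / 2) * (\<Sum>ys\<in>?W. sqrt (?P ys * ?P' ys))"
  proof -
    have "?P ys \<le> exp (a + e / 2) * sqrt (?P ys * ?P' ys)" if "ys \<in> ?T' \<inter> ?T" for ys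
    proof -
      have pos: "0 < ?P ys" "0 < ?P' ys"
        and l: "\<bar>ln (?P ys) + word_entropy Y V xs\<bar> \<le> a" "\<bar>ln (?P' ys) + word_entropy Y V xs'\<bar> \<le> a"
        using that by (auto simp: typical_def)
      \<comment> \<open>A log-likelihood exceeds the mean of the two by half their difference, which
        is at most \<open>2 * a + e\<close>.\<close>
      have "ln (?P ys) \<le> (a + e / 2) + (ln (?P ys) + ln (?P' ys)) / 2"
        using l ent by (simp add: abs_le_iff field_simps)
      then have "exp (ln (?P ys)) \<le> exp ((a + e / 2) + (ln (?P ys) + ln (?P' ys)) / 2)" by simp
      also have "(ln (?P ys) + ln (?P' ys)) / 2 = ln (sqrt (?P ys * ?P' ys))"
        using pos by (simp add: ln_sqrt ln_mult)
      also have "exp ((a + e / 2) + ln (sqrt (?P ys * ?P' ys))) = exp (a + e / 2) * sqrt (?P ys * ?P' ys)"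
        using pos by (simp add: exp_add)
      finally show ?thesis using pos by simp
    qed
    then have "(\<Sum>ys\<in>?T' \<inter> ?T. ?P ys) \<le> (\<Sum>ys\<in>?T' \<inter> ?T. exp (a + e / 2) * sqrt (?P ys * ?P' ys))"
      by (rule sum_mono)
    also have "\<dots> \<le> (\<Sum>ys\<in>?W. exp (a + e / 2) * sqrt (?P ys * ?P' ys))"
      using sub P0 by (intro sum_mono2 finite_words Y) auto
    finally show ?thesis by (simp add: sum_distrib_left)
  qed
  ultimately show ?thesis by simp
qed

section \<open>Separated sets, covering numbers and Minkowski dimension\<close>

lemma ham_sym: "length xs = length ys \<Longrightarrow> ham xs ys = ham ys xs"
  unfolding ham_def by (intro arg_cong[where f = card]) auto

text \<open>Choose the set of differing positions, one of at most \<open>2 ^ n\<close>, and then the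
  letters on it. The crude \<open>2 ^ n\<close> suffices because it is negligible on the scale
  \<open>n * log n\<close>.\<close>

lemma card_ham_ball:
  assumes Q: "finite Q" "Q \<noteq> {}" and xs: "xs \<in> words Q n"
  shows "card {ys \<in> words Q n. ham xs ys \<le> s} \<le> 2 ^ n * card Q ^ s"
proof -
  define C where "C D = {ys \<in> words Q n. \<forall>i<n. i \<notin> D \<longrightarrow> ys ! i = xs ! i}" for D
  define I where "I = {D \<in> Pow {..<n}. card D \<le> s}"
  have I: "finite I" "card I \<le> 2 ^ n"
  proof -
    show "finite I" by (simp add: I_def)
    have "card I \<le> card (Pow {..<n})" unfolding I_def by (intro card_mono) auto
    then show "card I \<le> 2 ^ n" by (simp add: card_Pow)
  qed
  have "card (C D) \<le> card Q ^ s" if "D \<in> I" for D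
  proof -
    have D: "D \<subseteq> {..<n}" "finite D" "card D \<le> s"
      using that by (auto simp: I_def intro: finite_subset)
    have "inj_on (\<lambda>ys. restrict ((!) ys) D) (C D)"
    proof (rule inj_onI)
      fix ys zs assume m: "ys \<in> C D" "zs \<in> C D" and e: "restrict ((!) ys) D = restrict ((!) zs) D"
      show "ys = zs"
      proof (rule nth_equalityI)
        have l: "length ys = n" "length zs = n" using m unfolding C_def words_def by blast+
        then show "length ys = length zs" by simp
        fix i assume "i < length ys"
        then have i: "i < n" using l by simp
        show "ys ! i = zs ! i"
        proof (cases "i \<in> D")
          case True
          then show ?thesis using fun_cong[OF e, of i] by simp
        next
          case False
          then have "ys ! i = xs ! i" "zs ! i = xs ! i" using m i unfolding C_def by blast+
          then show ?thesis by (simp only:)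
        qed
      qed
    qed
    moreover have "(\<lambda>ys. restrict ((!) ys) D) ` C D \<subseteq> D \<rightarrow>\<^sub>E Q"
    proof (intro image_subsetI PiE_I)
      fix ys i assume "ys \<in> C D" "i \<in> D"
      then have "i < length ys" "set ys \<subseteq> Q" using D(1) unfolding C_def words_def by blast+
      then have "ys ! i \<in> Q" using nth_mem by blast
      then show "restrict ((!) ys) D i \<in> Q" using \<open>i \<in> D\<close> by simp
    qed auto
    ultimately have "card (C D) \<le> card (D \<rightarrow>\<^sub>E Q)"
      by (rule card_inj_on_le) (intro finite_PiE D(2) Q(1))
    also have "\<dots> = card Q ^ card D" using D(2) by (simp add: card_PiE)
    also have "\<dots> \<le> card Q ^ s" using D(3) Q by (intro power_increasing) (simp_all add: Suc_le_eq card_gt_0_iff)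
    finally show ?thesis .
  qed
  note C = this
  have "{ys \<in> words Q n. ham xs ys \<le> s} \<subseteq> (\<Union>D\<in>I. C D)"
  proof
    fix ys assume y: "ys \<in> {ys \<in> words Q n. ham xs ys \<le> s}"
    have "{i. i < length xs \<and> xs ! i \<noteq> ys ! i} \<in> I" "ys \<in> C {i. i < length xs \<and> xs ! i \<noteq> ys ! i}"
      using y xs unfolding I_def C_def ham_def words_def by auto
    then show "ys \<in> (\<Union>D\<in>I. C D)" by blast
  qed
  then have "card {ys \<in> words Q n. ham xs ys \<le> s} \<le> card (\<Union>D\<in>I. C D)"
    using I(1) finite_words[OF Q(1), of n] by (intro card_mono finite_UN_I) (auto simp: C_def)
  also have "\<dots> \<le> (\<Sum>D\<in>I. card (C D))" by (rule card_UN_le[OF I(1)])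
  also have "\<dots> \<le> card I * card Q ^ s" using sum_bounded_above[of I "\<lambda>D. card (C D)", OF C] by simp
  also have "\<dots> \<le> 2 ^ n * card Q ^ s" using I(2) by (rule mult_le_mono1)
  finally show ?thesis .
qed

text \<open>Cardinalities are bounded, so a largest separated set exists; a point near none of its
  members could be added to it. Stated for an abstract relation, it serves words under Hamming
  distance as well as points under a metric.\<close>

lemma exists_maximal_separated:
  assumes bound: "\<And>S. finite S \<Longrightarrow> S \<subseteq> F \<Longrightarrow> (\<forall>x\<in>S. \<forall>y\<in>S. x \<noteq> y \<longrightarrow> \<not> near x y) \<Longrightarrow> card S \<le> M"
    and sym: "\<And>x y. x \<in> F \<Longrightarrow> y \<in> F \<Longrightarrow> near x y \<Longrightarrow> near y x" and refl: "\<And>x. x \<in> F \<Longrightarrow> near x x"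
  shows "\<exists>S. finite S \<and> S \<subseteq> F \<and> (\<forall>x\<in>S. \<forall>y\<in>S. x \<noteq> y \<longrightarrow> \<not> near x y) \<and> (\<forall>y\<in>F. \<exists>x\<in>S. near x y)"
proof -
  define P where "P S \<longleftrightarrow> finite S \<and> S \<subseteq> F \<and> (\<forall>x\<in>S. \<forall>y\<in>S. x \<noteq> y \<longrightarrow> \<not> near x y)" for S
  have "P {}" by (simp add: P_def)
  moreover have "\<forall>S. P S \<longrightarrow> card S \<le> M" using bound by (simp add: P_def)
  ultimately have "\<exists>S. P S \<and> (\<forall>S'. P S' \<longrightarrow> card S' \<le> card S)"
    by (intro ex_has_greatest_nat[of P _ card "Suc M"]) (simp_all add: less_Suc_eq_le)
  then obtain S where S: "P S" "\<And>S'. P S' \<Longrightarrow> card S' \<le> card S" by auto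
  have "\<exists>x\<in>S. near x y" if y: "y \<in> F" for y
  proof (rule ccontr)
    assume "\<not> ?thesis"
    then have n: "\<not> near x y" if "x \<in> S" for x using that by blast
    have SF: "finite S" "S \<subseteq> F" "\<forall>x\<in>S. \<forall>z\<in>S. x \<noteq> z \<longrightarrow> \<not> near x z"
      using S(1) unfolding P_def by blast+
    have n': "\<not> near y x" if "x \<in> S" for x
      using n[OF that] sym[OF y subsetD[OF SF(2) that]] by blast
    have "y \<notin> S" using refl[OF y] n by blast
    moreover have "\<not> near x z" if "x \<in> insert y S" "z \<in> insert y S" "x \<noteq> z" for x z
      using that n[of x] n'[of z] SF(3) by (elim insertE) simp_all
    then have "P (insert y S)" using SF(1,2) y by (simp add: P_def)
    ultimately show False using SF(1) S(2)[of "insert y S"] by simp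
  qed
  then have "\<forall>y\<in>F. \<exists>x\<in>S. near x y" by (intro ballI)
  with S(1) have "finite S \<and> S \<subseteq> F \<and> (\<forall>x\<in>S. \<forall>y\<in>S. x \<noteq> y \<longrightarrow> \<not> near x y) \<and> (\<forall>y\<in>F. \<exists>x\<in>S. near x y)"
    unfolding P_def by (elim conjE) (intro conjI)
  then show ?thesis by (rule exI)
qed

text \<open>The Gilbert--Varshamov count: the balls around a maximal separated set cover
  \<open>B\<close>.\<close>

lemma separated_subset_card:
  assumes B: "finite B" and sym: "\<And>x y. x \<in> B \<Longrightarrow> y \<in> B \<Longrightarrow> near x y \<Longrightarrow> near y x"
    and refl: "\<And>x. x \<in> B \<Longrightarrow> near x x" and ball: "\<And>x. x \<in> B \<Longrightarrow> card {y \<in> B. near x y} \<le> M"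
  shows "\<exists>S\<subseteq>B. (\<forall>x\<in>S. \<forall>y\<in>S. x \<noteq> y \<longrightarrow> \<not> near x y) \<and> card B \<le> card S * M"
proof -
  have "\<exists>S. finite S \<and> S \<subseteq> B \<and> (\<forall>x\<in>S. \<forall>y\<in>S. x \<noteq> y \<longrightarrow> \<not> near x y) \<and> (\<forall>y\<in>B. \<exists>x\<in>S. near x y)"
  proof (rule exists_maximal_separated)
    show "card S \<le> card B" if "S \<subseteq> B" for S using that by (rule card_mono[OF B])
  qed (fact sym refl)+
  then obtain S where "finite S \<and> S \<subseteq> B \<and> (\<forall>x\<in>S. \<forall>y\<in>S. x \<noteq> y \<longrightarrow> \<not> near x y) \<and> (\<forall>y\<in>B. \<exists>x\<in>S. near x y)" ..
  then have S: "finite S" "S \<subseteq> B" "\<And>x y. x \<in> S \<Longrightarrow> y \<in> S \<Longrightarrow> x \<noteq> y \<Longrightarrow> \<not> near x y"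
    "\<And>y. y \<in> B \<Longrightarrow> \<exists>x\<in>S. near x y"
    by simp_all
  have "B = (\<Union>x\<in>S. {y \<in> B. near x y})"
  proof
    show "B \<subseteq> (\<Union>x\<in>S. {y \<in> B. near x y})" using S(4) by fast
  qed blast
  then have "card B \<le> (\<Sum>x\<in>S. card {y \<in> B. near x y})" using card_UN_le[OF S(1), of "\<lambda>x. {y \<in> B. near x y}"] by (simp only:)
  also have "\<dots> \<le> card S * M"
    using sum_bounded_above[of S "\<lambda>x. card {y \<in> B. near x y}" M] ball[OF subsetD[OF S(2)]] by simp
  finally have card: "card B \<le> card S * M" .
  show ?thesis
  proof (intro exI[of _ S] conjI ballI impI card)
    show "S \<subseteq> B" by (rule S(2))
    show "\<not> near x y" if "x \<in> S" "y \<in> S" "x \<noteq> y" for x y using that by (rule S(3))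
  qed
qed

text \<open>Phrased as a finite labelling whose cells have diameter at most \<open>\<delta>\<close>.
  One representative per cell gives a cover with centers in \<open>F\<close>, and a separated set
  meets each cell at most once, both without a triangle inequality for \<open>dst\<close>.\<close>

definition totally_bdd :: "('p \<Rightarrow> 'p \<Rightarrow> real) \<Rightarrow> 'p set \<Rightarrow> bool" where
  "totally_bdd dst F \<longleftrightarrow> (\<forall>\<delta>>0. \<exists>g :: 'p \<Rightarrow> nat. finite (g ` F) \<and>
     (\<forall>a\<in>F. \<forall>b\<in>F. g a = g b \<longrightarrow> dst a b \<le> \<delta>))"

text \<open>Round every coordinate down to a grid of mesh \<open>1 / m\<close>. Points with equal
  roundings differ by at most \<open>1 / m\<close> per coordinate, hence by at most
  \<open>sqrt (card I) / m\<close>.\<close>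

lemma totally_bdd_coordinates:
  fixes \<phi> :: "'i \<Rightarrow> 'p \<Rightarrow> real"
  assumes I: "finite I" and bd: "\<And>i p. i \<in> I \<Longrightarrow> p \<in> F \<Longrightarrow> \<bar>\<phi> i p\<bar> \<le> 1"
    and dst: "\<And>p q. p \<in> F \<Longrightarrow> q \<in> F \<Longrightarrow> dst p q \<le> sqrt (\<Sum>i\<in>I. (\<phi> i p - \<phi> i q)\<^sup>2)"
  shows "totally_bdd dst F"
  unfolding totally_bdd_def
proof (intro allI impI)
  fix \<delta> :: real assume "\<delta> > 0"
  obtain m :: nat where "sqrt (card I) / \<delta> < m" using reals_Archimedean2 by blast
  then have m: "m > 0" "sqrt (card I) \<le> \<delta> * m"
  proof -
    have "0 \<le> sqrt (card I) / \<delta>" using \<open>\<delta> > 0\<close> by simp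
    also note \<open>sqrt (card I) / \<delta> < m\<close>
    finally show "m > 0" by simp
    show "sqrt (card I) \<le> \<delta> * m"
      using \<open>sqrt (card I) / \<delta> < m\<close> \<open>\<delta> > 0\<close> by (simp add: field_simps)
  qed
  define h where "h p = restrict (\<lambda>i. \<lfloor>\<phi> i p * m\<rfloor>) I" for p
  have "h ` F \<subseteq> I \<rightarrow>\<^sub>E {- int m..int m}"
  proof (intro image_subsetI PiE_I)
    fix p i assume "p \<in> F" "i \<in> I"
    then have "\<bar>\<phi> i p * m\<bar> \<le> m" using bd[of i p] m(1) by (simp add: abs_mult)
    then have "- real m \<le> \<phi> i p * m" "\<phi> i p * m \<le> real m" by linarith+
    then have "- int m \<le> \<lfloor>\<phi> i p * m\<rfloor>" "\<lfloor>\<phi> i p * m\<rfloor> \<le> int m" by linarith+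
    then show "h p i \<in> {- int m..int m}" using \<open>i \<in> I\<close> by (simp add: h_def)
  qed (simp add: h_def)
  then have fin: "finite (h ` F)" by (rule finite_subset) (simp add: I finite_PiE)
  \<comment> \<open>The roundings are finitely many functions; \<open>e\<close> renames them as the
    natural number labels that \<open>totally_bdd\<close> asks for.\<close>
  from finite_imp_inj_to_nat_seg[OF this] obtain e :: "('i \<Rightarrow> int) \<Rightarrow> nat" where e: "inj_on e (h ` F)"
    by (elim exE conjE)
  have "dst a b \<le> \<delta>" if ab: "a \<in> F" "b \<in> F" and "e (h a) = e (h b)" for a b
  proof -
    have "h a = h b" by (rule inj_on_eq_iff[OF e, THEN iffD1]) (simp_all add: that)
    then have eq: "\<lfloor>\<phi> i a * m\<rfloor> = \<lfloor>\<phi> i b * m\<rfloor>" if "i \<in> I" for i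
    proof -
      have "h a i = h b i" using \<open>h a = h b\<close> by (rule fun_cong)
      then show ?thesis unfolding h_def using that by simp
    qed
    have "(\<phi> i a - \<phi> i b)\<^sup>2 \<le> (1 / m)\<^sup>2" if "i \<in> I" for i
    proof -
      have "\<bar>\<phi> i a * m - \<phi> i b * m\<bar> \<le> 1" using eq[OF that] by linarith
      then have "\<bar>\<phi> i a - \<phi> i b\<bar> * m \<le> 1" using m(1) by (simp add: abs_mult flip: left_diff_distrib)
      then have "\<bar>\<phi> i a - \<phi> i b\<bar> \<le> \<bar>1 / m\<bar>" using m(1) by (simp add: field_simps)
      then show ?thesis by (simp only: abs_le_square_iff)
    qed
    then have "(\<Sum>i\<in>I. (\<phi> i a - \<phi> i b)\<^sup>2) \<le> card I * (1 / m)\<^sup>2"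
      by (rule sum_bounded_above)
    then have "dst a b \<le> sqrt (card I * (1 / m)\<^sup>2)"
      by (intro order.trans[OF dst[OF ab]] real_sqrt_le_mono)
    also have "\<dots> = sqrt (card I) / m" by (simp add: real_sqrt_mult real_sqrt_divide power_one_over)
    also have "\<dots> \<le> \<delta>" using m by (simp add: field_simps)
    finally show ?thesis .
  qed
  moreover have "finite ((e \<circ> h) ` F)" unfolding image_comp[symmetric] using fin by (rule finite_imageI)
  ultimately show "\<exists>g :: 'p \<Rightarrow> nat. finite (g ` F) \<and> (\<forall>a\<in>F. \<forall>b\<in>F. g a = g b \<longrightarrow> dst a b \<le> \<delta>)"
    unfolding o_def by blast
qed

lemma cover_num_le:
  assumes "finite C" "C \<subseteq> F" "F \<subseteq> (\<Union>c\<in>C. {p. dst c p \<le> \<delta>})"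
  shows "cover_num dst F \<delta> \<le> card C"
  unfolding cover_num_def by (intro Least_le exI[of _ C] conjI refl assms)

text \<open>Total boundedness supplies some finite cover, so the \<open>LEAST\<close> in
  \<open>cover_num_def\<close> ranges over a nonempty set and is attained.\<close>

lemma cover_num_attained:
  assumes "totally_bdd dst F" "\<delta> > 0"
  obtains C where "finite C" "card C = cover_num dst F \<delta>" "C \<subseteq> F" "F \<subseteq> (\<Union>c\<in>C. {p. dst c p \<le> \<delta>})"
proof -
  obtain g :: "'a \<Rightarrow> nat" where g: "finite (g ` F)" "\<forall>a\<in>F. \<forall>b\<in>F. g a = g b \<longrightarrow> dst a b \<le> \<delta>"
    using assms unfolding totally_bdd_def by blast
  define C where "C = inv_into F g ` g ` F"
  have "finite C" "C \<subseteq> F" using g(1) by (auto simp: C_def inv_into_into)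
  moreover have "F \<subseteq> (\<Union>c\<in>C. {p. dst c p \<le> \<delta>})"
  proof
    fix p assume p: "p \<in> F"
    then have "inv_into F g (g p) \<in> F" "g (inv_into F g (g p)) = g p"
      by (simp_all add: inv_into_into f_inv_into_f)
    then have "dst (inv_into F g (g p)) p \<le> \<delta>" using g(2) p by blast
    then show "p \<in> (\<Union>c\<in>C. {p. dst c p \<le> \<delta>})" using p by (auto simp: C_def)
  qed
  ultimately have "\<exists>k C. finite C \<and> card C = k \<and> C \<subseteq> F \<and> F \<subseteq> (\<Union>c\<in>C. {p. dst c p \<le> \<delta>})"
    by (intro exI[of _ "card C"] exI[of _ C] conjI refl)
  from LeastI_ex[OF this] obtain D where
    "finite D \<and> card D = cover_num dst F \<delta> \<and> D \<subseteq> F \<and> F \<subseteq> (\<Union>c\<in>D. {p. dst c p \<le> \<delta>})"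
    unfolding cover_num_def ..
  then show ?thesis by (elim conjE) (rule that)
qed

lemma cover_num_antimono:
  assumes "totally_bdd dst F" "0 < \<delta>" "\<delta> \<le> \<delta>'"
  shows "cover_num dst F \<delta>' \<le> cover_num dst F \<delta>"
proof -
  obtain C where C: "finite C" "card C = cover_num dst F \<delta>" "C \<subseteq> F" "F \<subseteq> (\<Union>c\<in>C. {p. dst c p \<le> \<delta>})"
    by (rule cover_num_attained[OF assms(1,2)])
  moreover have "(\<Union>c\<in>C. {p. dst c p \<le> \<delta>}) \<subseteq> (\<Union>c\<in>C. {p. dst c p \<le> \<delta>'})"
    using assms(3) by (intro UN_mono) auto
  ultimately have "F \<subseteq> (\<Union>c\<in>C. {p. dst c p \<le> \<delta>'})" by (simp only: subset_trans)
  then show ?thesis using cover_num_le[of C F dst \<delta>'] C by simp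
qed

lemma cover_num_pos:
  assumes "totally_bdd dst F" "\<delta> > 0" "F \<noteq> {}"
  shows "1 \<le> cover_num dst F \<delta>"
proof -
  obtain C where C: "finite C" "card C = cover_num dst F \<delta>" "F \<subseteq> (\<Union>c\<in>C. {p. dst c p \<le> \<delta>})"
    by (rule cover_num_attained[OF assms(1,2)])
  then have "C \<noteq> {}" using assms(3) by auto
  then have "0 < card C" using C(1) by (simp add: card_gt_0_iff)
  then show ?thesis using C(2) by simp
qed

text \<open>A maximal \<open>\<delta>\<close>-separated subset of \<open>F\<close> is itself a cover
  with radius \<open>\<delta>\<close> and centers in \<open>F\<close>.\<close>

lemma packing_ge_cover_num:
  assumes tb: "totally_bdd dst F" and \<delta>: "\<delta> > 0"
    and sym: "\<And>x y. dst x y = dst y x" and refl: "\<And>x. dst x x = 0"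
  obtains S where "finite S" "S \<subseteq> F" "\<And>x y. x \<in> S \<Longrightarrow> y \<in> S \<Longrightarrow> x \<noteq> y \<Longrightarrow> \<delta> < dst x y"
    "cover_num dst F \<delta> \<le> card S"
proof -
  obtain g :: "'a \<Rightarrow> nat" where g: "finite (g ` F)" "\<forall>a\<in>F. \<forall>b\<in>F. g a = g b \<longrightarrow> dst a b \<le> \<delta>"
    using tb \<delta> unfolding totally_bdd_def by blast
  have bound: "card S \<le> card (g ` F)"
    if "finite S" "S \<subseteq> F" "\<forall>x\<in>S. \<forall>y\<in>S. x \<noteq> y \<longrightarrow> \<not> dst x y \<le> \<delta>" for S
  proof (rule card_inj_on_le[OF _ _ g(1)])
    show "inj_on g S"
    proof (rule inj_onI, rule ccontr)
      fix x y assume "x \<in> S" "y \<in> S" "g x = g y" "x \<noteq> y"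
      then show False using that(2,3) g(2) by (meson subsetD)
    qed
    show "g ` S \<subseteq> g ` F" using that by blast
  qed
  have "\<exists>S. finite S \<and> S \<subseteq> F \<and> (\<forall>x\<in>S. \<forall>y\<in>S. x \<noteq> y \<longrightarrow> \<not> dst x y \<le> \<delta>) \<and> (\<forall>y\<in>F. \<exists>x\<in>S. dst x y \<le> \<delta>)"
  proof (rule exists_maximal_separated)
    show "dst y x \<le> \<delta>" if "dst x y \<le> \<delta>" for x y using that by (simp only: sym[of y x])
    show "dst x x \<le> \<delta>" for x using \<delta> by (simp add: refl)
  qed (fact bound)
  then obtain S where "finite S \<and> S \<subseteq> F \<and> (\<forall>x\<in>S. \<forall>y\<in>S. x \<noteq> y \<longrightarrow> \<not> dst x y \<le> \<delta>) \<and> (\<forall>y\<in>F. \<exists>x\<in>S. dst x y \<le> \<delta>)" ..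
  then have S: "finite S" "S \<subseteq> F" "\<And>x y. x \<in> S \<Longrightarrow> y \<in> S \<Longrightarrow> x \<noteq> y \<Longrightarrow> \<delta> < dst x y"
    "\<And>y. y \<in> F \<Longrightarrow> \<exists>x\<in>S. dst x y \<le> \<delta>"
    by (simp_all add: not_le)
  have "cover_num dst F \<delta> \<le> card S"
    using S(4) by (intro cover_num_le S(1,2)) blast
  then show ?thesis by (intro that[OF S(1,2)] S(3))
qed

section \<open>From bounds at integer block lengths to the lower Minkowski dimension\<close>

lemma log_cover_num_nonneg:
  assumes "totally_bdd dst F" "\<delta> > 0" "F \<noteq> {}"
  shows "0 \<le> log 2 (cover_num dst F \<delta>)"
  using cover_num_pos[OF assms] by simp

text \<open>Every small \<open>\<delta>\<close> is matched with an n for which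
  \<open>c / sqrt n\<close> is just above \<open>\<delta>\<close>; then \<open>log 2 n\<close> is
  \<open>- 2 * log 2 \<delta>\<close> up to a bounded error, which disappears after division by
  \<open>- log 2 \<delta>\<close>.\<close>

lemma liminf_le_half_mink_dim:
  assumes tb: "totally_bdd dst F" "F \<noteq> {}" and c: "c > 0"
    and le: "\<forall>\<^sub>F n in sequentially. r n \<le> ereal (log 2 (cover_num dst F (c / sqrt n)) / log 2 n)"
  shows "liminf r \<le> ereal (1 / 2) * lower_mink_dim dst F"
proof (rule dense_le)
  fix x assume x: "x < liminf r"
  let ?G = "cover_num dst F"
  have small: "\<forall>\<^sub>F \<delta> in at_right 0. \<delta> < e \<and> 0 < \<delta>" if "e > 0" for e :: real
    using that by (auto simp: eventually_at_right_field intro!: exI[of _ e])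
  have key: "ereal (2 * y) \<le> lower_mink_dim dst F" if y: "ereal y < liminf r" "0 \<le> y" for y
  proof -
    from less_LiminfD[OF y(1)] le have "\<forall>\<^sub>F n in sequentially. y \<le> log 2 (?G (c / sqrt n)) / log 2 n"
      by eventually_elim (metis ereal_less_eq(3) less_imp_le order.trans)
    then obtain n0 :: nat where n0: "\<And>n :: nat. n \<ge> n0 \<Longrightarrow> y \<le> log 2 (?G (c / sqrt n)) / log 2 n"
      by (auto simp: eventually_sequentially)
    define N where "N = real n0 + 2"
    have N: "N > 0" by (simp add: N_def)
    then have e1: "0 < c / sqrt N" using c by simp
    have "\<forall>\<^sub>F \<delta> in at_right 0. y * (2 + log 2 (c\<^sup>2 / 2) / - log 2 \<delta>) \<le> log 2 (?G \<delta>) / - log 2 \<delta>"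
      using small[OF e1] small[of 1, simplified]
    proof eventually_elim
      case (elim \<delta>)
      have \<delta>: "0 < \<delta>" "\<delta> < 1" "\<delta> * sqrt N < c"
        using elim c N by (auto simp: field_simps N_def)
      then have L: "0 < - log 2 \<delta>" by simp
      have "(\<delta> * sqrt N)\<^sup>2 < c\<^sup>2" using \<delta> N c by (intro power_strict_mono) auto
      then have "N < c\<^sup>2 / \<delta>\<^sup>2" using \<delta>(1) N by (simp add: power_mult_distrib field_simps)
      \<comment> \<open>The largest n with \<open>\<delta> \<le> c / sqrt n\<close>, so that the
        covering number at \<open>c / sqrt n\<close> is at most the one at
        \<open>\<delta>\<close>.\<close>
      define n where "n = nat \<lfloor>c\<^sup>2 / \<delta>\<^sup>2\<rfloor>"
      have n: "real n \<le> c\<^sup>2 / \<delta>\<^sup>2" "c\<^sup>2 / \<delta>\<^sup>2 - 1 < real n"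
        using \<open>N < c\<^sup>2 / \<delta>\<^sup>2\<close> N unfolding n_def by linarith+
      \<comment> \<open>Here \<open>q\<close> stands for
        \<open>c\<^sup>2 / \<delta>\<^sup>2\<close>. Rounding it down loses at most a factor 2, an
        additive constant in the logarithm.\<close>
      have "real n0 + 1 < real n \<and> q / 2 \<le> real n" if "real n0 + 2 < q" "q - 1 < real n" for q
        using that by (auto simp: field_simps)
      from this[OF \<open>N < c\<^sup>2 / \<delta>\<^sup>2\<close>[unfolded N_def] n(2)]
      have "real n0 + 1 < real n" "c\<^sup>2 / \<delta>\<^sup>2 / 2 \<le> real n" by blast+
      moreover from this(1) have "n \<ge> n0" "2 \<le> n" by linarith+
      ultimately have nN: "n \<ge> n0" "real n \<ge> 2" "c\<^sup>2 / \<delta>\<^sup>2 / 2 \<le> real n"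
        by simp_all
      have "sqrt n * \<delta> \<le> c"
      proof (rule power2_le_imp_le)
        show "(sqrt n * \<delta>)\<^sup>2 \<le> c\<^sup>2" using n(1) \<delta>(1) by (simp add: power_mult_distrib field_simps)
      qed (use c in simp)
      then have "\<delta> \<le> c / sqrt n" using nN(2) by (simp add: field_simps)
      then have G: "log 2 (?G (c / sqrt n)) \<le> log 2 (?G \<delta>)"
        using cover_num_antimono[OF tb(1) \<delta>(1), of "c / sqrt n"] cover_num_pos[OF tb(1) _ tb(2), of "c / sqrt n"] c nN(2)
        by simp
      have "log 2 (c\<^sup>2 / 2) + 2 * - log 2 \<delta> = log 2 (c\<^sup>2 / \<delta>\<^sup>2 / 2)"
        using c \<delta>(1) by (simp add: log_divide log_nat_power log_mult)
      also have "\<dots> \<le> log 2 n" using nN c \<delta>(1) by (intro log_mono) auto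
      finally have "y * (log 2 (c\<^sup>2 / 2) + 2 * - log 2 \<delta>) \<le> y * log 2 n" using y(2) by (rule mult_left_mono)
      also have "\<dots> \<le> log 2 (?G (c / sqrt n))" using n0[OF nN(1)] nN(2) by (simp add: field_simps)
      also note G
      finally have "y * (log 2 (c\<^sup>2 / 2) + 2 * - log 2 \<delta>) / - log 2 \<delta> \<le> log 2 (?G \<delta>) / - log 2 \<delta>"
        using L by (intro divide_right_mono) auto
      moreover have "y * (log 2 (c\<^sup>2 / 2) + 2 * - log 2 \<delta>) / - log 2 \<delta> = y * (2 + log 2 (c\<^sup>2 / 2) / - log 2 \<delta>)"
        using L by (simp add: field_simps)
      ultimately show ?case by (simp only:)
    qed
    then have "Liminf (at_right 0) (\<lambda>\<delta>. ereal (y * (2 + log 2 (c\<^sup>2 / 2) / - log 2 \<delta>))) \<le> lower_mink_dim dst F"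
      unfolding lower_mink_dim_def by (intro Liminf_mono) simp
    moreover have "((\<lambda>\<delta>. C / - log 2 \<delta>) \<longlongrightarrow> 0) (at_right 0)" for C :: real
      by real_asymp
    then have "((\<lambda>\<delta>. y * (2 + log 2 (c\<^sup>2 / 2) / - log 2 \<delta>)) \<longlongrightarrow> y * (2 + 0)) (at_right 0)"
      by (intro tendsto_mult tendsto_add tendsto_const)
    then have "Liminf (at_right 0) (\<lambda>\<delta>. ereal (y * (2 + log 2 (c\<^sup>2 / 2) / - log 2 \<delta>))) = ereal (y * (2 + 0))"
      by (intro lim_imp_Liminf) (auto simp: tendsto_ereal)
    ultimately show ?thesis by (simp add: mult.commute)
  qed
  \<comment> \<open>Nonnegativity of the dimension settles negative \<open>x\<close>, to which
    \<open>key\<close> does not apply.\<close>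
  have "\<forall>\<^sub>F \<delta> in at_right 0. ereal 0 \<le> ereal (log 2 (?G \<delta>) / - log 2 \<delta>)"
    using small[of 1, simplified]
  proof eventually_elim
    case (elim \<delta>)
    then have "0 \<le> log 2 (?G \<delta>) / - log 2 \<delta>"
      by (intro divide_nonneg_pos log_cover_num_nonneg[OF tb(1) _ tb(2)]) auto
    then show ?case by simp
  qed
  then have nonneg: "0 \<le> lower_mink_dim dst F"
    unfolding lower_mink_dim_def by (intro Liminf_bounded) (simp add: zero_ereal_def)
  show "x \<le> ereal (1 / 2) * lower_mink_dim dst F"
  proof (cases x)
    case (real y)
    show ?thesis
    proof (cases "y \<ge> 0")
      case True
      have "ereal (1 / 2) * ereal (2 * y) \<le> ereal (1 / 2) * lower_mink_dim dst F"
        using key[of y] x real True by (intro ereal_mult_left_mono) auto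
      then show ?thesis using real by simp
    next
      case False
      have "x \<le> 0" using False real by simp
      also have "0 \<le> ereal (1 / 2) * lower_mink_dim dst F" using nonneg by simp
      finally show ?thesis .
    qed
  qed (use x in auto)
qed

text \<open>The scales \<open>\<kappa> / n powr (1/4)\<close> tend to 0, so any \<open>b\<close>
  below the dimension eventually bounds the covering exponent along them, and \<open>- log 2\<close>
  of the scale is \<open>log 2 n / 4\<close> minus a constant. The subtracted terms vanish against
  \<open>n * log 2 n\<close>.\<close>

lemma quarter_mink_dim_le_liminf:
  assumes tb: "totally_bdd dst F" "F \<noteq> {}" and m: "m > (0 :: real)"
    and le: "\<And>t. 0 < t \<Longrightarrow> t < 1 \<Longrightarrow> \<exists>\<kappa>>0. \<forall>\<^sub>F n in sequentially.
      ereal (((1 - t) * (n * log 2 (cover_num dst F (\<kappa> / real n powr (1 / 4)))) - n - log 2 (sqrt n * m + 1))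
        / (n * log 2 n)) \<le> r n"
  shows "ereal (1 / 4) * lower_mink_dim dst F \<le> liminf r"
proof (rule dense_le)
  let ?G = "cover_num dst F"
  have small: "\<forall>\<^sub>F \<delta> in at_right 0. \<delta> < 1 \<and> (0 :: real) < \<delta>"
    by (auto simp: eventually_at_right_field intro!: exI[of _ 1])
  have key: "ereal ((1 - t) * b / 4) \<le> liminf r"
    if H: "\<forall>\<^sub>F \<delta> in at_right 0. b * - log 2 \<delta> \<le> log 2 (?G \<delta>)" and t: "0 < t" "t < 1" for b t
  proof -
    obtain \<kappa> where \<kappa>: "\<kappa> > 0" and ev: "\<forall>\<^sub>F n in sequentially.
      ereal (((1 - t) * (n * log 2 (cover_num dst F (\<kappa> / real n powr (1 / 4)))) - n - log 2 (sqrt n * m + 1))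
        / (n * log 2 n)) \<le> r n"
      using le[OF t] by blast
    define C where "C = log 2 \<kappa>"
    have "filterlim (\<lambda>n. \<kappa> / real n powr (1 / 4)) (at_right 0) sequentially"
      using \<kappa> by real_asymp
    then have "\<forall>\<^sub>F n in sequentially. b * - log 2 (\<kappa> / real n powr (1 / 4)) \<le> log 2 (?G (\<kappa> / real n powr (1 / 4)))"
      using H unfolding filterlim_iff by blast
    then have "\<forall>\<^sub>F n in sequentially. ereal (((1 - t) * (n * (b * (log 2 n / 4 - C))) - n - log 2 (sqrt n * m + 1))
        / (n * log 2 n)) \<le> r n"
      using ev eventually_gt_at_top[of 1]
    proof eventually_elim
      case (elim n)
      have "- log 2 (\<kappa> / real n powr (1 / 4)) = log 2 n / 4 - C"
        using \<kappa> elim(3) by (simp add: log_divide log_powr C_def)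
      then have "b * (log 2 n / 4 - C) \<le> log 2 (?G (\<kappa> / real n powr (1 / 4)))"
        using elim(1) by (simp only:)
      then have "(1 - t) * (n * (b * (log 2 n / 4 - C))) \<le> (1 - t) * (n * log 2 (?G (\<kappa> / real n powr (1 / 4))))"
        using t by (intro mult_left_mono) auto
      then have "((1 - t) * (n * (b * (log 2 n / 4 - C))) - n - log 2 (sqrt n * m + 1)) / (n * log 2 n)
        \<le> ((1 - t) * (n * log 2 (?G (\<kappa> / real n powr (1 / 4)))) - n - log 2 (sqrt n * m + 1)) / (n * log 2 n)"
        using elim(3) by (intro divide_right_mono diff_right_mono) auto
      with elim(2) show ?case using ereal_less_eq(3) order.trans by blast
    qed
    then have "liminf (\<lambda>n. ereal (((1 - t) * (n * (b * (log 2 n / 4 - C))) - n - log 2 (sqrt n * m + 1))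
        / (n * log 2 n))) \<le> liminf r"
      by (rule Liminf_mono)
    moreover have "(\<lambda>n. ((1 - t) * (n * (b * (log 2 n / 4 - C))) - n - log 2 (sqrt n * m + 1))
        / (n * log 2 n)) \<longlonglongrightarrow> (1 - t) * b / 4"
    proof -
      have "(\<lambda>n. (1 - t) * b / 4 - (1 - t) * b * C / log 2 (real n) - 1 / log 2 (real n)
          - log 2 (sqrt (real n) * m + 1) / (real n * log 2 (real n))) \<longlonglongrightarrow> (1 - t) * b / 4 - 0 - 0 - 0"
      proof (intro tendsto_diff tendsto_const)
        show "(\<lambda>n. (1 - t) * b * C / log 2 (real n)) \<longlonglongrightarrow> 0" by real_asymp
        show "(\<lambda>n. 1 / log 2 (real n)) \<longlonglongrightarrow> 0" by real_asymp
        show "(\<lambda>n. log 2 (sqrt (real n) * m + 1) / (real n * log 2 (real n))) \<longlonglongrightarrow> 0" using m by real_asymp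
      qed
      moreover have "\<forall>\<^sub>F n in sequentially. (1 - t) * b / 4 - (1 - t) * b * C / log 2 (real n) - 1 / log 2 (real n)
          - log 2 (sqrt (real n) * m + 1) / (real n * log 2 (real n))
        = ((1 - t) * (n * (b * (log 2 n / 4 - C))) - n - log 2 (sqrt n * m + 1)) / (n * log 2 n)"
        using eventually_gt_at_top[of 1]
      proof eventually_elim
        case (elim n)
        have "(1 - t) * b / 4 - (1 - t) * b * C / L - 1 / L - M / (N * L)
            = ((1 - t) * (N * (b * (L / 4 - C))) - N - M) / (N * L)" if "N \<noteq> 0" "L \<noteq> 0" for N L M
          using that by (simp add: field_simps)
        moreover have "real n \<noteq> 0" using elim by simp
        moreover have "0 < log 2 (real n)" using elim by simp
        then have "log 2 (real n) \<noteq> 0" by linarith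
        ultimately show ?case by blast
      qed
      ultimately show ?thesis by (simp add: tendsto_cong)
    qed
    then have "liminf (\<lambda>n. ereal (((1 - t) * (n * (b * (log 2 n / 4 - C))) - n - log 2 (sqrt n * m + 1))
        / (n * log 2 n))) = ereal ((1 - t) * b / 4)"
      by (intro lim_imp_Liminf) (auto simp: tendsto_ereal)
    ultimately show ?thesis by simp
  qed
  fix x assume x: "x < ereal (1 / 4) * lower_mink_dim dst F"
  show "x \<le> liminf r"
  proof (cases x)
    case (real y)
    show ?thesis
    proof (cases "y > 0")
      case True
      have "ereal (4 * y) < lower_mink_dim dst F"
        using x real by (cases "lower_mink_dim dst F") auto
      then obtain b where b: "4 * y < b" "ereal b < lower_mink_dim dst F"
        using ereal_dense2 by (metis ereal_less(3) less_ereal.simps(1))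
      have "\<forall>\<^sub>F \<delta> in at_right 0. b * - log 2 \<delta> \<le> log 2 (?G \<delta>)"
        using less_LiminfD[OF b(2)[unfolded lower_mink_dim_def]] small
      proof eventually_elim
        case (elim \<delta>)
        then have "0 < - log 2 \<delta>" by simp
        then show ?case using elim(1) by (simp only: less_ereal.simps pos_less_divide_eq less_imp_le)
      qed
      \<comment> \<open>The choice \<open>t = 1 - 4 * y / b\<close> makes
        \<open>(1 - t) * b / 4\<close> equal to \<open>y\<close>, and \<open>0 < 4 * y < b\<close>
        puts it strictly between 0 and 1.\<close>
      then have "ereal ((1 - (1 - 4 * y / b)) * b / 4) \<le> liminf r"
        by (rule key) (use b True in auto)
      then show ?thesis using b True real by simp
    next
      case False
      \<comment> \<open>The case \<open>b = 0\<close> of \<open>key\<close> shows that the limit is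
        nonnegative.\<close>
      have "\<forall>\<^sub>F \<delta> in at_right 0. 0 * - log 2 \<delta> \<le> log 2 (?G \<delta>)"
        using small
      proof eventually_elim
        case (elim \<delta>)
        then show ?case using log_cover_num_nonneg[OF tb(1) _ tb(2), of \<delta>] by simp
      qed
      from key[OF this, of "1/2"] have "0 \<le> liminf r" by (simp add: zero_ereal_def)
      moreover have "x \<le> 0" using False real by simp
      ultimately show ?thesis by (rule order.trans[rotated])
    qed
  qed (use x in auto)
qed

section \<open>Upper bound\<close>

text \<open>\<open>hs_dist\<close> squares the difference without an adjoint, so it is the entrywise
  Euclidean distance for Hermitian matrices.\<close>

lemma hs_sq_eq:
  assumes "herm d A" "herm d B"
  shows "Re (mtrace ((A - B) * (A - B))) = (\<Sum>j<d. \<Sum>i<d. (cmod (A $$ (i, j) - B $$ (i, j)))\<^sup>2)"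
  unfolding hs_norm_eq[OF herm_minus[OF assms]] Re_ip_self
  using herm_carrier[OF assms(1)] herm_carrier[OF assms(2)]
  by (intro sum.cong refl) (simp add: mcol_def)

text \<open>For roots of density matrices the first two terms are 1, so distance and overlap
  determine each other.\<close>

lemma hs_sq_expand:
  assumes A: "herm d A" and B: "herm d B"
  shows "Re (mtrace ((A - B) * (A - B))) = Re (mtrace (A * A)) + Re (mtrace (B * B)) - 2 * Re (mtrace (A * B))"
proof -
  have col: "Re (ip d (mcol (A - B) j) (mcol (A - B) j))
      = Re (ip d (mcol A j) (mcol A j)) + Re (ip d (mcol B j) (mcol B j)) - 2 * Re (ip d (mcol A j) (mcol B j))"
    if "j < d" for j
  proof -
    have "ip d (mcol (A - B) j) (mcol (A - B) j) = ip d (\<lambda>i. mcol A j i - mcol B j i) (\<lambda>i. mcol A j i - mcol B j i)"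
      using that herm_carrier[OF A] herm_carrier[OF B] by (intro ip_cong) (simp_all add: mcol_def)
    then show ?thesis
      using arg_cong[OF cnj_ip[of d "mcol A j" "mcol B j"], of Re] by (simp add: ip_linear)
  qed
  show ?thesis
    unfolding hs_norm_eq[OF herm_minus[OF A B]] hs_norm_eq[OF A] hs_norm_eq[OF B]
      mtrace_herm_mult[OF A herm_carrier[OF B]] Re_sum
    using col by (simp add: sum.distrib sum_subtractf sum_distrib_left)
qed

text \<open>Conjugation exchanges the factors and cyclicity exchanges them back. Being real, the
  letter overlaps can be bounded below and multiplied.\<close>

lemma mtrace_herm_mult_real:
  assumes A: "herm d A" and B: "herm d B"
  shows "mtrace (A * B) = of_real (Re (mtrace (A * B)))"
proof -
  have "cnj (mtrace (A * B)) = mtrace (B * A)"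
    unfolding mtrace_herm_mult[OF A herm_carrier[OF B]] mtrace_herm_mult[OF B herm_carrier[OF A]]
    by (simp add: cnj_ip)
  also have "\<dots> = mtrace (A * B)"
    by (rule mtrace_mult_commute[OF herm_carrier[OF B] herm_carrier[OF A]])
  finally show ?thesis by (simp add: complex_eq_iff)
qed

lemma of_real_prod_list: "of_real (\<Prod>z\<leftarrow>zs. f z) = (\<Prod>z\<leftarrow>zs. of_real (f z))"
  by (induction zs) simp_all

text \<open>The limit on how well any effect tells two close words apart. The overlap of the product
  roots is the product of the letter overlaps, at least \<open>1 - n * r\<close> by Bernoulli's
  inequality, where n is the length; so the roots have squared distance at most
  \<open>2 * n * r\<close>.\<close>

lemma DI_code_distinguishes:
  fixes r s :: real
  assumes W: "\<And>x. x \<in> S \<Longrightarrow> density d (W x)" and len: "length xs = length ys" and sub: "set xs \<subseteq> S" "set ys \<subseteq> S"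
    and close: "\<And>x y. (x, y) \<in> set (zip xs ys) \<Longrightarrow> 1 - r \<le> Re (mtrace (psd_sqrt d (W x) * psd_sqrt d (W y)))"
    and r: "r \<le> 1" and E: "effect (d ^ length xs) E" and s: "s > 0"
  shows "Re (mtrace (tensor_word W xs * E)) - Re (mtrace (tensor_word W ys * E)) \<le> s + (1 + 1 / s) * (2 * length xs * r)"
proof -
  let ?R = "\<lambda>x. psd_sqrt d (W x)"
  have p: "psd d (W x)" "mtrace (W x) = 1" if "x \<in> S" for x using W[OF that] by (simp_all add: density_def)
  have R: "herm d (?R x)" "?R x \<in> carrier_mat d d" if "x \<in> S" for x
    using psd_sqrt(1)[OF p(1)[OF that]] psd_herm psd_carrier by blast+
  let ?A = "tensor_word ?R xs" and ?B = "tensor_word ?R ys"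
  have sq: "tensor_word W zs = tensor_word ?R zs * tensor_word ?R zs" if "set zs \<subseteq> S" for zs
    using that by (intro tensor_word_psd_sqrt p) auto
  have tr: "mtrace (tensor_word W zs) = 1" if "set zs \<subseteq> S" for zs
  proof -
    have "mtrace (tensor_word W zs) = (\<Prod>z\<leftarrow>zs. mtrace (W z))"
      using that p(1) by (intro mtrace_tensor_word[where d = d] psd_carrier) auto
    also have "\<dots> = (\<Prod>z\<leftarrow>zs. 1)" using that p(2) by (intro arg_cong[where f = prod_list] map_cong) auto
    also have "\<dots> = 1" by (induction zs) simp_all
    finally show ?thesis .
  qed
  have A: "herm (d ^ length xs) ?A" using sub(1) R(1) by (intro herm_tensor_word) auto
  have B: "herm (d ^ length xs) ?B" unfolding len using sub(2) R(1) by (intro herm_tensor_word) auto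
  have "mtrace (?A * ?B) = (\<Prod>(x, y)\<leftarrow>zip xs ys. mtrace (?R x * ?R y))"
    using sub R(2) by (intro mtrace_tensor_word_mult[where d = d] len) auto
  also have "\<dots> = (\<Prod>(x, y)\<leftarrow>zip xs ys. of_real (Re (mtrace (?R x * ?R y))))"
  proof (intro arg_cong[where f = prod_list] map_cong refl)
    fix z assume "z \<in> set (zip xs ys)"
    moreover obtain x y where z: "z = (x, y)" by (cases z)
    ultimately have "x \<in> S" "y \<in> S" using sub by (auto dest: set_zip_leftD set_zip_rightD)
    then have "mtrace (?R x * ?R y) = of_real (Re (mtrace (?R x * ?R y)))"
      by (intro mtrace_herm_mult_real[where d = d] R)
    then show "(case z of (x, y) \<Rightarrow> mtrace (?R x * ?R y)) = (case z of (x, y) \<Rightarrow> of_real (Re (mtrace (?R x * ?R y))))"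
      unfolding z prod.case .
  qed
  also have "\<dots> = of_real (\<Prod>(x, y)\<leftarrow>zip xs ys. Re (mtrace (?R x * ?R y)))"
    unfolding of_real_prod_list by (simp only: case_prod_beta')
  finally have AB: "Re (mtrace (?A * ?B)) = (\<Prod>(x, y)\<leftarrow>zip xs ys. Re (mtrace (?R x * ?R y)))"
    by simp
  \<comment> \<open>By \<open>r \<le> 1\<close> the lower bounds of the factors are nonnegative and
    may be multiplied.\<close>
  have "(1 - r) ^ length zs \<le> (\<Prod>z\<leftarrow>zs. f z)" if "\<And>z. z \<in> set zs \<Longrightarrow> 1 - r \<le> f z" for zs :: "('a \<times> 'a) list" and f
    using that
  proof (induction zs)
    case (Cons z zs)
    have "1 - r \<le> f z" using Cons.prems by simp
    moreover have "(1 - r) ^ length zs \<le> (\<Prod>z\<leftarrow>zs. f z)" using Cons by simp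
    ultimately have "(1 - r) * (1 - r) ^ length zs \<le> f z * (\<Prod>z\<leftarrow>zs. f z)"
      using r by (intro mult_mono) auto
    then show ?case by simp
  qed simp
  from this[of "zip xs ys" "\<lambda>(x, y). Re (mtrace (?R x * ?R y))"]
  have "(1 - r) ^ length xs \<le> Re (mtrace (?A * ?B))"
    unfolding AB using close len by auto
  moreover have "1 + length xs * (- r) \<le> (1 + (- r)) ^ length xs"
    using r by (intro Bernoulli_inequality) simp
  ultimately have "1 - length xs * r \<le> Re (mtrace (?A * ?B))" by simp
  then have d: "Re (mtrace ((?A - ?B) * (?A - ?B))) \<le> 2 * length xs * r"
    unfolding hs_sq_expand[OF A B] sq[OF sub(1), symmetric] sq[OF sub(2), symmetric] tr[OF sub(1)] tr[OF sub(2)]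
    by simp
  have "Re (mtrace (tensor_word W xs * E)) - Re (mtrace (tensor_word W ys * E))
      \<le> s + (1 + 1 / s) * Re (mtrace ((?A - ?B) * (?A - ?B)))"
    unfolding sq[OF sub(1)] sq[OF sub(2)]
    by (rule mtrace_effect_diff_le[OF A B E s]) (simp add: sq[OF sub(2), symmetric] tr[OF sub(2)])
  also have "\<dots> \<le> s + (1 + 1 / s) * (2 * length xs * r)"
    using s d by (intro add_left_mono mult_left_mono) auto
  finally show ?thesis .
qed

lemma density_sqrt:
  assumes "density d \<rho>"
  shows "psd d (psd_sqrt d \<rho>)" "herm d (psd_sqrt d \<rho>)" "mtrace (psd_sqrt d \<rho> * psd_sqrt d \<rho>) = 1"
  using psd_sqrt[of d \<rho>] psd_herm[of d "psd_sqrt d \<rho>"] assms by (auto simp: density_def)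

text \<open>The coordinates are the real and imaginary parts of the entries, bounded by 1 because
  the roots have unit Hilbert--Schmidt norm.\<close>

lemma totally_bdd_sqrt_tilde:
  assumes "cq_channel X d W"
  shows "totally_bdd hs_dist (sqrt_tilde_X X d W)"
proof (rule totally_bdd_coordinates)
  let ?I = "({..<d} \<times> {..<d}) \<times> (UNIV :: bool set)"
  let ?\<phi> = "\<lambda>(p, b) (M :: complex mat). if b then Re (M $$ p) else Im (M $$ p)"
  show "finite ?I" by simp
  have el: "herm d M" "mtrace (M * M) = 1" if "M \<in> sqrt_tilde_X X d W" for M
    using that assms density_sqrt(2,3) by (auto simp: sqrt_tilde_X_def cq_channel_def)
  show "\<bar>?\<phi> i M\<bar> \<le> 1" if i: "i \<in> ?I" and M: "M \<in> sqrt_tilde_X X d W" for i M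
  proof -
    obtain a b c where i_eq: "i = ((a, b), c)" and ab: "a < d" "b < d" using i by auto
    have "(cmod (M $$ (a, b)))\<^sup>2 \<le> (\<Sum>i<d. (cmod (M $$ (i, b)))\<^sup>2)"
      using ab by (intro member_le_sum) auto
    also have "\<dots> \<le> (\<Sum>j<d. \<Sum>i<d. (cmod (M $$ (i, j)))\<^sup>2)"
      using ab by (intro member_le_sum) (auto intro: sum_nonneg)
    also have "\<dots> = 1"
      using hs_norm_eq[OF el(1)[OF M]] el(2)[OF M] by (simp add: Re_ip_self mcol_def)
    finally have "cmod (M $$ (a, b)) \<le> 1" by (simp add: abs_square_le_1)
    then show ?thesis
      using abs_Re_le_cmod[of "M $$ (a, b)"] abs_Im_le_cmod[of "M $$ (a, b)"] by (simp add: i_eq)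
  qed
  show "hs_dist p q \<le> sqrt (\<Sum>i\<in>?I. (?\<phi> i p - ?\<phi> i q)\<^sup>2)"
    if p: "p \<in> sqrt_tilde_X X d W" and q: "q \<in> sqrt_tilde_X X d W" for p q
  proof -
    have "(\<Sum>j<d. \<Sum>i<d. (cmod (p $$ (i, j) - q $$ (i, j)))\<^sup>2)
        = (\<Sum>i<d. \<Sum>j<d. (cmod (p $$ (i, j) - q $$ (i, j)))\<^sup>2)" by (rule sum.swap)
    also have "\<dots> = (\<Sum>z\<in>{..<d} \<times> {..<d}. (cmod (p $$ z - q $$ z))\<^sup>2)"
      by (simp add: sum.cartesian_product split_beta)
    also have "\<dots> = (\<Sum>z\<in>{..<d} \<times> {..<d}. \<Sum>b\<in>UNIV. (?\<phi> (z, b) p - ?\<phi> (z, b) q)\<^sup>2)"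
      by (simp add: UNIV_bool cmod_power2 add.commute)
    also have "\<dots> = (\<Sum>i\<in>?I. (?\<phi> i p - ?\<phi> i q)\<^sup>2)"
      by (subst sum.cartesian_product) (intro sum.cong refl, clarsimp)
    finally show ?thesis unfolding hs_dist_def hs_sq_eq[OF el(1)[OF p] el(1)[OF q]] by simp
  qed
qed

text \<open>Replacing letters by nearby centers is injective on codewords: if two of them coincided,
  the test of the first would accept the second with probability above \<open>l2\<close>. So
  codewords are at most as many as words over the centers.\<close>

lemma DI_code_size_le:
  assumes cq: "cq_channel X d W" and code: "DI_code X d W n N l1 l2 u E"
    and \<delta>: "\<delta> > 0" "2 * \<delta>\<^sup>2 \<le> 1" and s: "s > 0"
    and small: "s + (1 + 1 / s) * (4 * n * \<delta>\<^sup>2) < 1 - l1 - l2"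
  shows "N \<le> cover_num hs_dist (sqrt_tilde_X X d W) \<delta> ^ n"
proof -
  let ?F = "sqrt_tilde_X X d W" and ?R = "\<lambda>x. psd_sqrt d (W x)"
  obtain C where C: "finite C" "card C = cover_num hs_dist ?F \<delta>" "C \<subseteq> ?F" "?F \<subseteq> (\<Union>c\<in>C. {p. hs_dist c p \<le> \<delta>})"
    by (rule cover_num_attained[OF totally_bdd_sqrt_tilde[OF cq] \<delta>(1)])
  have dens: "density d (W x)" if "x \<in> space X" for x using cq that by (simp add: cq_channel_def)
  have "\<exists>c\<in>C. hs_dist c (?R x) \<le> \<delta>" if "x \<in> space X" for x
  proof -
    have "?R x \<in> ?F" using that by (simp add: sqrt_tilde_X_def)
    then show ?thesis using C(4) by blast
  qed
  then obtain g where g: "\<And>x. x \<in> space X \<Longrightarrow> g x \<in> C \<and> hs_dist (g x) (?R x) \<le> \<delta>" by metis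
  have gF: "herm d (g x)" if x: "x \<in> space X" for x
  proof -
    have "g x \<in> ?F" using g[OF x] C(3) by blast
    then show ?thesis using density_sqrt(2) dens by (auto simp: sqrt_tilde_X_def)
  qed
  have close: "1 - 2 * \<delta>\<^sup>2 \<le> Re (mtrace (?R x * ?R y))"
    if xy: "x \<in> space X" "y \<in> space X" "g x = g y" for x y
  proof -
    note hx = density_sqrt(2)[OF dens[OF xy(1)]] and hy = density_sqrt(2)[OF dens[OF xy(2)]]
    let ?D = "\<lambda>A B. \<Sum>j<d. \<Sum>i<d. (cmod (A $$ (i, j) - B $$ (i, j)))\<^sup>2"
    have D: "?D (g z) (?R z) \<le> \<delta>\<^sup>2" if z: "z \<in> space X" for z
    proof -
      have "sqrt (?D (g z) (?R z)) \<le> \<delta>"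
        using g[OF z] unfolding hs_dist_def hs_sq_eq[OF gF[OF z] density_sqrt(2)[OF dens[OF z]]] by blast
      then show ?thesis by (rule sqrt_le_D)
    qed
    \<comment> \<open>Both roots lie within \<open>\<delta>\<close> of the common center. The
      triangle inequality and the square of a sum give squared distance at most
      \<open>4 * \<delta>\<^sup>2\<close>, that is, overlap at least
      \<open>1 - 2 * \<delta>\<^sup>2\<close>.\<close>
    have "?D (?R x) (?R y) \<le> (\<Sum>j<d. \<Sum>i<d. 2 * (cmod (g x $$ (i, j) - ?R x $$ (i, j)))\<^sup>2
        + 2 * (cmod (g y $$ (i, j) - ?R y $$ (i, j)))\<^sup>2)"
    proof (intro sum_mono)
      fix i j
      let ?a = "g x $$ (i, j) - ?R x $$ (i, j)" and ?b = "g y $$ (i, j) - ?R y $$ (i, j)"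
      have "cmod (?R x $$ (i, j) - ?R y $$ (i, j)) = cmod (?b - ?a)" using xy(3) by simp
      also have "\<dots> \<le> cmod ?a + cmod ?b" using norm_triangle_ineq4[of ?b ?a] by simp
      finally have "(cmod (?R x $$ (i, j) - ?R y $$ (i, j)))\<^sup>2 \<le> (cmod ?a + cmod ?b)\<^sup>2"
        by (rule power_mono) simp
      also have "\<dots> \<le> 2 * (cmod ?a)\<^sup>2 + 2 * (cmod ?b)\<^sup>2"
        using sum_squares_bound[of "cmod ?a" "cmod ?b"] by (simp add: power2_sum)
      finally show "(cmod (?R x $$ (i, j) - ?R y $$ (i, j)))\<^sup>2 \<le> 2 * (cmod ?a)\<^sup>2 + 2 * (cmod ?b)\<^sup>2" .
    qed
    also have "\<dots> = 2 * ?D (g x) (?R x) + 2 * ?D (g y) (?R y)"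
      by (simp add: sum.distrib sum_distrib_left)
    also have "\<dots> \<le> 4 * \<delta>\<^sup>2" using D[OF xy(1)] D[OF xy(2)] by simp
    finally have "Re (mtrace ((?R x - ?R y) * (?R x - ?R y))) \<le> 4 * \<delta>\<^sup>2"
      unfolding hs_sq_eq[OF hx hy] .
    then show ?thesis
      unfolding hs_sq_expand[OF hx hy] density_sqrt(3)[OF dens[OF xy(1)]] density_sqrt(3)[OF dens[OF xy(2)]]
      by simp
  qed
  have u: "length (u j) = n" "set (u j) \<subseteq> space X" "effect (d ^ n) (E j)"
    "1 - l1 \<le> Re (mtrace (tensor_word W (u j) * E j))" if "j < N" for j
    using code that by (auto simp: DI_code_def)
  have "inj_on (\<lambda>j. map g (u j)) {..<N}"
  proof (rule inj_onI, rule ccontr)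
    fix j k assume jk: "j \<in> {..<N}" "k \<in> {..<N}" "map g (u j) = map g (u k)" "j \<noteq> k"
    then have N: "j < N" "k < N" by auto
    have "Re (mtrace (tensor_word W (u j) * E j)) - Re (mtrace (tensor_word W (u k) * E j))
        \<le> s + (1 + 1 / s) * (2 * length (u j) * (2 * \<delta>\<^sup>2))"
    proof (rule DI_code_distinguishes[OF dens])
      show "length (u j) = length (u k)" "set (u j) \<subseteq> space X" "set (u k) \<subseteq> space X" "effect (d ^ length (u j)) (E j)"
        using u[OF N(1)] u[OF N(2)] by simp_all
      fix x y assume xy: "(x, y) \<in> set (zip (u j) (u k))"
      then obtain i where "i < length (u j)" "i < length (u k)" "x = u j ! i" "y = u k ! i"
        by (auto simp: set_zip)
      moreover from this have "g x = g y" using arg_cong[OF jk(3), of "\<lambda>zs. zs ! i"] by simp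
      ultimately show "1 - 2 * \<delta>\<^sup>2 \<le> Re (mtrace (?R x * ?R y))"
        using u(2)[OF N(1)] u(2)[OF N(2)] by (intro close) (auto dest: nth_mem)
    qed (use \<delta> s in auto)
    also have "\<dots> < 1 - l1 - l2" using small u(1)[OF N(1)] by simp
    finally have "l2 < Re (mtrace (tensor_word W (u k) * E j))" using u(4)[OF N(1)] by linarith
    moreover have "Re (mtrace (tensor_word W (u k) * E j)) \<le> l2"
      using code N jk(4) unfolding DI_code_def by metis
    ultimately show False by linarith
  qed
  moreover have "(\<lambda>j. map g (u j)) ` {..<N} \<subseteq> words C n"
  proof (intro image_subsetI)
    fix j assume "j \<in> {..<N}"
    then have "length (u j) = n" "set (u j) \<subseteq> space X" by (simp_all add: u(1,2))
    then show "map g (u j) \<in> words C n" using g unfolding words_def by fastforce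
  qed
  ultimately have "card {..<N} \<le> card (words C n)"
    by (rule card_inj_on_le) (rule finite_words[OF C(1)])
  then show ?thesis by (simp only: card_words[OF C(1)] C(2) card_lessThan)
qed

lemma log2_enat_mono: "a \<le> b \<Longrightarrow> log2_enat a \<le> log2_enat b"
  by (cases a; cases b) (auto simp: log2_enat_def)

lemma log2_enat_enat: "k > 0 \<Longrightarrow> log2_enat (enat k) = ereal (log 2 k)"
  by (simp add: log2_enat_def)

lemma DI_rate_upper:
  assumes cq: "cq_channel X d W" and ne: "space X \<noteq> {}" and l: "l1 + l2 < 1"
  shows "DI_rate (\<lambda>n. N_DI X d W n l1 l2) \<le> ereal (1/2) * lower_mink_dim hs_dist (sqrt_tilde_X X d W)"
proof -
  let ?F = "sqrt_tilde_X X d W"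
  note tb = totally_bdd_sqrt_tilde[OF cq]
  have Fne: "?F \<noteq> {}" using ne by (simp add: sqrt_tilde_X_def)
  \<comment> \<open>Half of the gap \<open>1 - l1 - l2\<close> goes to \<open>s\<close>.
    \<open>K\<close> is the factor of \<open>n * \<delta>\<^sup>2 = c\<^sup>2\<close> in the error,
    and \<open>c\<close> keeps \<open>K * c\<^sup>2\<close> within half of the other half;
    \<open>c \<le> 1 / 2\<close> secures \<open>2 * \<delta>\<^sup>2 \<le> 1\<close>.\<close>
  define s where "s = (1 - l1 - l2) / 2"
  define K where "K = 4 * (1 + 1 / s)"
  define c where "c = min (1 / 2) (sqrt (s / (2 * K)))"
  have s: "s > 0" using l by (simp add: s_def)
  then have K: "K > 0" by (simp add: K_def add_pos_pos)
  have c: "c > 0" "c \<le> 1 / 2" using s K by (simp_all add: c_def)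
  have "c\<^sup>2 \<le> (sqrt (s / (2 * K)))\<^sup>2" using c(1) by (intro power_mono) (simp_all add: c_def)
  also have "\<dots> = s / (2 * K)" using s K by simp
  finally have "K * c\<^sup>2 \<le> s / 2" using K by (simp add: field_simps)
  then have small: "s + (1 + 1 / s) * (4 * c\<^sup>2) < 1 - l1 - l2"
  proof -
    have "(1 + 1 / s) * (4 * c\<^sup>2) = K * c\<^sup>2" by (simp add: K_def)
    moreover have "1 - l1 - l2 = 2 * s" by (simp add: s_def)
    ultimately show ?thesis using \<open>K * c\<^sup>2 \<le> s / 2\<close> s by linarith
  qed
  have c2: "c\<^sup>2 \<le> (1 / 2)\<^sup>2" using c by (intro power_mono) auto
  have "N_DI X d W n l1 l2 \<le> enat (cover_num hs_dist ?F (c / sqrt n) ^ n)" if n: "n \<ge> 2" for n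
    unfolding N_DI_def
  proof (rule Sup_least)
    fix z assume "z \<in> {enat N | N. \<exists>u E. DI_code X d W n N l1 l2 u E}"
    then obtain N u E where z: "z = enat N" and code: "DI_code X d W n N l1 l2 u E" by blast
    have sq: "(c / sqrt n)\<^sup>2 = c\<^sup>2 / n" using n by (simp add: power_divide)
    have "c\<^sup>2 / n \<le> c\<^sup>2 / 1" using n by (intro divide_left_mono) auto
    then have "2 * (c / sqrt n)\<^sup>2 \<le> 1" using c2 unfolding sq by (simp add: power2_eq_square)
    moreover have "s + (1 + 1 / s) * (4 * n * (c / sqrt n)\<^sup>2) < 1 - l1 - l2"
      using small n unfolding sq by simp
    ultimately have "N \<le> cover_num hs_dist ?F (c / sqrt n) ^ n"
      using c(1) n by (intro DI_code_size_le[OF cq code _ _ s]) auto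
    then show "z \<le> enat (cover_num hs_dist ?F (c / sqrt n) ^ n)" by (simp add: z)
  qed
  note size = this
  show ?thesis
    unfolding DI_rate_def
  proof (rule liminf_le_half_mink_dim[OF tb Fne c(1)])
    show "\<forall>\<^sub>F n in sequentially. log2_enat (N_DI X d W n l1 l2) / ereal (real n * log 2 (real n))
        \<le> ereal (log 2 (cover_num hs_dist ?F (c / sqrt n)) / log 2 n)"
      using eventually_ge_at_top[of 2]
    proof eventually_elim
      case (elim n)
      let ?G = "cover_num hs_dist ?F (c / sqrt n)"
      have G: "1 \<le> ?G" using elim c(1) by (intro cover_num_pos[OF tb _ Fne]) simp
      have L: "0 < log 2 (real n)" using elim by simp
      have "log2_enat (N_DI X d W n l1 l2) \<le> log2_enat (enat (?G ^ n))"
        by (intro log2_enat_mono size elim)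
      also have "\<dots> = ereal (n * log 2 ?G)" using G by (simp add: log2_enat_enat log_nat_power)
      finally have le: "log2_enat (N_DI X d W n l1 l2) \<le> ereal (n * log 2 ?G)" .
      have pos: "0 < real n * log 2 (real n)" using L elim by (intro mult_pos_pos) simp_all
      have "log2_enat (N_DI X d W n l1 l2) / ereal (real n * log 2 (real n))
          \<le> ereal (n * log 2 ?G) / ereal (real n * log 2 (real n))"
        by (rule ereal_divide_right_mono[OF le]) (simp only: ereal_less(2) pos)
      also have "\<dots> = ereal (n * log 2 ?G / (n * log 2 n))"
        by (simp only: ereal_divide less_imp_neq[OF pos, symmetric] if_False)
      also have "n * log 2 ?G / (n * log 2 n) = log 2 ?G / log 2 n"
        by (rule mult_divide_mult_cancel_left) (use elim in simp)
      finally show ?case .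
    qed
  qed
qed

section \<open>Lower bound\<close>

definition meas_prob :: "('x \<Rightarrow> complex mat) \<Rightarrow> (nat \<Rightarrow> complex mat) \<Rightarrow> 'x \<Rightarrow> nat \<Rightarrow> real" where
  "meas_prob W T x y = Re (mtrace (W x * T y))"

text \<open>Splitting \<open>W x\<close> into two copies of its root turns the trace into a sum of
  values of the form of \<open>T y\<close>.\<close>

lemma meas_prob_of_real:
  assumes "density d (W x)" "psd d (T y)"
  shows "mtrace (W x * T y) = of_real (meas_prob W T x y)" "0 \<le> meas_prob W T x y"
  using psd_mtrace_sandwich[OF density_sqrt(2)[OF assms(1)] assms(2)] psd_sqrt(2)[of d "W x"] assms(1)
  by (simp_all add: meas_prob_def density_def)

lemma stochastic_meas_prob:
  assumes W: "density d (W x)" and T: "info_complete_povm d k T"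
  shows "stochastic {..<k} (meas_prob W T) x"
proof -
  have p: "psd d (T y)" if "y < k" for y using T that by (simp add: info_complete_povm_def)
  have mp: "mtrace (W x * T y) = of_real (meas_prob W T x y)" "0 \<le> meas_prob W T x y" if "y < k" for y
    using meas_prob_of_real[of d W x T y, OF W p[OF that]] by simp_all
  have c: "W x \<in> carrier_mat d d" using W by (auto simp: density_def)
  have "complex_of_real (\<Sum>y<k. meas_prob W T x y) = (\<Sum>y<k. mtrace (W x * T y))"
    unfolding of_real_sum by (intro sum.cong refl) (simp add: mp(1))
  also have "\<dots> = mtrace (W x * msum d T {..<k})"
    using p by (intro mtrace_mult_msum[symmetric] c psd_carrier) simp
  also have "\<dots> = mtrace (W x)" using T c by (simp add: info_complete_povm_def)
  also have "\<dots> = 1" using W by (simp add: density_def)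
  finally have "(\<Sum>y<k. meas_prob W T x y) = 1" by (simp only: of_real_eq_1_iff)
  then show ?thesis using mp(2) by (simp add: stochastic_def)
qed

lemma mtrace_tensor_meas:
  assumes cq: "cq_channel X d W" and T: "info_complete_povm d k T"
    and xs: "xs \<in> words (space X) n" and ys: "ys \<in> words {..<k} n"
  shows "mtrace (tensor_word W xs * tensor_word T ys) = of_real (word_prob (meas_prob W T) xs ys)"
proof -
  have W: "density d (W x)" if "x \<in> set xs" for x
    using cq xs that by (auto simp: cq_channel_def words_def)
  have p: "psd d (T y)" if "y \<in> set ys" for y
    using T ys that by (auto simp: info_complete_povm_def words_def)
  have len: "length xs = length ys" using xs ys by (simp add: words_def)
  have "mtrace (tensor_word W xs * tensor_word T ys) = (\<Prod>(x, y)\<leftarrow>zip xs ys. mtrace (W x * T y))"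
    using W p by (intro mtrace_tensor_word_mult[where d = d] len) (auto simp: density_def)
  also have "\<dots> = (\<Prod>(x, y)\<leftarrow>zip xs ys. of_real (meas_prob W T x y))"
  proof (intro arg_cong[where f = prod_list] map_cong refl)
    fix z assume "z \<in> set (zip xs ys)"
    moreover obtain x y where z: "z = (x, y)" by (cases z)
    ultimately have "x \<in> set xs" "y \<in> set ys" by (auto dest: set_zip_leftD set_zip_rightD)
    then show "(case z of (x, y) \<Rightarrow> mtrace (W x * T y)) = (case z of (x, y) \<Rightarrow> of_real (meas_prob W T x y))"
      unfolding z prod.case by (intro meas_prob_of_real(1)[where d = d] W p)
  qed
  finally show ?thesis
    unfolding word_prob_def of_real_prod_list by (simp only: case_prod_beta')
qed

text \<open>All tests are unions of outcomes of the single product measurement, which is what makes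
  the code simultaneous; its error probabilities are those of the classical channel.\<close>

lemma sim_DI_code_of_measurement:
  assumes cq: "cq_channel X d W" and T: "info_complete_povm d k T"
    and S: "finite S" "S \<subseteq> words (space X) n" and acc: "\<And>xs. xs \<in> S \<Longrightarrow> A xs \<subseteq> words {..<k} n"
    and err1: "\<And>xs. xs \<in> S \<Longrightarrow> 1 - l1 \<le> (\<Sum>ys\<in>A xs. word_prob (meas_prob W T) xs ys)"
    and err2: "\<And>xs xs'. xs \<in> S \<Longrightarrow> xs' \<in> S \<Longrightarrow> xs \<noteq> xs' \<Longrightarrow>
      (\<Sum>ys\<in>A xs'. word_prob (meas_prob W T) xs ys) \<le> l2"
  shows "enat (card S) \<le> N_DI_sim X d W n l1 l2"
proof -
  let ?Y = "words {..<k} n"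
  obtain u where u: "bij_betw u {..<card S} S"
    using ex_bij_betw_nat_finite[OF S(1)] by (auto simp: lessThan_atLeast0)
  then have uS: "u j \<in> S" if "j < card S" for j using that by (auto simp: bij_betw_def)
  have u_inj: "u j \<noteq> u i" if "j < card S" "i < card S" "j \<noteq> i" for i j
    using u that by (auto simp: bij_betw_def inj_on_def)
  \<comment> \<open>Outcomes of a simultaneous code are numbered by naturals, so output words are
    encoded by \<open>to_nat\<close>; only codes of words in \<open>?Y\<close> are ever
    used.\<close>
  define D where "D m = tensor_word T (from_nat m :: nat list)" for m
  define M where "M j = to_nat ` A (u j)" for j
  define E where "E j = msum (d ^ n) D (M j)" for j
  have fin: "finite ?Y" by (simp add: finite_words)
  have T_psd: "psd d (T y)" if "y < k" for y using T that by (simp add: info_complete_povm_def)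
  have D_psd: "psd (d ^ n) (D m)" if "m \<in> to_nat ` ?Y" for m
  proof -
    obtain ys where "m = to_nat ys" "ys \<in> ?Y" using \<open>m \<in> to_nat ` ?Y\<close> by blast
    then show ?thesis using psd_tensor_word[of ys d T] T_psd by (auto simp: D_def words_def)
  qed
  have D_sum: "msum (d ^ n) D (to_nat ` Z) = msum (d ^ n) (tensor_word T) Z" for Z :: "nat list set"
    by (simp add: msum_def sum.reindex D_def)
  have D_one: "msum (d ^ n) D (to_nat ` ?Y) = 1\<^sub>m (d ^ n)"
    unfolding D_sum using T_psd T
    by (intro msum_tensor_word) (auto simp: info_complete_povm_def)
  have M: "M j \<subseteq> to_nat ` ?Y" if "j < card S" for j
    using acc[OF uS[OF that]] by (auto simp: M_def)
  have E_eff: "effect (d ^ n) (E j)" if "j < card S" for j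
    unfolding E_def using fin D_psd D_one M[OF that] by (intro effect_msum[of "to_nat ` ?Y"]) auto
  have tr: "Re (mtrace (tensor_word W (u j) * E i)) = (\<Sum>ys\<in>A (u i). word_prob (meas_prob W T) (u j) ys)"
    if "j < card S" "i < card S" for i j
  proof -
    have uj: "u j \<in> words (space X) n" using uS[OF that(1)] S(2) by blast
    have acc_i: "ys \<in> ?Y" if "ys \<in> A (u i)" for ys using acc[OF uS[OF \<open>i < card S\<close>]] that by blast
    have W_c: "tensor_word W (u j) \<in> carrier_mat (d ^ n) (d ^ n)"
      using tensor_word_carrier[of "u j" W d] uj cq by (auto simp: words_def cq_channel_def density_def)
    have T_c: "tensor_word T ys \<in> carrier_mat (d ^ n) (d ^ n)" if "ys \<in> ?Y" for ys
      using tensor_word_carrier[of ys T d] that T_psd by (auto simp: words_def)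
    have "mtrace (tensor_word W (u j) * E i) = (\<Sum>ys\<in>A (u i). mtrace (tensor_word W (u j) * tensor_word T ys))"
      unfolding E_def M_def D_sum using T_c acc_i by (intro mtrace_mult_msum W_c) blast
    also have "\<dots> = (\<Sum>ys\<in>A (u i). of_real (word_prob (meas_prob W T) (u j) ys))"
      using acc_i by (intro sum.cong refl mtrace_tensor_meas[OF cq T uj])
    finally show ?thesis by simp
  qed
  have u_words: "length (u j) = n \<and> set (u j) \<subseteq> space X" if "j < card S" for j
    using uS[OF that] S(2) by (auto simp: words_def)
  have "DI_code X d W n (card S) l1 l2 u E"
    unfolding DI_code_def
    using u_words E_eff tr err1[OF uS] err2[OF uS uS u_inj] by simp
  moreover have "finite (to_nat ` ?Y)" using fin by simp
  ultimately have "sim_DI_code X d W n (card S) l1 l2 u E"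
    unfolding sim_DI_code_def using D_psd D_one M E_def
    by (intro conjI exI[of _ "to_nat ` ?Y"] exI[of _ D] exI[of _ M]) blast+
  then show ?thesis
    unfolding N_DI_sim_def by (intro Sup_upper) blast
qed

text \<open>Gilbert--Varshamov, applied inside the most populated entropy bin of width \<open>sqrt n\<close>.\<close>
lemma exists_separated_words:
  assumes Q: "finite Q" "Q \<noteq> {}" and Y: "finite Y" and st: "\<And>x. x \<in> Q \<Longrightarrow> stochastic Y V x" and n: "n \<ge> 1"
  shows "\<exists>S\<subseteq>words Q n. (\<forall>xs\<in>S. \<forall>xs'\<in>S. xs \<noteq> xs' \<longrightarrow>
      s < ham xs xs' \<and> \<bar>word_entropy Y V xs - word_entropy Y V xs'\<bar> \<le> sqrt n)
    \<and> real (card Q) ^ n \<le> card S * (2 ^ n * real (card Q) ^ s) * (sqrt n * card Y + 1)"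
proof -
  \<comment> \<open>Word entropies lie between 0 and \<open>n * card Y\<close>, so bins of width
    \<open>sqrt n\<close> number at most \<open>m + 1\<close>.\<close>
  define bin where "bin xs = nat \<lfloor>word_entropy Y V xs / sqrt n\<rfloor>" for xs
  define m where "m = nat \<lfloor>sqrt n * card Y\<rfloor>"
  have st': "stochastic Y V x" if "xs \<in> words Q n" "x \<in> set xs" for x xs
    using st that by (auto simp: words_def)
  have ent: "0 \<le> word_entropy Y V xs" "word_entropy Y V xs \<le> n * card Y" if "xs \<in> words Q n" for xs
    using word_entropy_bounds[OF Y st'[OF that]] that by (auto simp: words_def)
  have sq: "0 < sqrt n" using n by simp
  have "bin \<in> words Q n \<rightarrow> {..m}"
  proof
    fix xs assume "xs \<in> words Q n"
    then have "word_entropy Y V xs / sqrt n \<le> n * card Y / sqrt n"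
      using ent(2) sq by (intro divide_right_mono) auto
    also have "\<dots> = sqrt n * card Y" using sq by (simp add: field_simps)
    finally show "bin xs \<in> {..m}" unfolding bin_def m_def by (auto intro!: nat_mono floor_mono)
  qed
  from pigeonhole_card[OF this finite_words[OF Q(1)]]
  obtain b where b: "card (words Q n) \<le> card (bin -` {b} \<inter> words Q n) * Suc m" by auto
  define B where "B = bin -` {b} \<inter> words Q n"
  have B: "finite B" "B \<subseteq> words Q n" using finite_words[OF Q(1)] by (auto simp: B_def)
  have "\<exists>S\<subseteq>B. (\<forall>x\<in>S. \<forall>y\<in>S. x \<noteq> y \<longrightarrow> \<not> ham x y \<le> s) \<and> card B \<le> card S * (2 ^ n * card Q ^ s)"
  proof (rule separated_subset_card[OF B(1), of "\<lambda>x y. ham x y \<le> s"])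
    show "ham y x \<le> s" if "x \<in> B" "y \<in> B" "ham x y \<le> s" for x y
    proof -
      have "length x = length y" using that B(2) by (auto simp: words_def)
      then show ?thesis using that(3) by (simp only: ham_sym)
    qed
    show "ham x x \<le> s" for x :: "'a list" by (simp add: ham_def)
    show "card {y \<in> B. ham x y \<le> s} \<le> 2 ^ n * card Q ^ s" if "x \<in> B" for x
    proof -
      have "card {y \<in> B. ham x y \<le> s} \<le> card {y \<in> words Q n. ham x y \<le> s}"
        using B finite_words[OF Q(1), of n] by (intro card_mono) auto
      also have "\<dots> \<le> 2 ^ n * card Q ^ s" using that B(2) by (intro card_ham_ball Q) auto
      finally show ?thesis .
    qed
  qed
  then obtain S where S: "S \<subseteq> B" "\<forall>x\<in>S. \<forall>y\<in>S. x \<noteq> y \<longrightarrow> \<not> ham x y \<le> s"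
    "card B \<le> card S * (2 ^ n * card Q ^ s)"
    by (elim exE conjE)
  have close: "\<bar>word_entropy Y V xs - word_entropy Y V xs'\<bar> \<le> sqrt n" if "xs \<in> B" "xs' \<in> B" for xs xs'
  proof -
    let ?a = "word_entropy Y V xs / sqrt n" and ?b = "word_entropy Y V xs' / sqrt n"
    \<comment> \<open>Nonnegativity is what lets equality of the bins pass through
      \<open>nat\<close> to equality of the floors.\<close>
    have "0 \<le> ?a" "0 \<le> ?b" using ent(1) that B(2) sq by auto
    moreover have "nat \<lfloor>?a\<rfloor> = nat \<lfloor>?b\<rfloor>" using that by (simp add: B_def bin_def)
    ultimately have "\<lfloor>?a\<rfloor> = \<lfloor>?b\<rfloor>" by (simp add: eq_nat_nat_iff)
    then have "\<bar>?a - ?b\<bar> \<le> 1" by linarith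
    then have "\<bar>(word_entropy Y V xs - word_entropy Y V xs') / sqrt n\<bar> \<le> 1" by (simp add: diff_divide_distrib)
    then show ?thesis using sq by (simp add: abs_divide)
  qed
  have "card Q ^ n \<le> card S * (2 ^ n * card Q ^ s) * Suc m"
  proof -
    have "card Q ^ n \<le> card B * Suc m" using b by (simp only: card_words[OF Q(1)] B_def)
    also have "\<dots> \<le> card S * (2 ^ n * card Q ^ s) * Suc m" by (rule mult_le_mono1[OF S(3)])
    finally show ?thesis .
  qed
  then have "real (card Q ^ n) \<le> real (card S * (2 ^ n * card Q ^ s) * Suc m)" by (rule of_nat_mono)
  then have "real (card Q) ^ n \<le> card S * (2 ^ n * real (card Q) ^ s) * real (Suc m)"
    by (simp only: of_nat_mult of_nat_power of_nat_numeral)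
  also have "\<dots> \<le> card S * (2 ^ n * real (card Q) ^ s) * (sqrt n * card Y + 1)"
  proof (rule mult_left_mono)
    have "0 \<le> sqrt n * card Y" by simp
    then have "real m \<le> sqrt n * card Y" unfolding m_def by linarith
    then show "real (Suc m) \<le> sqrt n * card Y + 1" by simp
  qed simp
  finally have size: "real (card Q) ^ n \<le> card S * (2 ^ n * real (card Q) ^ s) * (sqrt n * card Y + 1)" .
  show ?thesis
  proof (intro exI[of _ S] conjI ballI impI size)
    show "S \<subseteq> words Q n" using S(1) B(2) by (rule subset_trans)
    show "s < ham xs xs'" if "xs \<in> S" "xs' \<in> S" "xs \<noteq> xs'" for xs xs'
      using S(2) that by (simp add: not_le)
    show "\<bar>word_entropy Y V xs - word_entropy Y V xs'\<bar> \<le> sqrt n" if "xs \<in> S" "xs' \<in> S" for xs xs'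
      using that S(1) by (intro close) auto
  qed
qed

lemma totally_bdd_sqrt_hat:
  assumes cq: "cq_channel X d W" and T: "info_complete_povm d k T"
  shows "totally_bdd (euclid_dist k) (sqrt_hat_X X d W k T)"
proof (rule totally_bdd_coordinates)
  show "\<bar>p y\<bar> \<le> 1" if y: "y \<in> {..<k}" and p: "p \<in> sqrt_hat_X X d W k T" for y p
  proof -
    obtain x where x: "x \<in> space X" "p = (\<lambda>y. if y < k then sqrt (Re (mtrace (W x * T y))) else 0)"
      using p by (auto simp: sqrt_hat_X_def)
    have "density d (W x)" using cq x(1) by (simp add: cq_channel_def)
    then have st: "stochastic {..<k} (meas_prob W T) x" using T by (rule stochastic_meas_prob)
    then have "meas_prob W T x y \<le> 1" "0 \<le> meas_prob W T x y"
      using stochastic_le_1[OF _ st y] y by (auto simp: stochastic_def)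
    then show ?thesis using y by (simp add: x(2) meas_prob_def)
  qed
qed (simp_all add: euclid_dist_def)

text \<open>The finite-length bound: \<open>e1\<close> is Chebyshev's bound on rejecting the right
  codeword, \<open>e2\<close> adds the overlap of two typical sets, and the size is that of the
  Gilbert--Varshamov code over a \<open>\<delta>\<close>-packing.\<close>

lemma N_DI_sim_ge:
  fixes \<delta> a l1 l2 :: real
  assumes cq: "cq_channel X d W" and ne: "space X \<noteq> {}" and T: "info_complete_povm d k T"
    and n: "n \<ge> 1" and \<delta>: "\<delta> > 0" and a: "a > 0"
    and e1: "4 * real k * real n / a\<^sup>2 \<le> l1"
    and sn: "s \<le> n" and e2: "4 * real k * real n / a\<^sup>2 + exp (a + sqrt n / 2 - \<delta>\<^sup>2 / 2 * Suc s) \<le> l2"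
  defines "G \<equiv> cover_num (euclid_dist k) (sqrt_hat_X X d W k T) \<delta>"
  shows "\<exists>N>0. enat N \<le> N_DI_sim X d W n l1 l2 \<and>
    n * log 2 G - n - s * log 2 G - log 2 (sqrt n * k + 1) \<le> log 2 (real N)"
proof -
  define V where "V = meas_prob W T"
  define p where "p x = (\<lambda>y. if y < k then sqrt (Re (mtrace (W x * T y))) else 0)" for x
  let ?F = "sqrt_hat_X X d W k T" and ?Y = "{..<k}"
  have F: "?F = p ` space X" by (simp add: sqrt_hat_X_def p_def)
  note tb = totally_bdd_sqrt_hat[OF cq T]
  have G1: "1 \<le> G" unfolding G_def using ne by (intro cover_num_pos[OF tb \<delta>]) (simp add: F)
  obtain P where P: "finite P" "P \<subseteq> ?F" "\<And>f g. f \<in> P \<Longrightarrow> g \<in> P \<Longrightarrow> f \<noteq> g \<Longrightarrow> \<delta> < euclid_dist k f g" "G \<le> card P"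
    unfolding G_def
    by (rule packing_ge_cover_num[OF tb \<delta>]) (simp_all add: euclid_dist_def power2_commute)
  \<comment> \<open>One input letter for each packing point.\<close>
  obtain Q where Q: "Q \<subseteq> space X" "inj_on p Q" "P = p ` Q"
    using P(2) unfolding F subset_image_inj by blast
  have cQ: "card Q = card P" "finite Q" using Q P(1) by (simp_all add: card_image finite_image_iff)
  have Qne: "Q \<noteq> {}" using G1 P(4) cQ(1) by auto
  have dens: "density d (W x)" if "x \<in> space X" for x using cq that by (simp add: cq_channel_def)
  have st: "stochastic ?Y V x" if "x \<in> Q" for x
    unfolding V_def using Q(1) that by (intro stochastic_meas_prob[where d = d] dens T) auto
  have sep: "\<delta>\<^sup>2 \<le> (\<Sum>y\<in>?Y. (sqrt (V x y) - sqrt (V x' y))\<^sup>2)" if x: "x \<in> Q" "x' \<in> Q" "x \<noteq> x'" for x x'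
  proof -
    have "p x \<noteq> p x'" using x inj_onD[OF Q(2)] by blast
    then have "\<delta> < euclid_dist k (p x) (p x')" using P(3) Q(3) x by blast
    also have "\<dots> = sqrt (\<Sum>y\<in>?Y. (sqrt (V x y) - sqrt (V x' y))\<^sup>2)"
      by (simp add: euclid_dist_def p_def V_def meas_prob_def)
    finally have "\<delta>\<^sup>2 \<le> (sqrt (\<Sum>y\<in>?Y. (sqrt (V x y) - sqrt (V x' y))\<^sup>2))\<^sup>2"
      using \<delta> by (intro power_mono) auto
    then show ?thesis by (simp add: sum_nonneg)
  qed
  have "\<exists>S\<subseteq>words Q n. (\<forall>xs\<in>S. \<forall>xs'\<in>S. xs \<noteq> xs' \<longrightarrow>
      s < ham xs xs' \<and> \<bar>word_entropy ?Y V xs - word_entropy ?Y V xs'\<bar> \<le> sqrt n)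
    \<and> real (card Q) ^ n \<le> card S * (2 ^ n * real (card Q) ^ s) * (sqrt n * card ?Y + 1)"
    by (intro exists_separated_words cQ(2) Qne finite_lessThan st n)
  then obtain S where S: "S \<subseteq> words Q n"
    "\<forall>xs\<in>S. \<forall>xs'\<in>S. xs \<noteq> xs' \<longrightarrow> s < ham xs xs' \<and> \<bar>word_entropy ?Y V xs - word_entropy ?Y V xs'\<bar> \<le> sqrt n"
    "real (card Q) ^ n \<le> card S * (2 ^ n * real (card Q) ^ s) * (sqrt n * card ?Y + 1)"
    by (elim exE conjE)
  have finS: "finite S" using S(1) finite_words[OF cQ(2)] by (rule finite_subset)
  have word: "length xs = n" "\<And>x. x \<in> set xs \<Longrightarrow> x \<in> Q" if "xs \<in> S" for xs
    using S(1) that by (auto simp: words_def)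
  have "enat (card S) \<le> N_DI_sim X d W n l1 l2"
  proof (rule sim_DI_code_of_measurement[OF cq T finS])
    show "S \<subseteq> words (space X) n" using S(1) words_mono[OF Q(1)] by (rule subset_trans)
    show "typical ?Y V a xs \<subseteq> words ?Y n" if "xs \<in> S" for xs
      using word(1)[OF that] by (auto simp: typical_def)
    show "1 - l1 \<le> (\<Sum>ys\<in>typical ?Y V a xs. word_prob (meas_prob W T) xs ys)" if xs: "xs \<in> S" for xs
    proof -
      have "1 - 4 * card ?Y * length xs / a\<^sup>2 \<le> (\<Sum>ys\<in>typical ?Y V a xs. word_prob V xs ys)"
        using st word(2)[OF xs] by (intro sum_typical_ge a) auto
      then show ?thesis using e1 by (simp add: word(1)[OF xs] V_def)
    qed
    show "(\<Sum>ys\<in>typical ?Y V a xs'. word_prob (meas_prob W T) xs ys) \<le> l2"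
      if xs: "xs \<in> S" "xs' \<in> S" "xs \<noteq> xs'" for xs xs'
    proof -
      have len: "length xs = length xs'" using word(1)[OF xs(1)] word(1)[OF xs(2)] by simp
      have "s < ham xs xs'" and ent: "\<bar>word_entropy ?Y V xs - word_entropy ?Y V xs'\<bar> \<le> sqrt n"
        using S(2) xs by blast+
      \<comment> \<open>Distances are integers, so exceeding \<open>s\<close> means reaching
        \<open>Suc s\<close>, the value in the exponent of \<open>e2\<close>.\<close>
      then have ham: "real (Suc s) \<le> ham xs xs'" by linarith
      have st': "stochastic ?Y V x" if "x \<in> set xs \<union> set xs'" for x
        using that word(2)[OF xs(1)] word(2)[OF xs(2)] by (intro st) blast
      have sep': "\<delta>\<^sup>2 \<le> (\<Sum>y\<in>?Y. (sqrt (V x y) - sqrt (V x' y))\<^sup>2)"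
        if "x \<in> set xs" "x' \<in> set xs'" "x \<noteq> x'" for x x'
        using that word(2)[OF xs(1)] word(2)[OF xs(2)] by (intro sep) blast+
      have "(\<Sum>ys\<in>typical ?Y V a xs'. word_prob V xs ys) \<le> 4 * card ?Y * length xs / a\<^sup>2
        + exp (a + sqrt n / 2) * (\<Sum>ys\<in>words ?Y (length xs). sqrt (word_prob V xs ys * word_prob V xs' ys))"
        by (rule sum_other_typical_le[OF _ len st' a ent]) simp_all
      also have "(\<Sum>ys\<in>words ?Y (length xs). sqrt (word_prob V xs ys * word_prob V xs' ys)) \<le> exp (- (\<delta>\<^sup>2 / 2) * ham xs xs')"
        by (rule word_affinity_le[OF len st' sep'])
      also have "exp (- (\<delta>\<^sup>2 / 2) * ham xs xs') \<le> exp (- (\<delta>\<^sup>2 / 2) * Suc s)"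
        using ham by (simp add: mult_left_mono)
      also have "exp (a + sqrt n / 2) * exp (- (\<delta>\<^sup>2 / 2) * Suc s) = exp (a + sqrt n / 2 - \<delta>\<^sup>2 / 2 * Suc s)"
        by (simp only: exp_add[symmetric] mult_minus_left diff_conv_add_uminus)
      finally show ?thesis using e2 word(1)[OF xs(1)] by (simp add: V_def)
    qed
  qed
  moreover have "0 < card S"
  proof (rule ccontr)
    assume "\<not> 0 < card S"
    then have "real (card Q) ^ n \<le> 0" using S(3) by simp
    then show False using cQ(2) Qne by (simp add: power_le_zero_eq card_gt_0_iff)
  qed
  moreover have "n * log 2 G - n - s * log 2 G - log 2 (sqrt n * k + 1) \<le> log 2 (card S)"
  proof -
    let ?q = "real (card Q)"
    have q: "0 < ?q" "0 < real (card S)" "0 < sqrt n * k + 1"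
      using cQ(2) Qne \<open>0 < card S\<close> by (simp_all add: card_gt_0_iff add_nonneg_pos)
    have "log 2 (?q ^ n) \<le> log 2 (card S * (2 ^ n * ?q ^ s) * (sqrt n * k + 1))"
      using S(3) q by (intro log_mono) auto
    also have "\<dots> = log 2 (card S) + (n + s * log 2 ?q) + log 2 (sqrt n * k + 1)"
      using q by (simp add: log_mult log_nat_power)
    finally have 1: "n * log 2 ?q \<le> log 2 (card S) + (n + s * log 2 ?q) + log 2 (sqrt n * k + 1)"
      using q by (simp add: log_nat_power)
    \<comment> \<open>The logarithm of the alphabet size enters with factor \<open>n\<close> on one
      side and \<open>s\<close> on the other. It can be lowered to that of \<open>G\<close> only
      after collecting the nonnegative factor \<open>n - s\<close>.\<close>
    have "log 2 G \<le> log 2 ?q" using G1 P(4) cQ(1) by simp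
    then have "(real n - real s) * log 2 G \<le> (real n - real s) * log 2 ?q"
      using sn by (intro mult_left_mono) auto
    with 1 show ?thesis by (simp add: algebra_simps)
  qed
  ultimately show ?thesis by blast
qed

lemma DI_rate_lower:
  assumes cq: "cq_channel X d W" and ne: "space X \<noteq> {}" and T: "info_complete_povm d k T"
    and k: "k > 0" and l: "l1 > 0" "l2 > 0"
  shows "ereal (1/4) * lower_mink_dim (euclid_dist k) (sqrt_hat_X X d W k T)
    \<le> DI_rate (\<lambda>n. N_DI_sim X d W n l1 l2)"
  unfolding DI_rate_def
proof (rule quarter_mink_dim_le_liminf[of _ _ "real k"])
  show "totally_bdd (euclid_dist k) (sqrt_hat_X X d W k T)" by (rule totally_bdd_sqrt_hat[OF cq T])
  show "sqrt_hat_X X d W k T \<noteq> {}" using ne by (simp add: sqrt_hat_X_def)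
  show "0 < real k" using k by simp
  fix t :: real assume t: "0 < t" "t < 1"
  let ?G = "\<lambda>\<delta>. cover_num (euclid_dist k) (sqrt_hat_X X d W k T) \<delta>"
  \<comment> \<open>With \<open>a = c * sqrt n\<close> the Chebyshev error is exactly
    \<open>l\<close>: within \<open>l1\<close>, and leaving half of \<open>l2\<close> for the
    overlap term.\<close>
  define l where "l = min l1 (l2 / 2)"
  define c where "c = sqrt (4 * k / l)"
  \<comment> \<open>Chosen so that the affinity exponent
    \<open>\<delta>\<^sup>2 / 2 * (t * n)\<close> is \<open>(c + 3 / 2) * sqrt n\<close>. This
    exceeds the likelihood factor's exponent \<open>(c + 1 / 2) * sqrt n\<close> by
    \<open>sqrt n\<close>.\<close>
  define \<kappa> where "\<kappa> = sqrt (2 * (c + 3 / 2) / t)"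
  have l0: "0 < l" "l \<le> l1" "l \<le> l2 / 2" using l by (simp_all add: l_def)
  have c: "c > 0" "4 * k / c\<^sup>2 = l" using l0(1) k by (simp_all add: c_def)
  have \<kappa>: "\<kappa> > 0" "\<kappa>\<^sup>2 = 2 * (c + 3 / 2) / t" using c(1) t by (simp_all add: \<kappa>_def)
  have exp_small: "\<forall>\<^sub>F n in sequentially. exp (- sqrt (real n)) < l2 / 2"
  proof -
    have "(\<lambda>n. exp (- sqrt (real n))) \<longlonglongrightarrow> 0" by real_asymp
    then show ?thesis using l(2) by (intro order_tendstoD(2)) auto
  qed
  have "\<forall>\<^sub>F n in sequentially.
      ereal (((1 - t) * (n * log 2 (?G (\<kappa> / real n powr (1 / 4)))) - n - log 2 (sqrt n * k + 1)) / (n * log 2 n))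
      \<le> log2_enat (N_DI_sim X d W n l1 l2) / ereal (real n * log 2 (real n))"
    using exp_small eventually_ge_at_top[of 2]
  proof eventually_elim
    case (elim n)
    define \<delta> where "\<delta> = \<kappa> / real n powr (1 / 4)"
    \<comment> \<open>The floor serves both sides: \<open>Suc s\<close> is at least
      \<open>t * n\<close> in the error exponent, and \<open>s\<close> is at most
      \<open>t * n\<close> in the loss of code size.\<close>
    define s where "s = nat \<lfloor>t * n\<rfloor>"
    have n: "real n > 0" "sqrt n > 0" using elim(2) by simp_all
    have s: "real s \<le> t * n" "t * n \<le> real (Suc s)"
      using t n(1) by (simp_all add: s_def) linarith+
    have "t * real n \<le> 1 * real n" using t by (intro mult_right_mono) auto
    then have sn: "s \<le> n" using s(1) by simp
    have "(real n powr (1 / 4))\<^sup>2 = real n powr (1 / 4 + 1 / 4)"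
      by (simp only: power2_eq_square powr_add)
    also have "\<dots> = sqrt n" using n by (simp add: powr_half_sqrt)
    finally have \<delta>2: "\<delta>\<^sup>2 = \<kappa>\<^sup>2 / sqrt n" by (simp add: \<delta>_def power_divide)
    have \<delta>: "\<delta> > 0" using \<kappa>(1) n by (simp add: \<delta>_def)
    have err: "4 * real k * real n / (c * sqrt n)\<^sup>2 = l"
    proof -
      have "4 * real k * real n / (c * sqrt n)\<^sup>2 = 4 * k / c\<^sup>2" using n(1) by (simp add: power_mult_distrib)
      then show ?thesis using c(2) by simp
    qed
    have "\<delta>\<^sup>2 / 2 * Suc s \<ge> \<delta>\<^sup>2 / 2 * (t * n)" using s(2) by (intro mult_left_mono) auto
    also have "\<delta>\<^sup>2 / 2 * (t * n) = (c + 3 / 2) * (real n / sqrt n)"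
      using t n unfolding \<delta>2 \<kappa>(2) by (simp add: field_simps)
    also have "real n / sqrt n = sqrt n" using n(1) by (simp add: real_div_sqrt)
    finally have "c * sqrt n + sqrt n / 2 - \<delta>\<^sup>2 / 2 * Suc s \<le> - sqrt n"
      by (simp add: algebra_simps)
    then have "exp (c * sqrt n + sqrt n / 2 - \<delta>\<^sup>2 / 2 * Suc s) \<le> exp (- sqrt n)" by simp
    also have "\<dots> < l2 / 2" by (rule elim(1))
    finally have ex: "exp (c * sqrt n + sqrt n / 2 - \<delta>\<^sup>2 / 2 * Suc s) < l2 / 2" .
    have "\<exists>N>0. enat N \<le> N_DI_sim X d W n l1 l2 \<and>
      n * log 2 (?G \<delta>) - n - s * log 2 (?G \<delta>) - log 2 (sqrt n * k + 1) \<le> log 2 (real N)"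
    proof (rule N_DI_sim_ge[OF cq ne T _ \<delta>])
      show "1 \<le> n" "0 < c * sqrt n" "s \<le> n" using elim(2) c(1) n sn by simp_all
      show "4 * real k * real n / (c * sqrt n)\<^sup>2 \<le> l1" unfolding err by (rule l0(2))
      show "4 * real k * real n / (c * sqrt n)\<^sup>2 + exp (c * sqrt n + sqrt n / 2 - \<delta>\<^sup>2 / 2 * Suc s) \<le> l2"
        unfolding err using ex l0(3) by linarith
    qed
    then obtain N where N: "N > 0" "enat N \<le> N_DI_sim X d W n l1 l2"
      "n * log 2 (?G \<delta>) - n - s * log 2 (?G \<delta>) - log 2 (sqrt n * k + 1) \<le> log 2 (real N)"
      by (elim exE conjE)
    have G0: "0 \<le> log 2 (?G \<delta>)"
      using ne by (intro log_cover_num_nonneg[OF totally_bdd_sqrt_hat[OF cq T] \<delta>]) (simp add: sqrt_hat_X_def)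
    have "s * log 2 (?G \<delta>) \<le> t * n * log 2 (?G \<delta>)" using s(1) G0 by (rule mult_right_mono)
    with N(3) have le: "(1 - t) * (n * log 2 (?G \<delta>)) - n - log 2 (sqrt n * k + 1) \<le> log 2 (real N)"
      by (simp add: algebra_simps)
    have pos: "0 < real n * log 2 (real n)" using elim(2) by (intro mult_pos_pos) simp_all
    have "ereal (((1 - t) * (n * log 2 (?G \<delta>)) - n - log 2 (sqrt n * k + 1)) / (n * log 2 n))
        \<le> ereal (log 2 (real N) / (n * log 2 n))"
      unfolding ereal_less_eq using le pos by (intro divide_right_mono) auto
    also have "\<dots> = ereal (log 2 (real N)) / ereal (n * log 2 n)"
      by (simp only: ereal_divide less_imp_neq[OF pos, symmetric] if_False)
    also have "\<dots> \<le> log2_enat (N_DI_sim X d W n l1 l2) / ereal (n * log 2 n)"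
    proof (rule ereal_divide_right_mono)
      show "ereal (log 2 (real N)) \<le> log2_enat (N_DI_sim X d W n l1 l2)"
        using log2_enat_mono[OF N(2)] N(1) by (simp only: log2_enat_enat)
      show "0 < ereal (n * log 2 n)" by (simp only: ereal_less(2) pos)
    qed
    finally show ?case unfolding \<delta>_def .
  qed
  with \<kappa>(1) show "\<exists>\<kappa>>0. \<forall>\<^sub>F n in sequentially.
      ereal (((1 - t) * (n * log 2 (?G (\<kappa> / real n powr (1 / 4)))) - n - log 2 (sqrt n * k + 1)) / (n * log 2 n))
      \<le> log2_enat (N_DI_sim X d W n l1 l2) / ereal (real n * log 2 (real n))"
    by blast
qed

lemma N_DI_sim_le: "N_DI_sim X d W n l1 l2 \<le> N_DI X d W n l1 l2"
  unfolding N_DI_sim_def N_DI_def sim_DI_code_def by (intro Sup_subset_mono) blast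

lemma DI_rate_mono:
  assumes "\<And>n. f n \<le> g n"
  shows "DI_rate f \<le> DI_rate g"
  unfolding DI_rate_def
proof (rule Liminf_mono)
  show "\<forall>\<^sub>F n in sequentially. log2_enat (f n) / ereal (real n * log 2 (real n))
      \<le> log2_enat (g n) / ereal (real n * log 2 (real n))"
    using eventually_ge_at_top[of 2]
  proof eventually_elim
    case (elim n)
    then have "0 < real n * log 2 (real n)" by (intro mult_pos_pos) simp_all
    then show ?case by (intro ereal_divide_right_mono log2_enat_mono assms) (simp only: ereal_less(2))
  qed
qed

theorem theorem13:
  fixes X :: "'x measure" and d :: nat and W :: "'x \<Rightarrow> complex mat"
    and k :: nat and T :: "nat \<Rightarrow> complex mat" and l1 l2 :: real
  assumes "d \<ge> 1"
    and "space X \<noteq> {}"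
    and "cq_channel X d W"
    and "info_complete_povm d k T"
    and "k \<ge> d\<^sup>2"
    and "l1 > 0" and "l2 > 0" and "l1 + l2 < 1"
  shows "ereal (1/4) * lower_mink_dim (euclid_dist k) (sqrt_hat_X X d W k T) \<le> C_DI_sim_dot X d W \<and>
     C_DI_sim_dot X d W \<le> DI_rate (\<lambda>n. N_DI X d W n l1 l2) \<and>
     DI_rate (\<lambda>n. N_DI X d W n l1 l2) \<le> ereal (1/2) * lower_mink_dim hs_dist (sqrt_tilde_X X d W)"
proof (intro conjI)
  have "0 < d\<^sup>2" using assms(1) by simp
  with assms(5) have k: "k > 0" by linarith
  \<comment> \<open>The lower bound holds at every pair of positive error levels, hence for the
    infimum.\<close>
  show "ereal (1/4) * lower_mink_dim (euclid_dist k) (sqrt_hat_X X d W k T) \<le> C_DI_sim_dot X d W"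
    unfolding C_DI_sim_dot_def using DI_rate_lower[OF assms(3,2,4) k] by (intro INF_greatest) auto
  \<comment> \<open>The infimum is at most its value at the given pair of error levels, where
    simultaneous codes are compared with general ones.\<close>
  have "C_DI_sim_dot X d W \<le> DI_rate (\<lambda>n. N_DI_sim X d W n (fst (l1, l2)) (snd (l1, l2)))"
    unfolding C_DI_sim_dot_def using assms(6,7) by (intro INF_lower) simp
  also have "\<dots> \<le> DI_rate (\<lambda>n. N_DI X d W n l1 l2)"
    by (intro DI_rate_mono) (simp add: N_DI_sim_le)
  finally show "C_DI_sim_dot X d W \<le> DI_rate (\<lambda>n. N_DI X d W n l1 l2)" .
  show "DI_rate (\<lambda>n. N_DI X d W n l1 l2) \<le> ereal (1/2) * lower_mink_dim hs_dist (sqrt_tilde_X X d W)"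
    by (rule DI_rate_upper[OF assms(3,2,8)])
qed

end
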